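(* Let $N\in\mathbb{N}$, $p,q>1$, $a,b>0$, and let $G_1,G_2\in C^1(\mathbb{R})$ satisfy $G_1(0)=G_2(0)=0$, $G_1(\sigma)\ge a|\sigma|^p$ and $G_2(\sigma)\ge b|\sigma|^q$ for all $\sigma\in\mathbb{R}$. Let $f_1,g_1,f_2,g_2\in C_c^\infty(\mathbb{R}^N)$ with $\int_{\mathbb{R}^N}g_1\,dx>0$ and $\int_{\mathbb{R}^N}g_2\,dx>0$, and put $r_0=\sup\{|x|\;;\;x\in\operatorname{supp}(f_1,f_2,g_1,g_2)\}$. Assume $$\Gamma_{GG}(N,p,q)=\max\{F_{GG}(N,p,q),F_{GG}(N,q,p)\}\ge0.$$ Then there exist constants $\varepsilon_0>0$ and $C>0$, independent of $\varepsilon$, such that the following holds for every $\varepsilon\in(0,\varepsilon_0]$: if $(u,v)$ is a weak solution in $(0,T)$ of $$\begin{cases}\partial_t^2u-\Delta u=G_1(\partial_tv),\quad\partial_t^2v-\Delta v=G_2(\partial_tu)&\text{in }\mathbb{R}^N\times(0,T),\\ u(0)=\varepsilon f_1,\ \partial_tu(0)=\varepsilon g_1,\ v(0)=\varepsilon f_2,\ \partial_tv(0)=\varepsilon g_2\end{cases}$$ satisfying $\operatorname{supp}(u,v)\subset\{(x,t)\in\mathbb{R}^N\times[0,T)\;;\;|x|\le r_0+t\}$, then $$T\le\begin{cases}C\varepsilon^{-\Gamma_{GG}(N,p,q)^{-1}}&\text{if }\Gamma_{GG}(N,p,q)>0,\\ \exp(C\varepsilon^{-(pq-1)})&\text{if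 }\Gamma_{GG}(N,p,q)=0,\ p\ne q,\\ \exp(C\varepsilon^{-(p-1)})&\text{if }\Gamma_{GG}(N,p,q)=0,\ p=q.\end{cases}$$
   Context: Set $F_{GG}(N,p,q)=\frac{p+1}{pq-1}-\frac{N-1}{2}$. Weak solution in $(0,T)$: a pair $(u,v)\in C([0,T);(H^1(\mathbb{R}^N))^2)\cap C^1([0,T);(L^2(\mathbb{R}^N))^2)$ with $G_2(\partial_tu),G_1(\partial_tv)\in L^1(0,T;L^1(\mathbb{R}^N))$, $(u,v)(0)=(\varepsilon f_1,\varepsilon f_2)$, $(\partial_tu,\partial_tv)(0)=(\varepsilon g_1,\varepsilon g_2)$, such that for every $\Psi\in C_c^\infty(\mathbb{R}^N\times[0,T))$, $$\varepsilon\int_{\mathbb{R}^N}g_1\Psi(x,0)\,dx+\int_0^T\!\!\int_{\mathbb{R}^N}G_1(\partial_tv)\Psi\,dx\,dt=\int_0^T\!\!\int_{\mathbb{R}^N}(-\partial_tu\,\partial_t\Psi+\nabla u\cdot\nabla\Psi)\,dx\,dt,$$ $$\varepsilon\int_{\mathbb{R}^N}g_2\Psi(x,0)\,dx+\int_0^T\!\!\int_{\mathbb{R}^N}G_2(\partial_tu)\Psi\,dx\,dt=\int_0^T\!\!\int_{\mathbb{R}^N}(-\partial_tv\,\partial_t\Psi+\nabla v\cdot\nabla\Psi)\,dx\,dt.$$ *)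

theory Defs
  imports "HOL-Analysis.Analysis"
begin

text \<open>
  Elements of \<open>L\<^sup>2\<close>, \<open>H\<^sup>1\<close>, etc. are represented by Lebesgue measurable functions, and equalities
  between them hold almost everywhere. A function of space and time is represented in curried form
  \<open>u :: real \<Rightarrow> 'a \<Rightarrow> real\<close>, where \<open>u t\<close> is a representative of the class \<open>u(t)\<close>. The end
  time \<open>T\<close> is an extended real, so that \<open>T = \<infinity>\<close> is allowed.
\<close>

subsection \<open>Smooth functions, supports\<close>

primrec Ck :: "nat \<Rightarrow> ('a::euclidean_space \<Rightarrow> real) \<Rightarrow> bool" where
  "Ck 0 f \<longleftrightarrow> continuous_on UNIV f"
| "Ck (Suc k) f \<longleftrightarrow>
     (\<forall>x. f differentiable (at x)) \<and> (\<forall>b\<in>Basis. Ck k (\<lambda>x. frechet_derivative f (at x) b))"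

definition smooth :: "('a::euclidean_space \<Rightarrow> real) \<Rightarrow> bool" where
  "smooth f \<longleftrightarrow> (\<forall>k. Ck k f)"

definition supp :: "('a::topological_space \<Rightarrow> real) \<Rightarrow> 'a set" where
  "supp f = closure {x. f x \<noteq> 0}"

definition Cc_infty :: "('a::euclidean_space \<Rightarrow> real) set" where
  "Cc_infty = {f. smooth f \<and> compact (supp f)}"

definition grad :: "('a::euclidean_space \<Rightarrow> real) \<Rightarrow> 'a \<Rightarrow> 'a" where
  "grad f x = (\<Sum>b\<in>Basis. frechet_derivative f (at x) b *\<^sub>R b)"

definition time_interval :: "ereal \<Rightarrow> real set" where
  "time_interval T = {t. 0 \<le> t \<and> ereal t < T}"

text \<open>
  Members of \<open>C\<^sub>c\<^sup>\<infinity>(\<real>\<^sup>N \<times> [0,T))\<close> are the restrictions to \<open>t \<ge> 0\<close> of smooth functions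
  on the whole space-time with compact support in \<open>{t < T}\<close>; no vanishing at \<open>t = 0\<close> is required.
  Only the values for \<open>t \<ge> 0\<close> enter the weak formulation.
\<close>

definition spacetime_test :: "ereal \<Rightarrow> ('a::euclidean_space \<times> real \<Rightarrow> real) set" where
  "spacetime_test T = {\<Psi>. \<Psi> \<in> Cc_infty \<and> supp \<Psi> \<subseteq> {(x, t). ereal t < T}}"

text \<open>
  The support of the class represented by \<open>u\<close>, relative to \<open>\<real>\<^sup>N \<times> [0,T)\<close>: the complement
  of the largest relatively open set on which \<open>u\<close> vanishes almost everywhere. For
  \<open>u \<in> C([0,T);L\<^sup>2)\<close>, vanishing a.e. in \<open>(x,t)\<close> on a product set is the same as vanishing
  a.e. in \<open>x\<close> for every \<open>t\<close>.
\<close>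

definition spacetime_supp :: "ereal \<Rightarrow> (real \<Rightarrow> 'a::euclidean_space \<Rightarrow> real) \<Rightarrow> ('a \<times> real) set" where
  "spacetime_supp T u = {(x, t). t \<in> time_interval T \<and>
     \<not> (\<exists>\<delta>>0. \<forall>s\<in>time_interval T. \<bar>s - t\<bar> < \<delta> \<longrightarrow>
            (AE y in lebesgue. y \<in> ball x \<delta> \<longrightarrow> u s y = 0))}"

subsection \<open>Function spaces\<close>

definition L2 :: "('a::euclidean_space \<Rightarrow> 'b::euclidean_space) set" where
  "L2 = {f. f \<in> borel_measurable lebesgue \<and> integrable lebesgue (\<lambda>x. (norm (f x))\<^sup>2)}"

definition L2_norm :: "('a::euclidean_space \<Rightarrow> 'b::euclidean_space) \<Rightarrow> real" where
  "L2_norm f = sqrt (\<integral>x. (norm (f x))\<^sup>2 \<partial>lebesgue)"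

definition has_weak_gradient :: "('a::euclidean_space \<Rightarrow> real) \<Rightarrow> ('a \<Rightarrow> 'a) \<Rightarrow> bool" where
  "has_weak_gradient f F \<longleftrightarrow> (\<forall>\<phi>\<in>Cc_infty. \<forall>b\<in>Basis.
     (\<integral>x. f x * (grad \<phi> x \<bullet> b) \<partial>lebesgue) = - (\<integral>x. (F x \<bullet> b) * \<phi> x \<partial>lebesgue))"

definition continuous_L2 :: "real set \<Rightarrow> (real \<Rightarrow> 'a::euclidean_space \<Rightarrow> 'b::euclidean_space) \<Rightarrow> bool" where
  "continuous_L2 J w \<longleftrightarrow> (\<forall>t\<in>J. w t \<in> L2 \<and>
     ((\<lambda>s. L2_norm (\<lambda>x. w s x - w t x)) \<longlongrightarrow> 0) (at t within J))"

text \<open>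
  \<open>w \<in> C(J;H\<^sup>1)\<close> with spatial weak gradient \<open>Dw\<close>. As the squared \<open>H\<^sup>1\<close> norm is the sum of the
  squared \<open>L\<^sup>2\<close> norms of the function and of its gradient, continuity in \<open>H\<^sup>1\<close> is continuity of both
  in \<open>L\<^sup>2\<close>.
\<close>

definition continuous_H1 ::
  "real set \<Rightarrow> (real \<Rightarrow> 'a::euclidean_space \<Rightarrow> real) \<Rightarrow> (real \<Rightarrow> 'a \<Rightarrow> 'a) \<Rightarrow> bool" where
  "continuous_H1 J w Dw \<longleftrightarrow> continuous_L2 J w \<and> continuous_L2 J Dw \<and>
     (\<forall>t\<in>J. has_weak_gradient (w t) (Dw t))"

text \<open>
  \<open>w \<in> C\<^sup>1(J;L\<^sup>2)\<close> with time derivative \<open>w'\<close>; the derivative is one-sided at an end point in \<open>J\<close>.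
\<close>

definition C1_L2 ::
  "real set \<Rightarrow> (real \<Rightarrow> 'a::euclidean_space \<Rightarrow> real) \<Rightarrow> (real \<Rightarrow> 'a \<Rightarrow> real) \<Rightarrow> bool" where
  "C1_L2 J w w' \<longleftrightarrow> continuous_L2 J w \<and> continuous_L2 J w' \<and>
     (\<forall>t\<in>J. ((\<lambda>s. L2_norm (\<lambda>x. (w s x - w t x) / (s - t) - w' t x)) \<longlongrightarrow> 0) (at t within J))"

text \<open>
  The Bochner space \<open>L\<^sup>1(J;L\<^sup>1)\<close>: strong measurability (an a.e. limit, in \<open>L\<^sup>1\<close>, of simple
  functions) and integrability of the norm.
\<close>

definition L1_simple :: "(real \<Rightarrow> 'a::euclidean_space \<Rightarrow> real) \<Rightarrow> bool" where
  "L1_simple s \<longleftrightarrow> (\<exists>(m::nat) A h.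
     (\<forall>k<m. A k \<in> sets lebesgue \<and> integrable lebesgue (h k)) \<and>
     (\<forall>t x. s t x = (\<Sum>k<m. indicator (A k) t * h k x)))"

definition Bochner_L1_L1 :: "real set \<Rightarrow> (real \<Rightarrow> 'a::euclidean_space \<Rightarrow> real) \<Rightarrow> bool" where
  "Bochner_L1_L1 J F \<longleftrightarrow>
     (\<exists>s. (\<forall>n. L1_simple (s n)) \<and>
        (AE t in lebesgue. t \<in> J \<longrightarrow> integrable lebesgue (F t) \<and>
           (\<lambda>n. \<integral>x. \<bar>s n t x - F t x\<bar> \<partial>lebesgue) \<longlonglongrightarrow> 0)) \<and>
     set_integrable lebesgue J (\<lambda>t. \<integral>x. \<bar>F t x\<bar> \<partial>lebesgue)"

subsection \<open>Weak solutions\<close>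

text \<open>
  The weak form of \<open>\<partial>\<^sub>t\<^sup>2w - \<Delta>w = F\<close> with initial velocity \<open>w\<^sub>1\<close>, where \<open>wt\<close> and \<open>Dw\<close> are the time
  derivative and the spatial gradient of \<open>w\<close>.
\<close>

definition weak_wave_eq ::
  "ereal \<Rightarrow> (real \<Rightarrow> 'a::euclidean_space \<Rightarrow> real) \<Rightarrow> (real \<Rightarrow> 'a \<Rightarrow> 'a) \<Rightarrow>
   (real \<Rightarrow> 'a \<Rightarrow> real) \<Rightarrow> ('a \<Rightarrow> real) \<Rightarrow> bool" where
  "weak_wave_eq T wt Dw F w\<^sub>1 \<longleftrightarrow> (\<forall>\<Psi>\<in>spacetime_test T.
     (\<integral>x. w\<^sub>1 x * \<Psi> (x, 0) \<partial>lebesgue) +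
     (LINT t:time_interval T|lebesgue. \<integral>x. F t x * \<Psi> (x, t) \<partial>lebesgue) =
     (LINT t:time_interval T|lebesgue.
        \<integral>x. - wt t x * deriv (\<lambda>s. \<Psi> (x, s)) t + Dw t x \<bullet> grad (\<lambda>y. \<Psi> (y, t)) x \<partial>lebesgue))"

text \<open>
  The time derivatives and gradients of \<open>u\<close> and \<open>v\<close> are unique up to null sets, so it does not matter
  which representatives are chosen.
\<close>

definition weak_solution ::
  "(real \<Rightarrow> real) \<Rightarrow> (real \<Rightarrow> real) \<Rightarrow> real \<Rightarrow>
   ('a::euclidean_space \<Rightarrow> real) \<Rightarrow> ('a \<Rightarrow> real) \<Rightarrow> ('a \<Rightarrow> real) \<Rightarrow> ('a \<Rightarrow> real) \<Rightarrow>
   ereal \<Rightarrow> (real \<Rightarrow> 'a \<Rightarrow> real) \<Rightarrow> (real \<Rightarrow> 'a \<Rightarrow> real) \<Rightarrow> bool" where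
  "weak_solution G\<^sub>1 G\<^sub>2 \<epsilon> f\<^sub>1 g\<^sub>1 f\<^sub>2 g\<^sub>2 T u v \<longleftrightarrow> 0 < T \<and> (\<exists>ut Du vt Dv.
     continuous_H1 (time_interval T) u Du \<and> C1_L2 (time_interval T) u ut \<and>
     continuous_H1 (time_interval T) v Dv \<and> C1_L2 (time_interval T) v vt \<and>
     Bochner_L1_L1 (time_interval T) (\<lambda>t x. G\<^sub>2 (ut t x)) \<and>
     Bochner_L1_L1 (time_interval T) (\<lambda>t x. G\<^sub>1 (vt t x)) \<and>
     (AE x in lebesgue. u 0 x = \<epsilon> * f\<^sub>1 x) \<and> (AE x in lebesgue. ut 0 x = \<epsilon> * g\<^sub>1 x) \<and>
     (AE x in lebesgue. v 0 x = \<epsilon> * f\<^sub>2 x) \<and> (AE x in lebesgue. vt 0 x = \<epsilon> * g\<^sub>2 x) \<and>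
     weak_wave_eq T ut Du (\<lambda>t x. G\<^sub>1 (vt t x)) (\<lambda>x. \<epsilon> * g\<^sub>1 x) \<and>
     weak_wave_eq T vt Dv (\<lambda>t x. G\<^sub>2 (ut t x)) (\<lambda>x. \<epsilon> * g\<^sub>2 x))"

subsection \<open>The critical exponent\<close>

definition F_GG :: "nat \<Rightarrow> real \<Rightarrow> real \<Rightarrow> real" where
  "F_GG N p q = (p + 1) / (p * q - 1) - (real N - 1) / 2"

definition \<Gamma>_GG :: "nat \<Rightarrow> real \<Rightarrow> real \<Rightarrow> real" where
  "\<Gamma>_GG N p q = max (F_GG N p q) (F_GG N q p)"

end

theory Submission
  imports Defs "HOL-Real_Asymp.Real_Asymp"
begin

text \<open>
  The test function is a single plane wave: for a coordinate vector \<open>e\<close> and small \<open>\<nu> > 0\<close>, the function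
  \<open>exp (\<nu> (x \<bullet> e))\<close> is a positive eigenfunction of the Laplacian, and multiplied by \<open>exp (- \<nu> t)\<close> it has
  mass of order \<open>(1 + t)\<^sup>m\<close>, \<open>m = (N - 1) / 2\<close>, on the ball of radius \<open>r\<^sub>0 + t\<close>. Testing the
  equations against it times \<open>cosh (\<nu> (t - s))\<close>, cut off at \<open>s = t\<close>, expresses
  \<open>A(t) = exp (- \<nu> t) \<integral> \<partial>\<^sub>tu exp (\<nu> (x \<bullet> e))\<close> by Duhamel's formula, and Jensen's inequality bounds the source
  term from below. So \<open>A\<close> and its analogue for \<open>v\<close> dominate a solution of
  \<open>X' \<ge> \<kappa> t\<^bsup>-m(p-1)\<^esup> Y\<^sup>p\<close>, \<open>Y' \<ge> \<kappa> t\<^bsup>-m(q-1)\<^esup> X\<^sup>q\<close> whose data at time 1 are of size \<open>\<epsilon>\<close>.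

  By the arithmetic-geometric mean inequality, \<open>X\<^bsup>-(q-1)/2\<^esup> Y\<^bsup>-(p-1)/2\<^esup>\<close> decreases at least at the rate
  \<open>t\<^bsup>-m((p+q)/2-1)\<^esup>\<close>. Hence a solution with \<open>X(\<tau>) \<ge> \<xi> \<tau>\<^bsup>m-k\<^esup>\<close>, \<open>k = (p+1)/(pq-1)\<close>, for a large
  constant \<open>\<xi>\<close>, does not reach time \<open>4 \<tau>\<close>. L1f \<open>k > m\<close>, the trivial bound \<open>X \<ge> X(1)\<close> makes \<open>X\<close> this large; if
  \<open>k = m\<close>, comparison with the blow-up solution of \<open>x' = c x\<^bsup>pq\<^esup>\<close> in logarithmic time does; if moreover
  \<open>p = q\<close>, the decay of the monotone quantity from time 1 on gives the sharper bound directly.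
\<close>

section \<open>Blow-up for a pair of differential inequalities\<close>

text \<open>The sources control only the time derivatives, whereas the weak equation also contains
  the pairing of the solution itself, whose sign is unknown. The factor
  \<open>cosh (\<nu> * (t - s))\<close> solves the dual equation in time and has slope zero at
  \<open>s = t\<close>. Testing therefore leaves the velocity at time \<open>t\<close> and, of the
  solution itself, only the initial value. That value carries a factor \<nu>, which is why \<nu> is
  taken small: in the limit \<nu> to 0 the positive mean of the initial velocity dominates.

  The sources are merely integrable in time, so \<open>A\<close> satisfies an integral inequality
  and is not known to be differentiable. The functions \<open>X\<close> and \<open>Y\<close> are
  minorants built from continuous lower bounds of the sources, and the differential inequalities
  hold for them.

  In the critical case with \<open>p\<close> different from \<open>q\<close>, the decay rate of the
  monotone quantity is integrable at infinity, so starting it at time 1 bounds nothing. The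
  comparison function serves to bring \<open>X\<close> to a fixed size, from which one further
  factor 4 in time suffices.\<close>

lemma nondecreasing_if_deriv_nonneg:
  fixes f :: "real \<Rightarrow> real"
  assumes "a \<le> b" and "continuous_on {a..b} f"
    and "\<And>x. a < x \<Longrightarrow> x < b \<Longrightarrow> \<exists>D\<ge>0. (f has_real_derivative D) (at x)"
  shows "f a \<le> f b"
proof (cases "a = b")
  case False
  with assms(1) have ab: "a < b" by simp
  have "\<exists>l z. a < z \<and> z < b \<and> (f has_real_derivative l) (at z) \<and> f b - f a = (b - a) * l"
    by (rule MVT[OF ab assms(2)]) (use assms(3) real_differentiable_def in blast)
  then obtain l z where z: "a < z" "z < b" "(f has_real_derivative l) (at z)" "f b - f a = (b - a) * l"
    by blast
  then have "l \<ge> 0"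
    using assms(3)[of z] DERIV_unique by blast
  then show ?thesis
    using z(4) ab by (smt (verit) mult_nonneg_nonneg)
qed simp

text \<open>Up to the first point where \<open>min (\<phi> x) (\<psi> x)\<close> fails to be
  positive, both functions are nondecreasing, so even there they dominate their positive initial
  values. Monotonicity is assumed only while both are positive because in a coupled comparison each
  gap controls the derivative of the other.\<close>

lemma simultaneously_positive:
  fixes \<phi> \<psi> :: "real \<Rightarrow> real"
  assumes cont: "continuous_on {a..b} \<phi>" "continuous_on {a..b} \<psi>"
    and init: "\<phi> a > 0" "\<psi> a > 0"
    and d\<phi>: "\<And>x. a < x \<Longrightarrow> x < b \<Longrightarrow> \<phi> x > 0 \<Longrightarrow> \<psi> x > 0 \<Longrightarrow> \<exists>D\<ge>0. (\<phi> has_real_derivative D) (at x)"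
    and d\<psi>: "\<And>x. a < x \<Longrightarrow> x < b \<Longrightarrow> \<phi> x > 0 \<Longrightarrow> \<psi> x > 0 \<Longrightarrow> \<exists>D\<ge>0. (\<psi> has_real_derivative D) (at x)"
    and t: "a \<le> t" "t \<le> b"
  shows "\<phi> t > 0"
proof (rule ccontr)
  assume neg: "\<not> \<phi> t > 0"
  define B where "B = {a..b} \<inter> (\<lambda>x. min (\<phi> x) (\<psi> x)) -` {..0}"
  have clB: "closed B"
    unfolding B_def
    by (rule continuous_closed_preimage) (auto intro!: continuous_intros cont)
  have tB: "t \<in> B" using neg t by (auto simp: B_def)
  have bdd: "bdd_below B" by (auto simp: B_def)
  define s where "s = Inf B"
  have sB: "s \<in> B" unfolding s_def
    by (rule closed_contains_Inf) (use tB bdd clB in auto)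
  have before: "\<phi> x > 0 \<and> \<psi> x > 0" if "a \<le> x" "x < s" for x
  proof (rule ccontr)
    assume "\<not> ?thesis"
    then have "x \<in> B" using that sB by (auto simp: B_def)
    then show False using cInf_lower[OF _ bdd, of x] that s_def by simp
  qed
  have ss: "a \<le> s" "s \<le> b" using sB by (auto simp: B_def)
  have "\<phi> a \<le> \<phi> s"
    by (rule nondecreasing_if_deriv_nonneg)
      (use ss before d\<phi> in \<open>auto intro: continuous_on_subset[OF cont(1)]\<close>)
  moreover have "\<psi> a \<le> \<psi> s"
    by (rule nondecreasing_if_deriv_nonneg)
      (use ss before d\<psi> in \<open>auto intro: continuous_on_subset[OF cont(2)]\<close>)
  ultimately show False using sB init by (auto simp: B_def)
qed

lemma powr_monomial_small:
  fixes e A B :: real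
  assumes "e > 0" "B > 0"
  shows "\<exists>\<xi>>0. A * \<xi> powr (- e) < B"
proof -
  have "((\<lambda>\<xi>. A * \<xi> powr (- e)) \<longlongrightarrow> A * 0) at_top"
    by (intro tendsto_intros tendsto_neg_powr) (use assms in \<open>auto simp: filterlim_ident\<close>)
  then have "eventually (\<lambda>\<xi>. A * \<xi> powr (- e) < B) at_top"
    using assms(2) by (auto dest: order_tendstoD(2))
  with eventually_gt_at_top[of 0] have "eventually (\<lambda>\<xi>. \<xi> > 0 \<and> A * \<xi> powr (- e) < B) at_top"
    by eventually_elim auto
  then show ?thesis by (auto dest: eventually_happens)
qed

section \<open>The coupled differential inequalities and their decreasing functional\<close>

text \<open>Time is one plus the time of the wave equation, which makes the weights pure powers. The
  weight \<open>t powr (- (m * (p - 1)))\<close> is the price of Jensen's inequality for a test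
  function with mass of order \<open>t powr m\<close>. Positivity is included because negative
  powers of both functions are taken.\<close>

definition ode_supersolution :: "real \<Rightarrow> real \<Rightarrow> real \<Rightarrow> real \<Rightarrow> real \<Rightarrow> (real \<Rightarrow> real) \<Rightarrow> (real \<Rightarrow> real) \<Rightarrow> bool" where
  "ode_supersolution p q K m S X Y \<longleftrightarrow>
     continuous_on {1..S} X \<and> continuous_on {1..S} Y \<and> (\<forall>t\<in>{1..S}. X t > 0 \<and> Y t > 0) \<and>
     (\<forall>t\<in>{1<..<S}. \<exists>D. (X has_real_derivative D) (at t) \<and> D \<ge> K * t powr (- (m * (p - 1))) * Y t powr p) \<and>
     (\<forall>t\<in>{1<..<S}. \<exists>D. (Y has_real_derivative D) (at t) \<and> D \<ge> K * t powr (- (m * (q - 1))) * X t powr q)"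

lemma ode_supersolution_swap:
  "ode_supersolution p q K m S X Y \<Longrightarrow> ode_supersolution q p K m S Y X"
  by (auto simp: ode_supersolution_def)

context
  fixes p q K m :: real
  assumes p: "p > 1" and q: "q > 1" and K: "K > 0" and m: "m \<ge> 0"
begin

lemma pq_gt_1: "p * q > 1"
  by (rule less_1_mult[OF p q])

lemma ode_nondecreasing:
  assumes "ode_supersolution p q K m S X Y" "1 \<le> s" "s \<le> t" "t \<le> S"
  shows "X s \<le> X t"
proof (rule nondecreasing_if_deriv_nonneg[OF assms(3)])
  show "continuous_on {s..t} X"
    using assms by (auto simp: ode_supersolution_def intro: continuous_on_subset)
  fix x assume x: "s < x" "x < t"
  then obtain D where "(X has_real_derivative D) (at x)" "D \<ge> K * x powr (- (m * (p - 1))) * Y x powr p"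
    using assms by (force simp: ode_supersolution_def)
  moreover have "K * x powr (- (m * (p - 1))) * Y x powr p \<ge> 0" using K by simp
  ultimately show "\<exists>D\<ge>0. (X has_real_derivative D) (at x)" by (meson order_trans)
qed

text \<open>The halves in the exponents are dictated by the arithmetic-geometric mean inequality.
  The logarithmic derivative contains one term with the ratio Y/X and one with X/Y; in their
  geometric mean the ratios cancel and the reciprocal of the functional remains. The resulting rate
  is independent of the solution.\<close>

definition lyapunov :: "(real \<Rightarrow> real) \<Rightarrow> (real \<Rightarrow> real) \<Rightarrow> real \<Rightarrow> real" where
  "lyapunov X Y t = X t powr (- ((q - 1) / 2)) * Y t powr (- ((p - 1) / 2))"

text \<open>\<open>K\<close> times twice the geometric mean of the exponents
  \<open>(q - 1) / 2\<close> and \<open>(p - 1) / 2\<close>.\<close>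

definition lyapunov_rate :: real where
  "lyapunov_rate = K * sqrt ((q - 1) * (p - 1))"

lemma lyapunov_rate_pos: "lyapunov_rate > 0"
  using p q K by (auto simp: lyapunov_rate_def)

lemma lyapunov_deriv:
  assumes sys: "ode_supersolution p q K m S X Y" and t: "1 < t" "t < S"
  shows "\<exists>D. (lyapunov X Y has_real_derivative D) (at t) \<and>
           D \<le> - lyapunov_rate * t powr (- (m * ((p + q) / 2 - 1)))"
proof -
  define \<alpha> \<beta> where "\<alpha> = (q - 1) / 2" and "\<beta> = (p - 1) / 2"
  have ab: "\<alpha> > 0" "\<beta> > 0" using p q by (auto simp: \<alpha>_def \<beta>_def)
  obtain D1 where D1: "(X has_real_derivative D1) (at t)" "D1 \<ge> K * t powr (- (m * (p - 1))) * Y t powr p"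
    using sys t by (force simp: ode_supersolution_def)
  obtain D2 where D2: "(Y has_real_derivative D2) (at t)" "D2 \<ge> K * t powr (- (m * (q - 1))) * X t powr q"
    using sys t by (force simp: ode_supersolution_def)
  have X: "X t > 0" and Y: "Y t > 0" using sys t by (auto simp: ode_supersolution_def)
  \<comment> \<open>\<open>A * B\<close> is the reciprocal of the functional. The squares of
    \<open>A\<close>, \<open>B\<close> and, below, of \<open>r\<close> and \<open>r'\<close> are the
    factors occurring in the two differential inequalities.\<close>
  define A B where "A = X t powr \<alpha>" and "B = Y t powr \<beta>"
  have AB: "A > 0" "B > 0" using X Y by (auto simp: A_def B_def)
  have Yp: "Y t powr p = Y t * B\<^sup>2"
  proof -
    have "B\<^sup>2 = Y t powr (p - 1)" using Y by (simp add: B_def \<beta>_def power2_eq_square powr_add[symmetric])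
    then show ?thesis using Y by (simp add: powr_mult_base)
  qed
  have Xq: "X t powr q = X t * A\<^sup>2"
  proof -
    have "A\<^sup>2 = X t powr (q - 1)" using X by (simp add: A_def \<alpha>_def power2_eq_square powr_add[symmetric])
    then show ?thesis using X by (simp add: powr_mult_base)
  qed
  define r where "r = t powr (- (m * \<beta>))"
  define r' where "r' = t powr (- (m * \<alpha>))"
  have r: "r > 0" "r' > 0" using t by (auto simp: r_def r'_def)
  have rr: "t powr (- (m * (p - 1))) = r\<^sup>2" "t powr (- (m * (q - 1))) = r'\<^sup>2"
    "t powr (- (m * ((p + q) / 2 - 1))) = r * r'"
    unfolding r_def r'_def \<alpha>_def \<beta>_def power2_eq_square powr_add[symmetric]
    by (rule arg_cong[where f="\<lambda>x. t powr x"], simp add: field_simps)+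
  have d: "(lyapunov X Y has_real_derivative
      (X t powr (- \<alpha>) * (- \<alpha> * (D1 / X t))) * Y t powr (- \<beta>) + (Y t powr (- \<beta>) * (- \<beta> * (D2 / Y t))) * X t powr (- \<alpha>)) (at t)"
    unfolding lyapunov_def[abs_def] \<alpha>_def[symmetric] \<beta>_def[symmetric]
    by (rule DERIV_mult DERIV_powr[THEN DERIV_cong] derivative_eq_intros D1 D2 X Y refl | simp)+
  have eq: "(X t powr (- \<alpha>) * (- \<alpha> * (D1 / X t))) * Y t powr (- \<beta>) + (Y t powr (- \<beta>) * (- \<beta> * (D2 / Y t))) * X t powr (- \<alpha>)
     = - (\<alpha> * D1 / X t + \<beta> * D2 / Y t) / (A * B)"
    using X Y AB by (simp add: powr_minus A_def B_def field_simps)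
  have "\<alpha> * D1 / X t + \<beta> * D2 / Y t \<ge> \<alpha> * (K * r\<^sup>2 * (Y t * B\<^sup>2)) / X t + \<beta> * (K * r'\<^sup>2 * (X t * A\<^sup>2)) / Y t"
    using D1(2) D2(2) X Y ab unfolding rr Yp Xq
    by (intro add_mono divide_right_mono mult_left_mono) auto
  also have "\<alpha> * (K * r\<^sup>2 * (Y t * B\<^sup>2)) / X t + \<beta> * (K * r'\<^sup>2 * (X t * A\<^sup>2)) / Y t
      = K * (\<alpha> * (r * B)\<^sup>2 * (Y t / X t) + \<beta> * (r' * A)\<^sup>2 * (X t / Y t))"
    by (simp add: field_simps power_mult_distrib)
  finally have low: "\<alpha> * D1 / X t + \<beta> * D2 / Y t \<ge> \<dots>" .
  have "\<alpha> * (r * B)\<^sup>2 * (Y t / X t) + \<beta> * (r' * A)\<^sup>2 * (X t / Y t) \<ge> 2 * (sqrt (\<alpha> * \<beta>) * (r * B) * (r' * A))"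
  proof -
    \<comment> \<open>With \<open>z\<close> the root of the ratio, the two terms become squares
      whose cross term no longer contains \<open>z\<close>.\<close>
    define z where "z = sqrt (Y t / X t)"
    have z: "z > 0" "Y t / X t = z\<^sup>2" "X t / Y t = (1 / z)\<^sup>2"
      using X Y by (auto simp: z_def power_divide)
    have "0 \<le> (sqrt \<alpha> * (r * B) * z - sqrt \<beta> * (r' * A) * (1 / z))\<^sup>2" by simp
    also have "\<dots> = \<alpha> * (r * B)\<^sup>2 * z\<^sup>2 + \<beta> * (r' * A)\<^sup>2 * (1/z)\<^sup>2 - 2 * (sqrt \<alpha> * sqrt \<beta> * (r * B) * (r' * A)) * (z * (1 / z))"
      using ab by (simp only: power2_diff power_mult_distrib real_sqrt_pow2 order_less_imp_le) (simp add: mult_ac)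
    finally show ?thesis using z ab by (simp add: real_sqrt_mult)
  qed
  with low have "\<alpha> * D1 / X t + \<beta> * D2 / Y t \<ge> K * (2 * (sqrt (\<alpha> * \<beta>) * (r * B) * (r' * A)))"
    using K by (smt (verit) mult_left_mono)
  moreover have "K * (2 * (sqrt (\<alpha> * \<beta>) * (r * B) * (r' * A))) = lyapunov_rate * (r * r') * (A * B)"
  proof -
    have "sqrt ((q - 1) * (p - 1)) = sqrt (4 * (\<alpha> * \<beta>))" by (simp add: \<alpha>_def \<beta>_def)
    then have "sqrt ((q - 1) * (p - 1)) = 2 * sqrt (\<alpha> * \<beta>)" by (simp add: real_sqrt_mult)
    then show ?thesis by (simp add: lyapunov_rate_def)
  qed
  ultimately have "lyapunov_rate * (r * r') * (A * B) \<le> \<alpha> * D1 / X t + \<beta> * D2 / Y t"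
    by simp
  then have "lyapunov_rate * (r * r') \<le> (\<alpha> * D1 / X t + \<beta> * D2 / Y t) / (A * B)"
    using AB by (subst pos_le_divide_eq) auto
  with d[unfolded eq] show ?thesis unfolding rr
    by (intro exI[of _ "- (\<alpha> * D1 / X t + \<beta> * D2 / Y t) / (A * B)"]) (simp only: minus_divide_left[symmetric] mult_minus_left mult_minus_right neg_le_iff_le simp_thms)
qed

lemma continuous_on_lyapunov:
  assumes "ode_supersolution p q K m S X Y"
  shows "continuous_on {1..S} (lyapunov X Y)"
  unfolding lyapunov_def[abs_def]
  by (intro continuous_intros) (use assms in \<open>force simp: ode_supersolution_def\<close>)+

lemma lyapunov_nonneg: "lyapunov X Y t \<ge> 0"
  by (simp add: lyapunov_def)

text \<open>The functional is still nonnegative at \<open>t\<close>, so at \<open>s\<close> it must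
  exceed everything it loses in between. The rate is a nonpositive power of time, hence smallest at
  the right end \<open>t\<close>.\<close>

lemma lyapunov_lower:
  assumes sys: "ode_supersolution p q K m S X Y" and st: "1 \<le> s" "s \<le> t" "t \<le> S"
  shows "lyapunov X Y s \<ge> lyapunov_rate * t powr (- (m * ((p + q) / 2 - 1))) * (t - s)"
proof -
  let ?c = "lyapunov_rate * t powr (- (m * ((p + q) / 2 - 1)))"
  have "- lyapunov X Y s - ?c * s \<le> - lyapunov X Y t - ?c * t"
  proof (rule nondecreasing_if_deriv_nonneg[OF st(2)])
    show "continuous_on {s..t} (\<lambda>x. - lyapunov X Y x - ?c * x)"
      by (intro continuous_intros continuous_on_subset[OF continuous_on_lyapunov[OF sys]]) (use st in auto)
    fix x assume x: "s < x" "x < t"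
    then obtain D where D: "(lyapunov X Y has_real_derivative D) (at x)"
        "D \<le> - lyapunov_rate * x powr (- (m * ((p + q) / 2 - 1)))"
      using lyapunov_deriv[OF sys, of x] st by auto
    have "t powr (- (m * ((p + q) / 2 - 1))) \<le> x powr (- (m * ((p + q) / 2 - 1)))"
      using x st p q m by (intro powr_mono2') auto
    then have "?c \<le> lyapunov_rate * x powr (- (m * ((p + q) / 2 - 1)))"
      using lyapunov_rate_pos by simp
    with D show "\<exists>D\<ge>0. ((\<lambda>x. - lyapunov X Y x - ?c * x) has_real_derivative D) (at x)"
      by (intro exI[of _ "- D - ?c"]) (auto intro!: derivative_eq_intros)
  qed
  then show ?thesis using lyapunov_nonneg[of X Y t] by (simp add: algebra_simps)
qed

text \<open>With k = (p+1)/(pq-1) and l = (q+1)/(pq-1), the powers -k and -l of the remaining time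
  balance the unweighted system x' = y^p, y' = x^q: this is the second and third identity. The first
  says that along such a profile \<open>lyapunov\<close> vanishes linearly at the blow-up
  time.\<close>

lemma scaling_exponents:
  "(q - 1) / 2 * ((p + 1) / (p * q - 1)) + (p - 1) / 2 * ((q + 1) / (p * q - 1)) = 1"
  "q * ((p + 1) / (p * q - 1)) = (q + 1) / (p * q - 1) + 1"
  "p * ((q + 1) / (p * q - 1)) = (p + 1) / (p * q - 1) + 1"
proof -
  have "p * q - 1 \<noteq> 0" using pq_gt_1 by simp
  then show "(q - 1) / 2 * ((p + 1) / (p * q - 1)) + (p - 1) / 2 * ((q + 1) / (p * q - 1)) = 1"
    "q * ((p + 1) / (p * q - 1)) = (q + 1) / (p * q - 1) + 1"
    "p * ((q + 1) / (p * q - 1)) = (p + 1) / (p * q - 1) + 1"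
    by (simp_all add: divide_simps) (simp_all add: algebra_simps)
qed

text \<open>A large value of \<open>X\<close> at \<tau> persists and makes \<open>Y\<close> large at
  \<open>2 * \<tau>\<close>, so the functional is small there. Existence up to
  \<open>4 * \<tau>\<close> forces it to be at least its loss over the second half. Both bounds
  scale as the same power of \<tau>, and the upper one has a negative power of \<xi> in front, so
  one large \<xi> serves all \<tau>.\<close>

lemma local_blowup:
  "\<exists>\<xi>>0. \<forall>S X Y \<tau>. ode_supersolution p q K m S X Y \<and> 1 \<le> \<tau> \<and> 4 * \<tau> \<le> S \<longrightarrow>
      X \<tau> < \<xi> * \<tau> powr (m - (p + 1) / (p * q - 1))"
proof -
  define k l where "k = (p + 1) / (p * q - 1)" and "l = (q + 1) / (p * q - 1)"
  define \<alpha> \<beta> E where "\<alpha> = (q - 1) / 2" and "\<beta> = (p - 1) / 2" and "E = (p + q) / 2 - 1"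
  have ab: "\<alpha> > 0" "\<beta> > 0" "E = \<alpha> + \<beta>" using p q by (auto simp: \<alpha>_def \<beta>_def E_def field_simps)
  have exps: "\<alpha> * k + \<beta> * l = 1" "q * k = l + 1"
    using scaling_exponents by (auto simp: \<alpha>_def \<beta>_def k_def l_def)
  \<comment> \<open>The power of 2 accounts for the smallest weight on the interval from \<tau> to
    \<open>2 * \<tau>\<close>.\<close>
  define K2 where "K2 = K * 2 powr (- (m * (q - 1)))"
  have K2: "K2 > 0" using K by (simp add: K2_def)
  have "\<alpha> + q * \<beta> > 0" "lyapunov_rate * 4 powr (- (m * E)) * 2 > 0"
    using ab q lyapunov_rate_pos by (auto intro: add_pos_pos)
  \<comment> \<open>On the right, \<open>4 powr (- (m * E))\<close> is the weight at time
    \<open>4 * \<tau>\<close> and the factor 2 is the length \<open>2 * \<tau>\<close> of the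
    interval, both with \<tau> scaled out.\<close>
  then obtain \<xi> where \<xi>: "\<xi> > 0" "K2 powr (- \<beta>) * \<xi> powr (- (\<alpha> + q * \<beta>)) < lyapunov_rate * 4 powr (- (m * E)) * 2"
    using powr_monomial_small by blast
  have "X \<tau> < \<xi> * \<tau> powr (m - k)"
    if sys: "ode_supersolution p q K m S X Y" and \<tau>: "1 \<le> \<tau>" "4 * \<tau> \<le> S" for S X Y \<tau>
  proof (rule ccontr)
    assume "\<not> ?thesis"
    then have X\<tau>: "X \<tau> \<ge> \<xi> * \<tau> powr (m - k)" by simp
    define e where "e = \<xi> * \<tau> powr (m - k)"
    have e: "e > 0" using \<xi> \<tau> by (simp add: e_def)
    have Xe: "X t \<ge> e" if "\<tau> \<le> t" "t \<le> 2 * \<tau>" for t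
      using ode_nondecreasing[OF sys, of \<tau> t] X\<tau> that \<tau> by (auto simp: e_def)
    let ?d = "K * (2 * \<tau>) powr (- (m * (q - 1))) * e powr q"
    have "Y \<tau> - ?d * \<tau> \<le> Y (2 * \<tau>) - ?d * (2 * \<tau>)"
    proof (rule nondecreasing_if_deriv_nonneg[where f="\<lambda>t. Y t - ?d * t"])
      show "continuous_on {\<tau>..2 * \<tau>} (\<lambda>t. Y t - ?d * t)"
        by (intro continuous_intros)
          (use sys \<tau> in \<open>auto simp: ode_supersolution_def intro: continuous_on_subset\<close>)
      fix x assume x: "\<tau> < x" "x < 2 * \<tau>"
      then obtain D where D: "(Y has_real_derivative D) (at x)" "D \<ge> K * x powr (- (m * (q - 1))) * X x powr q"
        using sys \<tau> by (force simp: ode_supersolution_def)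
      have "?d \<le> K * x powr (- (m * (q - 1))) * X x powr q"
        using x \<tau> p q m K e Xe[of x]
        by (intro mult_mono mult_left_mono powr_mono2' powr_mono2) auto
      with D show "\<exists>D\<ge>0. ((\<lambda>t. Y t - ?d * t) has_real_derivative D) (at x)"
        by (intro exI[of _ "D - ?d"]) (auto intro!: derivative_eq_intros)
    qed (use \<tau> in auto)
    moreover have "Y \<tau> > 0" using sys \<tau> by (auto simp: ode_supersolution_def)
    ultimately have Y2: "Y (2 * \<tau>) \<ge> ?d * \<tau>" by (simp add: algebra_simps)
    have dd: "?d * \<tau> = K2 * \<xi> powr q * \<tau> powr (m - l)"
    proof -
      have "\<tau> powr (- (m * (q - 1))) * \<tau> powr ((m - k) * q) * \<tau> powr 1 = \<tau> powr (m - l)"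
        unfolding powr_add[symmetric] by (rule arg_cong[where f="\<lambda>x. \<tau> powr x"])
          (use exps in \<open>simp add: algebra_simps\<close>)
      then show ?thesis using \<tau> \<xi> by (simp add: e_def powr_mult powr_powr K2_def mult_ac)
    qed
    have "lyapunov X Y (2 * \<tau>) \<le> e powr (- \<alpha>) * (?d * \<tau>) powr (- \<beta>)"
      unfolding lyapunov_def \<alpha>_def[symmetric] \<beta>_def[symmetric]
      using Xe[of "2 * \<tau>"] Y2 e ab \<tau> K by (intro mult_mono powr_mono2') auto
    also have "\<dots> = K2 powr (- \<beta>) * \<xi> powr (- (\<alpha> + q * \<beta>)) * \<tau> powr (1 - m * E)"
    proof -
      have "\<tau> powr ((m - k) * (- \<alpha>)) * \<tau> powr ((m - l) * (- \<beta>)) = \<tau> powr (1 - m * E)"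
        unfolding powr_add[symmetric] by (rule arg_cong[where f="\<lambda>x. \<tau> powr x"])
          (use exps in \<open>simp add: ab algebra_simps\<close>)
      moreover have "\<xi> powr (- \<alpha>) * \<xi> powr (q * (- \<beta>)) = \<xi> powr (- (\<alpha> + q * \<beta>))"
        unfolding powr_add[symmetric] by simp
      moreover have "e powr (- \<alpha>) * (?d * \<tau>) powr (- \<beta>) =
        K2 powr (- \<beta>) * (\<xi> powr (- \<alpha>) * \<xi> powr (q * (- \<beta>))) * (\<tau> powr ((m - k) * (- \<alpha>)) * \<tau> powr ((m - l) * (- \<beta>)))"
        unfolding dd unfolding e_def using \<tau> \<xi> K2 by (simp add: powr_mult powr_powr mult_ac)
      ultimately show ?thesis by simp
    qed
    also have "\<dots> < lyapunov_rate * 4 powr (- (m * E)) * 2 * \<tau> powr (1 - m * E)"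
      using \<xi> \<tau> by (intro mult_strict_right_mono) auto
    also have "\<dots> = lyapunov_rate * (4 * \<tau>) powr (- (m * E)) * (4 * \<tau> - 2 * \<tau>)"
    proof -
      have "\<tau> powr (1 - m * E) = \<tau> * \<tau> powr (- (m * E))" using \<tau> by (simp add: powr_mult_base)
      then show ?thesis using \<tau> by (simp add: powr_mult)
    qed
    also have "\<dots> \<le> lyapunov X Y (2 * \<tau>)"
      unfolding E_def by (rule lyapunov_lower[OF sys]) (use \<tau> in auto)
    finally show False by simp
  qed
  then show ?thesis using \<xi>(1) unfolding k_def by blast
qed

text \<open>The threshold of \<open>local_blowup\<close> decays like
  \<open>\<tau> powr (- \<Gamma>)\<close>, while \<open>X\<close> never falls below its initial size
  \<open>c * \<epsilon>\<close>. The time \<tau> is the one at which the two coincide, and the bound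
  \<open>\<epsilon> \<le> \<xi> / c\<close> guarantees \<open>\<tau> \<ge> 1\<close>.\<close>

lemma subcritical_lifespan:
  assumes "(p + 1) / (p * q - 1) - m > 0" and c: "c > 0"
  shows "\<exists>\<epsilon>\<^sub>0>0. \<exists>C>0. \<forall>\<epsilon> S X Y. 0 < \<epsilon> \<and> \<epsilon> \<le> \<epsilon>\<^sub>0 \<and> ode_supersolution p q K m S X Y \<and>
     X 1 \<ge> c * \<epsilon> \<and> Y 1 \<ge> c * \<epsilon> \<longrightarrow> S \<le> C * \<epsilon> powr (- inverse ((p + 1) / (p * q - 1) - m))"
proof -
  define \<Gamma> where "\<Gamma> = (p + 1) / (p * q - 1) - m"
  have \<Gamma>: "\<Gamma> > 0" using assms by (simp add: \<Gamma>_def)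
  obtain \<xi> where \<xi>: "\<xi> > 0" and loc: "\<And>S X Y \<tau>. ode_supersolution p q K m S X Y \<Longrightarrow> 1 \<le> \<tau> \<Longrightarrow> 4 * \<tau> \<le> S \<Longrightarrow>
      X \<tau> < \<xi> * \<tau> powr (- \<Gamma>)"
    using local_blowup by (auto simp: \<Gamma>_def)
  have "S \<le> 4 * (\<xi> / c) powr (inverse \<Gamma>) * \<epsilon> powr (- inverse \<Gamma>)"
    if \<epsilon>: "0 < \<epsilon>" "\<epsilon> \<le> \<xi> / c" and sys: "ode_supersolution p q K m S X Y" and init: "X 1 \<ge> c * \<epsilon>" for \<epsilon> S X Y
  proof (rule ccontr)
    assume large: "\<not> ?thesis"
    define \<tau> where "\<tau> = (\<xi> / (c * \<epsilon>)) powr (inverse \<Gamma>)"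
    have "\<xi> / (c * \<epsilon>) \<ge> 1" using \<epsilon> c \<xi> by (simp add: field_simps)
    then have \<tau>1: "\<tau> \<ge> 1" unfolding \<tau>_def using \<Gamma> by (intro ge_one_powr_ge_zero) auto
    have "(\<xi> / (c * \<epsilon>)) = (\<xi> / c) * inverse \<epsilon>" by (simp add: field_simps)
    then have \<tau>2: "(\<xi> / c) powr (inverse \<Gamma>) * \<epsilon> powr (- inverse \<Gamma>) = \<tau>"
      using \<epsilon> c \<xi> unfolding \<tau>_def by (simp only: powr_mult) (simp add: powr_minus inverse_powr)
    have S: "4 * \<tau> \<le> S" using large by (simp flip: \<tau>2 add: mult.assoc)
    have "X \<tau> < \<xi> * \<tau> powr (- \<Gamma>)" by (rule loc[OF sys \<tau>1 S])
    also have "\<tau> powr (- \<Gamma>) = inverse (\<xi> / (c * \<epsilon>))"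
      unfolding \<tau>_def using \<Gamma> \<epsilon> c \<xi> by (simp add: powr_powr powr_minus)
    also have "\<xi> * \<dots> = c * \<epsilon>" using \<xi> by simp
    also have "\<dots> \<le> X \<tau>" using ode_nondecreasing[OF sys, of 1 \<tau>] init \<tau>1 S by auto
    finally show False by simp
  qed
  then show ?thesis
    unfolding \<Gamma>_def[symmetric] using \<xi> c
    by (intro exI[of _ "\<xi> / c"] conjI exI[of _ "4 * (\<xi> / c) powr (inverse \<Gamma>)"]) auto
qed

text \<open>The threshold of \<open>local_blowup\<close> is now a constant \<xi>, and the task is to
  bound the time at which \<open>X\<close> reaches it. For this the pair is compared with
  \<open>x\<close> and \<open>y = \<gamma> * t powr a * x powr q\<close>: inserting \<open>y\<close>
  into the inequality for \<open>X\<close> gives x' = c1 x^(pq) / t, and \<open>y\<close> is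
  admissible in the inequality for \<open>Y\<close> as long as x stays below \<xi> and \<gamma> is
  small.\<close>

lemma critical_lifespan:
  assumes crit: "m = (p + 1) / (p * q - 1)" and le: "q \<le> p" and c: "c > 0"
  shows "\<exists>\<epsilon>\<^sub>0>0. \<exists>C>0. \<forall>\<epsilon> S X Y. 0 < \<epsilon> \<and> \<epsilon> \<le> \<epsilon>\<^sub>0 \<and> ode_supersolution p q K m S X Y \<and>
     X 1 \<ge> c * \<epsilon> \<and> Y 1 \<ge> c * \<epsilon> \<longrightarrow> S \<le> exp (C * \<epsilon> powr (- (p * q - 1)))"
proof -
  \<comment> \<open>The exponent \<open>a\<close> is chosen so that \<open>t powr (a - 1)\<close> is
    the weight in the inequality for \<open>Y\<close>. A size \<open>t powr a * x powr q\<close> of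
    \<open>Y\<close> then leaves exactly the weight 1/t in the inequality for \<open>X\<close>,
    which is autonomous in logarithmic time. The assumption \<open>q \<le> p\<close> gives
    \<open>a \<ge> 0\<close>.\<close>
  define l P a where "l = (q + 1) / (p * q - 1)" and "P = p * q - 1" and "a = m - l"
  have P: "P > 0" using pq_gt_1 by (simp add: P_def)
  have a: "a \<ge> 0" using le P by (simp add: a_def crit l_def P_def divide_right_mono diff_divide_distrib[symmetric])
  have exps: "a - 1 = - (m * (q - 1))" "p * a - m * (p - 1) = -1"
    using scaling_exponents(2,3) unfolding a_def l_def crit[symmetric] by (auto simp: algebra_simps)
  obtain \<xi> where \<xi>: "\<xi> > 0" and loc: "\<And>S X Y \<tau>. ode_supersolution p q K m S X Y \<Longrightarrow> 1 \<le> \<tau> \<Longrightarrow> 4 * \<tau> \<le> S \<Longrightarrow> X \<tau> < \<xi>"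
    using local_blowup by (auto simp: crit split: if_splits)
  \<comment> \<open>Differentiating \<open>y\<close> produces the factor
    \<open>\<gamma> * (q * K * \<gamma> powr p * x powr P + a)\<close>, which must not exceed
    \<open>K\<close> while x is at most \<xi>. The bound by 1 disposes of
    \<open>\<gamma> powr p\<close>.\<close>
  define \<gamma> where "\<gamma> = min 1 (K / (q * K * \<xi> powr P + a))"
  have den: "q * K * \<xi> powr P + a > 0" using q K \<xi> a by (simp add: add_pos_nonneg)
  have \<gamma>: "\<gamma> > 0" "\<gamma> \<le> 1" using K den by (auto simp: \<gamma>_def)
  have \<gamma>_bound: "\<gamma> * (q * K * \<gamma> powr p * \<xi> powr P + a) \<le> K"
  proof -
    have "\<gamma> powr p \<le> 1 powr p" using \<gamma> p by (intro powr_mono2) auto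
    then have "q * K * \<gamma> powr p * \<xi> powr P + a \<le> q * K * \<xi> powr P + a"
      using q K by (simp add: mult_le_cancel_left1 mult_left_le mult_right_mono)
    then have "\<gamma> * (q * K * \<gamma> powr p * \<xi> powr P + a) \<le> \<gamma> * (q * K * \<xi> powr P + a)"
      using \<gamma> by simp
    also have "\<gamma> * (q * K * \<xi> powr P + a) \<le> K"
      using pos_le_divide_eq[OF den, of \<gamma> K] by (simp add: \<gamma>_def)
    finally show ?thesis .
  qed
  define c1 where "c1 = K * \<gamma> powr p"
  have c1: "c1 > 0" using K \<gamma> by (simp add: c1_def)
  \<comment> \<open>The three bounds give, in this order,
    \<open>\<epsilon> powr (- P) \<ge> 1\<close>, which absorbs \<open>ln 4\<close>, then
    \<open>\<delta> \<le> 1\<close>, and finally \<open>\<delta> < \<xi>\<close>.\<close>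
  define \<epsilon>\<^sub>0 where "\<epsilon>\<^sub>0 = min 1 (min (2 / c) (\<xi> / c))"
  have \<epsilon>0: "\<epsilon>\<^sub>0 > 0" using c \<xi> by (auto simp: \<epsilon>\<^sub>0_def)
  \<comment> \<open>\<open>ln 4\<close> pays for the last factor 4 in time; the other summand bounds
    the logarithmic time needed to grow to \<xi>.\<close>
  define C where "C = ln 4 + (c / 2) powr (- P) / (P * c1)"
  have C: "C > 0" using c P c1 unfolding C_def by (intro add_pos_pos) auto
  have "S \<le> exp (C * \<epsilon> powr (- P))"
    if \<epsilon>: "0 < \<epsilon>" "\<epsilon> \<le> \<epsilon>\<^sub>0" and sys: "ode_supersolution p q K m S X Y" and init: "X 1 \<ge> c * \<epsilon>" "Y 1 \<ge> c * \<epsilon>" for \<epsilon> S X Y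
  proof (rule ccontr)
    assume large: "\<not> ?thesis"
    \<comment> \<open>Half of the initial size makes both comparisons strict at time 1.\<close>
    define \<delta> where "\<delta> = c * \<epsilon> / 2"
    have \<delta>: "\<delta> > 0" "\<delta> \<le> 1" "\<delta> < \<xi>" "\<delta> < c * \<epsilon>"
      using \<epsilon> c \<xi> by (auto simp: \<delta>_def \<epsilon>\<^sub>0_def field_simps)
    \<comment> \<open>The logarithmic time at which the comparison function, started at \<delta>,
      equals \<xi>.\<close>
    define s1 where "s1 = (\<delta> powr (- P) - \<xi> powr (- P)) / (P * c1)"
    define \<tau> where "\<tau> = exp s1"
    have "\<delta> powr (- P) > \<xi> powr (- P)" using \<delta> P by (intro powr_less_mono2_neg) auto
    then have s1: "s1 \<ge> 0" using P c1 by (simp add: s1_def)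
    then have \<tau>1: "\<tau> \<ge> 1" by (simp add: \<tau>_def)
    have "ln 4 + s1 \<le> C * \<epsilon> powr (- P)"
    proof -
      have "\<epsilon> powr (- P) \<ge> 1 powr (- P)" using \<epsilon> P by (intro powr_mono2') (auto simp: \<epsilon>\<^sub>0_def)
      then have "ln 4 * 1 \<le> ln 4 * \<epsilon> powr (- P)" by (intro mult_left_mono) auto
      moreover have "s1 \<le> \<delta> powr (- P) / (P * c1)" using P c1 by (auto simp: s1_def intro!: divide_right_mono)
      moreover have "\<delta> = (c / 2) * \<epsilon>" by (simp add: \<delta>_def)
      then have "\<delta> powr (- P) = (c / 2) powr (- P) * \<epsilon> powr (- P)" using c \<epsilon> by (simp only: powr_mult)
      then have "\<delta> powr (- P) / (P * c1) = (c / 2) powr (- P) * \<epsilon> powr (- P) / (P * c1)" by (rule arg_cong)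
      moreover have "C * \<epsilon> powr (- P) = ln 4 * \<epsilon> powr (- P) + (c / 2) powr (- P) * \<epsilon> powr (- P) / (P * c1)"
        by (simp add: C_def distrib_right)
      ultimately show ?thesis by (simp only: mult_1_right)
    qed
    then have "exp (ln 4 + s1) \<le> exp (C * \<epsilon> powr (- P))" by simp
    then have S: "4 * \<tau> \<le> S" using large by (simp add: exp_add \<tau>_def)
    \<comment> \<open>The explicit solution of x' = c1 x^(P+1) / t with value \<delta> at time
      1.\<close>
    define x where "x = (\<lambda>t. (\<delta> powr (- P) - P * c1 * ln t) powr (- (1 / P)))"
    have base: "\<delta> powr (- P) - P * c1 * ln t \<ge> \<xi> powr (- P)" if "1 \<le> t" "t \<le> \<tau>" for t
    proof -
      have "ln t \<le> s1" using that unfolding \<tau>_def by (metis exp_gt_zero ln_exp ln_le_cancel_iff zero_less_one order_less_le_trans)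
      then have "P * c1 * ln t \<le> P * c1 * s1" using P c1 by simp
      then show ?thesis using P c1 by (simp add: s1_def)
    qed
    have base_pos: "\<delta> powr (- P) - P * c1 * ln t > 0" if "1 \<le> t" "t \<le> \<tau>" for t
      using base[OF that] \<xi> by (smt (verit) powr_gt_zero)
    have x_pos: "x t > 0" if "1 \<le> t" "t \<le> \<tau>" for t
      using base_pos[OF that] unfolding x_def by simp
    have x_le: "x t \<le> \<xi>" if "1 \<le> t" "t \<le> \<tau>" for t
    proof -
      have "x t \<le> (\<xi> powr (- P)) powr (- (1 / P))"
        unfolding x_def using base[OF that] \<xi> P by (intro powr_mono2') auto
      also have "\<dots> = \<xi>" using P \<xi> by (simp add: powr_powr)
      finally show ?thesis .
    qed
    have x_end: "x \<tau> = \<xi>" and x_start: "x 1 = \<delta>"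
      unfolding x_def \<tau>_def s1_def using P c1 \<xi> \<delta> by (simp_all add: powr_powr)
    have dx: "(x has_real_derivative c1 * x t powr (p * q) / t) (at t)" if t: "1 \<le> t" "t \<le> \<tau>" for t
    proof -
      let ?b = "\<delta> powr (- P) - P * c1 * ln t"
      have "((\<lambda>t. \<delta> powr (- P) - P * c1 * ln t) has_real_derivative - (P * c1 / t)) (at t)"
        using t by (auto intro!: derivative_eq_intros)
      from DERIV_fun_powr[OF this base_pos[OF t], of "- (1 / P)"]
      have "(x has_real_derivative (- (1 / P)) * ?b powr (- (1 / P) - 1) * (- (P * c1 / t))) (at t)"
        by (simp add: x_def)
      moreover have "?b powr (- (1 / P) - 1) = x t powr (p * q)"
        unfolding x_def powr_powr using P by (simp add: P_def field_simps)
      ultimately show ?thesis using P by (simp add: field_simps)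
    qed
    define y where "y = (\<lambda>t. \<gamma> * t powr a * x t powr q)"
    have cx: "continuous_on {1..\<tau>} x"
      by (rule DERIV_continuous_on[where D="\<lambda>t. c1 * x t powr (p * q) / t"]) (use dx in \<open>auto intro: has_field_derivative_at_within\<close>)
    have cXY: "continuous_on {1..\<tau>} X" "continuous_on {1..\<tau>} Y"
      using sys S \<tau>1 by (auto simp: ode_supersolution_def intro: continuous_on_subset)
    have "X \<tau> - x \<tau> > 0"
    proof (rule simultaneously_positive[where a=1 and b=\<tau> and \<phi>="\<lambda>t. X t - x t" and \<psi>="\<lambda>t. Y t - y t"])
      show "continuous_on {1..\<tau>} (\<lambda>t. X t - x t)" by (intro continuous_intros cXY cx)
      show "continuous_on {1..\<tau>} (\<lambda>t. Y t - y t)" unfolding y_def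
        by (intro continuous_intros cXY cx) (use x_pos in force)+
      show "X 1 - x 1 > 0" using x_start \<delta> init by simp
      have "\<gamma> * \<delta> powr q \<le> 1 * \<delta> powr 1" using \<gamma> \<delta> q by (intro mult_mono powr_mono') auto
      then show "Y 1 - y 1 > 0" using x_start \<delta> init by (simp add: y_def)
    next
      fix t assume t: "1 < t" "t < \<tau>" and pos: "X t - x t > 0" "Y t - y t > 0"
      obtain D where D: "(X has_real_derivative D) (at t)" "D \<ge> K * t powr (- (m * (p - 1))) * Y t powr p"
        using sys t S by (force simp: ode_supersolution_def)
      have xt: "x t > 0" using x_pos[of t] t by simp
      have yt: "y t > 0" using xt \<gamma> t by (simp add: y_def)
      have "c1 * x t powr (p * q) / t = K * t powr (- (m * (p - 1))) * y t powr p"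
      proof -
        have "- (m * (p - 1)) + a * p = -1" using exps(2) by (simp add: algebra_simps)
        then have "t powr (- (m * (p - 1))) * t powr (a * p) = t powr (-1)"
          by (simp only: powr_add[symmetric])
        also have "\<dots> = 1 / t" using t by (simp add: powr_minus divide_inverse)
        finally have 1: "t powr (- (m * (p - 1))) * t powr (a * p) = 1 / t" .
        have "y t powr p = \<gamma> powr p * t powr (a * p) * x t powr (p * q)"
          using t xt \<gamma> unfolding y_def by (simp add: powr_mult powr_powr mult.commute)
        then have "K * t powr (- (m * (p - 1))) * y t powr p =
            K * \<gamma> powr p * x t powr (p * q) * (t powr (- (m * (p - 1))) * t powr (a * p))"
          by (simp add: mult_ac)
        then show ?thesis unfolding 1 by (simp add: c1_def)
      qed
      also have "\<dots> \<le> K * t powr (- (m * (p - 1))) * Y t powr p"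
        using yt pos K p by (intro mult_left_mono powr_mono2) auto
      finally show "\<exists>D\<ge>0. ((\<lambda>t. X t - x t) has_real_derivative D) (at t)"
        using D dx[of t] t by (intro exI[of _ "D - c1 * x t powr (p * q) / t"]) (auto intro!: derivative_intros)
    next
      fix t assume t: "1 < t" "t < \<tau>" and pos: "X t - x t > 0" "Y t - y t > 0"
      obtain D where D: "(Y has_real_derivative D) (at t)" "D \<ge> K * t powr (- (m * (q - 1))) * X t powr q"
        using sys t S by (force simp: ode_supersolution_def)
      have xt: "x t > 0" "x t \<le> \<xi>" using x_pos[of t] x_le[of t] t by auto
      let ?Dy = "\<gamma> * (a * t powr (a - 1) * x t powr q + t powr a * (q * x t powr (q - 1) * (c1 * x t powr (p * q) / t)))"
      have dy: "(y has_real_derivative ?Dy) (at t)"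
        unfolding y_def using t xt
        by (auto intro!: derivative_eq_intros dx simp: algebra_simps powr_diff)
      have "?Dy = t powr (a - 1) * x t powr q * (\<gamma> * (q * K * \<gamma> powr p * x t powr P + a))"
      proof -
        have "x t powr (q - 1) * x t powr (p * q) = x t powr q * x t powr P"
          unfolding powr_add[symmetric] by (rule arg_cong[where f="\<lambda>z. x t powr z"]) (simp add: P_def)
        moreover have "t powr a = t * t powr (a - 1)" using t by (simp add: powr_mult_base)
        then have "?Dy = \<gamma> * (a * t powr (a - 1) * x t powr q + t powr (a - 1) * q * c1 * (x t powr (q - 1) * x t powr (p * q)))"
          using t by simp
        ultimately show ?thesis by (simp add: c1_def algebra_simps)
      qed
      also have "\<dots> \<le> t powr (a - 1) * x t powr q * K"
      proof (rule mult_left_mono)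
        have "x t powr P \<le> \<xi> powr P" using xt P by (intro powr_mono2) auto
        then have "\<gamma> * (q * K * \<gamma> powr p * x t powr P + a) \<le> \<gamma> * (q * K * \<gamma> powr p * \<xi> powr P + a)"
          using \<gamma> q K by (intro mult_left_mono add_right_mono) auto
        then show "\<gamma> * (q * K * \<gamma> powr p * x t powr P + a) \<le> K" using \<gamma>_bound by simp
      qed simp
      also have "\<dots> \<le> t powr (a - 1) * X t powr q * K"
        using xt pos q K by (intro mult_right_mono mult_left_mono powr_mono2) auto
      also have "\<dots> \<le> D" using D(2) unfolding exps(1) by (simp add: mult_ac)
      finally show "\<exists>D\<ge>0. ((\<lambda>t. Y t - y t) has_real_derivative D) (at t)"
        using D dy by (intro exI[of _ "D - ?Dy"]) (auto intro!: derivative_intros)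
    qed (use \<tau>1 in auto)
    then show False using loc[OF sys \<tau>1 S] x_end by simp
  qed
  then show ?thesis unfolding P_def[symmetric]
    using \<epsilon>0 C by (intro exI[of _ \<epsilon>\<^sub>0] conjI exI[of _ C]) auto
qed

end

text \<open>For \<open>p = q\<close> at the critical exponent the functional decays exactly at the
  rate r/t. Its initial value, at most \<open>(c * \<epsilon>) powr (- (p - 1))\<close>, must
  therefore exceed \<open>r * ln S\<close>. No smallness of \<epsilon> enters.\<close>

lemma critical_symmetric_lifespan:
  assumes p: "p > (1::real)" and K: "K > 0" and crit: "m = 1 / (p - 1)" and c: "c > 0"
  shows "\<exists>C>0. \<forall>\<epsilon> S X Y. 0 < \<epsilon> \<and> S \<ge> 1 \<and> ode_supersolution p p K m S X Y \<and>
     X 1 \<ge> c * \<epsilon> \<and> Y 1 \<ge> c * \<epsilon> \<longrightarrow> S \<le> exp (C * \<epsilon> powr (- (p - 1)))"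
proof -
  have m: "m \<ge> 0" using p crit by simp
  note rules = p p K m
  let ?V = "lyapunov p p"
  define r where "r = lyapunov_rate p p K"
  have r: "r > 0" unfolding r_def by (rule lyapunov_rate_pos[OF rules])
  have "S \<le> exp (c powr (- (p - 1)) / r * \<epsilon> powr (- (p - 1)))"
    if \<epsilon>: "0 < \<epsilon>" and S: "S \<ge> 1" and sys: "ode_supersolution p p K m S X Y" and init: "X 1 \<ge> c * \<epsilon>" "Y 1 \<ge> c * \<epsilon>" for \<epsilon> S X Y
  proof -
    have "- ?V X Y 1 - r * ln 1 \<le> - ?V X Y S - r * ln S"
    proof (rule nondecreasing_if_deriv_nonneg[OF S])
      show "continuous_on {1..S} (\<lambda>t. - ?V X Y t - r * ln t)"
        by (intro continuous_intros continuous_on_lyapunov[OF rules sys]) auto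
      fix t assume t: "1 < t" "t < S"
      obtain D where D: "(?V X Y has_real_derivative D) (at t)" "D \<le> - r * t powr (- (m * ((p + p) / 2 - 1)))"
        using lyapunov_deriv[OF rules sys t] by (auto simp: r_def)
      have "- (m * ((p + p) / 2 - 1)) = -1" using p by (simp add: crit)
      then have "t powr (- (m * ((p + p) / 2 - 1))) = t powr (-1)" by (simp only:)
      also have "\<dots> = 1 / t" using t by (simp add: powr_minus divide_inverse)
      finally have "t powr (- (m * ((p + p) / 2 - 1))) = 1 / t" .
      with D t show "\<exists>D\<ge>0. ((\<lambda>t. - ?V X Y t - r * ln t) has_real_derivative D) (at t)"
        by (intro exI[of _ "- D - r * (1 / t)"]) (auto intro!: derivative_eq_intros)
    qed
    then have "r * ln S \<le> ?V X Y 1" using lyapunov_nonneg[OF rules, of X Y S] by simp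
    also have "\<dots> \<le> (c * \<epsilon>) powr (- ((p - 1) / 2)) * (c * \<epsilon>) powr (- ((p - 1) / 2))"
      unfolding lyapunov_def[OF rules] using init c \<epsilon> p by (intro mult_mono powr_mono2') auto
    also have "\<dots> = (c * \<epsilon>) powr (- (p - 1))" by (simp flip: powr_add)
    finally have "ln S \<le> (c * \<epsilon>) powr (- (p - 1)) / r" using r by (simp add: field_simps)
    then have "exp (ln S) \<le> exp ((c * \<epsilon>) powr (- (p - 1)) / r)" by simp
    then show ?thesis using S c \<epsilon> by (simp add: powr_mult)
  qed
  then show ?thesis using r c by (intro exI[of _ "c powr (- (p - 1)) / r"]) auto
qed

section \<open>Smooth functions\<close>

lemma Ck_has_derivativeI:
  assumes "\<And>x. (f has_derivative f' x) (at x)" and "\<And>b. b \<in> Basis \<Longrightarrow> Ck k (\<lambda>x. f' x b)"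
  shows "Ck (Suc k) f"
proof -
  have "frechet_derivative f (at x) = f' x" for x
    using frechet_derivative_at[OF assms(1)] by simp
  then show ?thesis using assms by (auto simp: differentiable_def)
qed

lemma Ck_Suc_real:
  fixes f :: "real \<Rightarrow> real"
  assumes "\<And>x. (f has_real_derivative f' x) (at x)" and "Ck k f'"
  shows "Ck (Suc k) f"
  by (rule Ck_has_derivativeI[where f'="\<lambda>x. (*) (f' x)"])
    (use assms in \<open>auto simp: has_field_derivative_def\<close>)

text \<open>The recursion speaks about the partial derivatives only, so the inclusion is not
  immediate: at the bottom it is continuity of differentiable functions, and it climbs by applying
  itself to the partial derivatives.\<close>

lemma Ck_SucD: "Ck (Suc k) f \<Longrightarrow> Ck k f"
proof (induction k arbitrary: f)
  case 0
  then show ?case by (auto intro!: continuous_at_imp_continuous_on differentiable_imp_continuous_within)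
next
  case (Suc k)
  have "Ck k (\<lambda>x. frechet_derivative f (at x) b)" if "b \<in> Basis" for b
    by (rule Suc.IH) (use Suc.prems that in \<open>simp only: Ck.simps(2)[of "Suc k"]\<close>)
  with Suc.prems show ?case by (simp only: Ck.simps(2)) blast
qed

lemma Ck_const: "Ck k (\<lambda>x. c)"
proof (induction k arbitrary: c)
  case (Suc k)
  show ?case by (rule Ck_has_derivativeI[where f'="\<lambda>x b. 0"]) (auto intro: Suc)
qed simp

lemma Ck_bounded_linear: "bounded_linear f \<Longrightarrow> Ck k f"
proof (cases k)
  case (Suc n)
  assume "bounded_linear f"
  then show ?thesis unfolding Suc
    by (intro Ck_has_derivativeI[where f'="\<lambda>x. f"] bounded_linear_imp_has_derivative Ck_const)
qed (simp add: linear_continuous_on)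

lemma Ck_differentiable:
  assumes "Ck (Suc k) f"
  shows "(f has_derivative frechet_derivative f (at x)) (at x)"
    and "b \<in> Basis \<Longrightarrow> Ck k (\<lambda>x. frechet_derivative f (at x) b)"
  using assms by (auto simp: frechet_derivative_works)

lemma Ck_add: "Ck k f \<Longrightarrow> Ck k g \<Longrightarrow> Ck k (\<lambda>x. f x + g x)"
proof (induction k arbitrary: f g)
  case (Suc k)
  note d = Ck_differentiable[OF Suc.prems(1)] Ck_differentiable[OF Suc.prems(2)]
  show ?case
    by (rule Ck_has_derivativeI[OF has_derivative_add[OF d(1) d(3)]]) (intro Suc.IH d)
qed (auto intro: continuous_intros)

lemma Ck_mult: "Ck k f \<Longrightarrow> Ck k g \<Longrightarrow> Ck k (\<lambda>x. f x * g x)"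
proof (induction k arbitrary: f g)
  case (Suc k)
  note d = Ck_differentiable[OF Suc.prems(1)] Ck_differentiable[OF Suc.prems(2)]
  show ?case
    by (rule Ck_has_derivativeI[OF has_derivative_mult[OF d(1) d(3)]])
      (intro Ck_add Suc.IH d Ck_SucD[OF Suc.prems(1)] Ck_SucD[OF Suc.prems(2)])
qed (auto intro: continuous_intros)

lemma Ck_compose:
  fixes g :: "real \<Rightarrow> real" and f :: "'a::euclidean_space \<Rightarrow> real"
  shows "Ck k g \<Longrightarrow> Ck k f \<Longrightarrow> Ck k (\<lambda>x. g (f x))"
proof (induction k arbitrary: g)
  case 0
  then show ?case by (auto intro: continuous_on_compose2)
next
  case (Suc k)
  note d = Ck_differentiable[OF Suc.prems(1)] Ck_differentiable[OF Suc.prems(2)]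
  have "((\<lambda>x. g (f x)) has_derivative (\<lambda>b. frechet_derivative g (at (f x)) 1 * frechet_derivative f (at x) b)) (at x)" for x
  proof -
    have "frechet_derivative g (at (f x)) y = frechet_derivative g (at (f x)) 1 * y" for y
      using linear_cmul[OF has_derivative_linear[OF d(1)], of "f x" y 1] by (simp add: mult.commute)
    then have "(\<lambda>b. frechet_derivative g (at (f x)) (frechet_derivative f (at x) b)) =
        (\<lambda>b. frechet_derivative g (at (f x)) 1 * frechet_derivative f (at x) b)"
      by blast
    moreover have "((\<lambda>x. g (f x)) has_derivative (\<lambda>b. frechet_derivative g (at (f x)) (frechet_derivative f (at x) b))) (at x)"
      by (rule has_derivative_compose[OF d(3) d(1)])
    ultimately show ?thesis by (simp only:)
  qed
  then show ?case
  proof (rule Ck_has_derivativeI)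
    fix b :: 'a assume "b \<in> Basis"
    moreover have "(1::real) \<in> Basis" by simp
    ultimately show "Ck k (\<lambda>x. frechet_derivative g (at (f x)) 1 * frechet_derivative f (at x) b)"
      using Ck_mult[OF Suc.IH[OF d(2) Ck_SucD[OF Suc.prems(2)]] d(4)] by blast
  qed
qed

text \<open>The projections from space-time send each basis vector to a basis vector or to 0. A
  partial derivative of the composition is thus a partial derivative of \<open>f\<close> composed
  with \<open>L\<close>, or 0, and the induction needs no linear combinations.\<close>

lemma Ck_compose_projection:
  fixes f :: "'a::euclidean_space \<Rightarrow> real" and L :: "'b::euclidean_space \<Rightarrow> 'a"
  assumes L: "bounded_linear L" "\<And>b. b \<in> Basis \<Longrightarrow> L b \<in> Basis \<or> L b = 0"
  shows "Ck k f \<Longrightarrow> Ck k (\<lambda>z. f (L z))"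
proof (induction k arbitrary: f)
  case 0
  then show ?case
    using linear_continuous_on[OF L(1)] by (auto intro!: continuous_on_compose2[of UNIV f])
next
  case (Suc k)
  note d = Ck_differentiable[OF Suc.prems]
  have "((\<lambda>z. f (L z)) has_derivative (\<lambda>b. frechet_derivative f (at (L z)) (L b))) (at z)" for z
    by (rule has_derivative_compose[OF bounded_linear_imp_has_derivative[OF L(1)] d(1)])
  then show ?case
  proof (rule Ck_has_derivativeI)
    fix b :: 'b assume "b \<in> Basis"
    from L(2)[OF this] show "Ck k (\<lambda>z. frechet_derivative f (at (L z)) (L b))"
      using Suc.IH[OF d(2), of "L b"] linear_0[OF has_derivative_linear[OF d(1)]]
      by (elim disjE) (simp_all add: Ck_const)
  qed
qed

lemma smooth_const: "smooth (\<lambda>x. c)"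
  and smooth_bounded_linear: "bounded_linear f \<Longrightarrow> smooth f"
  and smooth_add: "smooth f \<Longrightarrow> smooth g \<Longrightarrow> smooth (\<lambda>x. f x + g x)"
  and smooth_mult: "smooth f \<Longrightarrow> smooth g \<Longrightarrow> smooth (\<lambda>x. f x * g x)"
  and smooth_compose: "smooth h \<Longrightarrow> smooth f \<Longrightarrow> smooth (\<lambda>x. h (f x))"
  for h :: "real \<Rightarrow> real"
  by (auto simp: smooth_def intro: Ck_const Ck_bounded_linear Ck_add Ck_mult Ck_compose)

lemma smooth_fst:
  assumes "smooth f"
  shows "smooth (\<lambda>z::'a::euclidean_space \<times> 'b::euclidean_space. f (fst z))"
  unfolding smooth_def
proof
  fix k
  have "Ck k f" using assms by (simp add: smooth_def)
  then show "Ck k (\<lambda>z::'a \<times> 'b. f (fst z))"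
    by (rule Ck_compose_projection[OF bounded_linear_fst, rotated]) (auto simp: Basis_prod_def)
qed

lemma smooth_snd:
  assumes "smooth f"
  shows "smooth (\<lambda>z::'a::euclidean_space \<times> 'b::euclidean_space. f (snd z))"
  unfolding smooth_def
proof
  fix k
  have "Ck k f" using assms by (simp add: smooth_def)
  then show "Ck k (\<lambda>z::'a \<times> 'b. f (snd z))"
    by (rule Ck_compose_projection[OF bounded_linear_snd, rotated]) (auto simp: Basis_prod_def)
qed

lemma smooth_has_derivative:
  assumes "smooth f"
  shows "(f has_derivative frechet_derivative f (at x)) (at x)"
    and "b \<in> Basis \<Longrightarrow> smooth (\<lambda>x. frechet_derivative f (at x) b)"
    and "continuous_on UNIV f"
proof -
  have Ck: "Ck k f" for k using assms by (simp add: smooth_def)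
  show "(f has_derivative frechet_derivative f (at x)) (at x)"
    by (rule Ck_differentiable(1)[OF Ck])
  show "smooth (\<lambda>x. frechet_derivative f (at x) b)" if "b \<in> Basis"
    using Ck_differentiable(2)[OF Ck that] by (simp add: smooth_def)
  show "continuous_on UNIV f"
    using Ck[of 0] by simp
qed

lemma smooth_antiderivative:
  fixes f :: "real \<Rightarrow> real"
  assumes "\<And>x. (f has_real_derivative f' x) (at x)" and "smooth f'"
  shows "smooth f"
  unfolding smooth_def
proof
  fix k
  have "Ck (Suc k) f" by (rule Ck_Suc_real[OF assms(1)]) (use assms(2) in \<open>simp_all add: smooth_def\<close>)
  then show "Ck k f" by (rule Ck_SucD)
qed

lemma smooth_exp: "smooth (exp :: real \<Rightarrow> real)"
proof -
  have "Ck k (exp :: real \<Rightarrow> real)" for k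
  proof (induction k)
    case (Suc k)
    show ?case by (rule Ck_Suc_real[where f'=exp]) (use Suc DERIV_exp in auto)
  qed (auto intro: continuous_intros)
  then show ?thesis by (simp add: smooth_def)
qed

lemma smooth_cosh: "smooth (cosh :: real \<Rightarrow> real)"
proof -
  have "Ck k (cosh :: real \<Rightarrow> real) \<and> Ck k (sinh :: real \<Rightarrow> real)" for k
  proof (induction k)
    case (Suc k)
    have "Ck (Suc k) (cosh :: real \<Rightarrow> real)"
      by (rule Ck_Suc_real[where f'=sinh]) (use Suc in \<open>auto intro!: derivative_eq_intros\<close>)
    moreover have "Ck (Suc k) (sinh :: real \<Rightarrow> real)"
      by (rule Ck_Suc_real[where f'=cosh]) (use Suc in \<open>auto intro!: derivative_eq_intros\<close>)
    ultimately show ?case by blast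
  qed (auto intro: continuous_intros)
  then show ?thesis by (simp add: smooth_def)
qed

lemma smooth_inner_self: "smooth (\<lambda>x. x \<bullet> x)"
proof -
  have "Ck k (\<lambda>x::'a. x \<bullet> x)" for k
  proof (cases k)
    case (Suc n)
    have "Ck n (\<lambda>x::'a. x \<bullet> b + b \<bullet> x)" for b
      by (intro Ck_bounded_linear bounded_linear_intros)
    then show ?thesis unfolding Suc
      by (intro Ck_has_derivativeI[where f'="\<lambda>x b. x \<bullet> b + b \<bullet> x"])
        (auto intro!: derivative_eq_intros simp: inner_commute)
  qed (auto intro: continuous_intros)
  then show ?thesis by (simp add: smooth_def)
qed

section \<open>Smooth steps and cutoffs\<close>

text \<open>The standard flat function exp(-1/x) is the member with index 0. The whole family is
  introduced because the derivative of each member is a combination of the next two, so smoothness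
  of all of them follows by one induction.\<close>

definition flat :: "nat \<Rightarrow> real \<Rightarrow> real" where
  "flat n x = (if x > 0 then exp (- (1 / x)) / x ^ n else 0)"

lemma flat_tendsto_0: "((\<lambda>x. flat n x) \<longlongrightarrow> 0) (at 0)"
proof -
  have "filterlim (\<lambda>x::real. exp (- (1 / x)) / x ^ n) (nhds 0) (at_right 0)"
  proof -
    have "((\<lambda>y::real. y ^ n / exp y) \<longlongrightarrow> 0) at_top" by (rule tendsto_power_div_exp_0)
    then have "((\<lambda>x::real. inverse x ^ n / exp (inverse x)) \<longlongrightarrow> 0) (at_right 0)"
      by (rule filterlim_compose[OF _ filterlim_inverse_at_top_right])
    then show ?thesis by (simp add: exp_minus divide_inverse power_inverse mult.commute)
  qed
  then have "((\<lambda>x. flat n x) \<longlongrightarrow> 0) (at_right 0)"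
    by (rule Lim_transform_eventually) (auto simp: flat_def eventually_at_filter)
  moreover have "((\<lambda>x. flat n x) \<longlongrightarrow> 0) (at_left 0)"
    by (rule Lim_transform_eventually[OF tendsto_const]) (auto simp: flat_def eventually_at_filter)
  ultimately show ?thesis by (simp add: filterlim_split_at_real)
qed

lemma flat_deriv: "(flat n has_real_derivative flat (n + 2) x - real n * flat (n + 1) x) (at x)"
proof -
  consider "x > 0" | "x < 0" | "x = 0" by linarith
  then show ?thesis
  proof cases
    case 1
    have "((\<lambda>x. exp (- (1 / x)) / x ^ n) has_real_derivative
        ((exp (- (1 / x)) * (1 / x\<^sup>2)) * x ^ n - exp (- (1 / x)) * (real n * x ^ (n - 1))) / (x ^ n * x ^ n)) (at x)"
      using 1 by (auto intro!: derivative_eq_intros simp: power2_eq_square)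
    moreover have "real n * x ^ (n - 1) = real n * x ^ n / x"
      using 1 by (cases n) auto
    then have "((exp (- (1 / x)) * (1 / x\<^sup>2)) * x ^ n - exp (- (1 / x)) * (real n * x ^ (n - 1))) / (x ^ n * x ^ n)
        = flat (n + 2) x - real n * flat (n + 1) x"
      using 1 by (simp only: flat_def if_True) (simp add: field_simps power2_eq_square)
    ultimately have "((\<lambda>x. exp (- (1 / x)) / x ^ n) has_real_derivative flat (n + 2) x - real n * flat (n + 1) x) (at x)"
      by (simp only:)
    then show ?thesis
      by (rule DERIV_cong_ev[THEN iffD1, rotated -1])
        (use 1 eventually_nhds_in_open[of "{0<..}" x] in \<open>auto simp: flat_def elim: eventually_mono\<close>)
  next
    case 2
    have "((\<lambda>x. 0) has_real_derivative flat (n + 2) x - real n * flat (n + 1) x) (at x)"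
      using 2 by (simp add: flat_def)
    then show ?thesis
      by (rule DERIV_cong_ev[THEN iffD1, rotated -1])
        (use 2 eventually_nhds_in_open[of "{..<0}" x] in \<open>auto simp: flat_def elim: eventually_mono\<close>)
  next
    case 3
    \<comment> \<open>The difference quotient at 0 is \<open>flat (n + 1)\<close>, which tends to
      0.\<close>
    have "((\<lambda>h. (flat n h - flat n 0) / (h - 0)) \<longlongrightarrow> 0) (at 0)"
      by (rule Lim_transform_eventually[OF flat_tendsto_0[of "n + 1"]])
        (auto simp: flat_def eventually_at_filter field_simps)
    then show ?thesis using 3 by (simp add: has_field_derivative_iff flat_def)
  qed
qed

lemma smooth_flat: "smooth (flat n)"
proof -
  have "Ck k (flat n)" for k
  proof (induction k arbitrary: n)
    case 0
    show ?case using flat_deriv by (auto intro!: DERIV_isCont continuous_at_imp_continuous_on)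
  next
    case (Suc k)
    have "Ck k (\<lambda>x. flat (n + 2) x + (- real n) * flat (n + 1) x)"
      by (intro Ck_add Ck_mult Ck_const Suc)
    then show ?case by (intro Ck_Suc_real[OF flat_deriv]) simp
  qed
  then show ?thesis by (simp add: smooth_def)
qed

text \<open>The step is the normalised antiderivative of a bump supported in [0,1]. Its derivative
  is exposed as well, since rescaled copies of it later act as an approximate identity.\<close>

lemma smooth_step_exists:
  "\<exists>S S' :: real \<Rightarrow> real. smooth S \<and> (\<forall>x. (S has_real_derivative S' x) (at x)) \<and> continuous_on UNIV S' \<and>
     (\<forall>x. 0 \<le> S' x \<and> 0 \<le> S x \<and> S x \<le> 1) \<and> (\<forall>x\<le>0. S x = 0 \<and> S' x = 0) \<and> (\<forall>x\<ge>1. S x = 1 \<and> S' x = 0)"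
proof -
  define g where "g = (\<lambda>x. flat 0 x * flat 0 (1 - x))"
  have sg: "smooth g"
  proof -
    have "smooth (\<lambda>x::real. 1 + (- 1) * x)"
      by (intro smooth_add smooth_mult smooth_const smooth_bounded_linear bounded_linear_ident)
    then show ?thesis unfolding g_def
      by (intro smooth_mult smooth_flat smooth_compose[OF smooth_flat]) simp
  qed
  have cg: "continuous_on UNIV g" by (rule smooth_has_derivative(3)[OF sg])
  have "\<exists>G. \<forall>x. - \<infinity> < ereal x \<longrightarrow> ereal x < \<infinity> \<longrightarrow> (G has_vector_derivative g x) (at x)"
    by (rule einterval_antiderivative) (use cg in \<open>auto simp: continuous_on_eq_continuous_at\<close>)
  then obtain G where G: "\<And>x. (G has_real_derivative g x) (at x)"
    by (auto simp: has_real_derivative_iff_has_vector_derivative)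
  have g0: "g x \<ge> 0" for x by (auto simp: g_def flat_def)
  have mono: "G x \<le> G y" if "x \<le> y" for x y
    by (rule DERIV_nonneg_imp_nondecreasing[OF that]) (use G g0 in blast)
  have G0: "G x = G 0" if "x \<le> 0" for x
  proof -
    have "G 0 \<le> G x"
      by (rule DERIV_nonpos_imp_nonincreasing[OF that]) (use G in \<open>force simp: g_def flat_def\<close>)
    with mono[OF that] show ?thesis by simp
  qed
  have G1: "G x = G 1" if "x \<ge> 1" for x
  proof -
    have "G x \<le> G 1"
      by (rule DERIV_nonpos_imp_nonincreasing[OF that]) (use G in \<open>force simp: g_def flat_def\<close>)
    with mono[OF that] show ?thesis by simp
  qed
  have "G 0 < G 1"
  proof (rule DERIV_pos_imp_increasing_open[of 0 1])
    show "\<exists>y. (G has_real_derivative y) (at x) \<and> 0 < y" if "0 < x" "x < 1" for x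
      using that G[of x] by (intro exI[of _ "g x"]) (auto simp: g_def flat_def)
    show "continuous_on {0..1} G"
      using G by (auto intro!: DERIV_isCont continuous_at_imp_continuous_on)
  qed auto
  define K where "K = 1 / (G 1 - G 0)"
  have K: "K > 0" using \<open>G 0 < G 1\<close> by (simp add: K_def)
  define S where "S = (\<lambda>x. K * (G x - G 0))"
  have dS: "(S has_real_derivative K * g x) (at x)" for x
    unfolding S_def by (auto intro!: derivative_eq_intros G)
  have "smooth S"
    by (rule smooth_antiderivative[OF dS]) (intro smooth_mult smooth_const sg)
  moreover have "0 \<le> S x \<and> S x \<le> 1" for x
    using mono[of 0 x] mono[of x 1] G0[of x] G1[of x] K \<open>G 0 < G 1\<close>
    by (cases "x \<le> 0"; cases "x \<ge> 1") (auto simp: S_def K_def field_simps)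
  moreover have "S x = 0" if "x \<le> 0" for x
    unfolding S_def G0[OF that] by simp
  moreover have "S x = 1" if "x \<ge> 1" for x
    unfolding S_def G1[OF that] K_def using \<open>G 0 < G 1\<close> by simp
  moreover have "continuous_on UNIV (\<lambda>x. K * g x)"
    by (intro continuous_intros cg)
  moreover have "0 \<le> K * g x" for x using K g0 by simp
  moreover have "K * g x = 0" if "x \<le> 0 \<or> x \<ge> 1" for x using that by (auto simp: g_def flat_def)
  ultimately show ?thesis using dS
    by (intro exI[of _ S] exI[of _ "\<lambda>x. K * g x"]) blast
qed

lemma compact_supp:
  fixes f :: "'a::euclidean_space \<Rightarrow> real"
  assumes "\<And>x. norm x > M \<Longrightarrow> f x = 0"
  shows "compact (supp f)"
proof -
  have "norm x \<le> M" if "f x \<noteq> 0" for x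
    using assms[of x] that by (cases "norm x > M") auto
  then have "supp f \<subseteq> cball 0 M" unfolding supp_def
    by (intro closure_minimal) auto
  then have "bounded (supp f)" by (rule bounded_subset[OF bounded_cball])
  moreover have "closed (supp f)" by (simp add: supp_def)
  ultimately show ?thesis by (simp add: compact_eq_bounded_closed)
qed

lemma ball_cutoff_exists:
  assumes "R \<ge> 0"
  shows "\<exists>\<theta> :: 'a::euclidean_space \<Rightarrow> real. smooth \<theta> \<and> (\<forall>x. 0 \<le> \<theta> x \<and> \<theta> x \<le> 1) \<and>
     (\<forall>x. norm x \<le> R \<longrightarrow> \<theta> x = 1) \<and> (\<forall>x. norm x > R + 1 \<longrightarrow> \<theta> x = 0)"
proof -
  obtain S S' :: "real \<Rightarrow> real" where S: "smooth S" "\<And>x. 0 \<le> S x \<and> S x \<le> 1" "\<And>x. x \<le> 0 \<Longrightarrow> S x = 0" "\<And>x. x \<ge> 1 \<Longrightarrow> S x = 1"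
    using smooth_step_exists by auto
  \<comment> \<open>The square of the norm is used because it is smooth at the origin. The argument
    of \<open>S\<close> is at least 1 exactly for norms up to \<open>R\<close>, and nonpositive
    beyond \<open>R + 1\<close> because \<open>R\<^sup>2 + 1 \<le> (R + 1)\<^sup>2\<close>.\<close>
  define \<theta> where "\<theta> = (\<lambda>x::'a. S ((R\<^sup>2 + 1) + (-1) * (x \<bullet> x)))"
  have "smooth \<theta>" unfolding \<theta>_def
    by (intro smooth_compose[OF S(1)] smooth_add smooth_mult smooth_const smooth_inner_self)
  moreover have "\<theta> x = 1" if "norm x \<le> R" for x
    using power_mono[OF that, of 2] unfolding \<theta>_def by (intro S(4)) (simp add: dot_square_norm)
  moreover have "\<theta> x = 0" if "norm x > R + 1" for x
  proof -
    have "(R + 1)\<^sup>2 \<le> (norm x)\<^sup>2" using that assms by (intro power_mono) auto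
    moreover have "R\<^sup>2 + 1 \<le> (R + 1)\<^sup>2" using assms by (simp add: power2_sum)
    ultimately show ?thesis unfolding \<theta>_def by (intro S(3)) (simp add: dot_square_norm)
  qed
  ultimately show ?thesis using S(2) by (intro exI[of _ \<theta>]) (auto simp: \<theta>_def)
qed

lemma Cc_infty_partial:
  fixes f :: "'a::euclidean_space \<Rightarrow> real"
  assumes "f \<in> Cc_infty" "b \<in> Basis"
  shows "(\<lambda>x. frechet_derivative f (at x) b) \<in> Cc_infty"
proof -
  have "frechet_derivative f (at x) b = 0" if "x \<notin> supp f" for x
  proof -
    have "open (- supp f)" by (simp add: supp_def open_Compl)
    moreover have "f y = 0" if "y \<in> - supp f" for y
      using that closure_subset[of "{x. f x \<noteq> 0}"] by (auto simp: supp_def)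
    ultimately have "(f has_derivative (\<lambda>_. 0)) (at x)"
      using that by (intro has_derivative_transform_within_open[of "\<lambda>_. 0" "\<lambda>_. 0" x UNIV "- supp f" f]) auto
    then have "(\<lambda>_. 0) = frechet_derivative f (at x)" by (rule frechet_derivative_at)
    then show ?thesis by metis
  qed
  then have "supp (\<lambda>x. frechet_derivative f (at x) b) \<subseteq> supp f"
    unfolding supp_def[of "\<lambda>x. frechet_derivative f (at x) b"]
    by (intro closure_minimal) (auto simp: supp_def)
  then have "compact (supp (\<lambda>x. frechet_derivative f (at x) b))"
    using assms(1) by (metis (mono_tags, lifting) Cc_infty_def bounded_subset closed_closure compact_eq_bounded_closed mem_Collect_eq supp_def)
  then show ?thesis using assms smooth_has_derivative(2) by (auto simp: Cc_infty_def)
qed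

section \<open>Pairing with test functions\<close>

abbreviation pairing :: "('a::euclidean_space \<Rightarrow> real) \<Rightarrow> ('a \<Rightarrow> real) \<Rightarrow> real" where
  "pairing f g \<equiv> \<integral>x. f x * g x \<partial>lebesgue"

lemma L2_inner_integrable:
  assumes "f \<in> L2" "g \<in> L2"
  shows "integrable lebesgue (\<lambda>x. f x \<bullet> g x)"
proof (rule Bochner_Integration.integrable_bound)
  show "integrable lebesgue (\<lambda>x. (norm (f x))\<^sup>2 + (norm (g x))\<^sup>2)"
    using assms by (auto simp: L2_def)
  show "(\<lambda>x. f x \<bullet> g x) \<in> borel_measurable lebesgue"
    using assms by (auto simp: L2_def)
  have "\<bar>f x \<bullet> g x\<bar> \<le> (norm (f x))\<^sup>2 + (norm (g x))\<^sup>2" for x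
  proof -
    have "\<bar>f x \<bullet> g x\<bar> \<le> norm (f x) * norm (g x)" by (rule Cauchy_Schwarz_ineq2)
    also have "\<dots> \<le> (norm (f x))\<^sup>2 + (norm (g x))\<^sup>2"
      using sum_squares_bound[of "norm (f x)" "norm (g x)"] mult_nonneg_nonneg[OF norm_ge_zero[of "f x"] norm_ge_zero[of "g x"]]
      by linarith
    finally show ?thesis .
  qed
  then show "AE x in lebesgue. norm (f x \<bullet> g x) \<le> norm ((norm (f x))\<^sup>2 + (norm (g x))\<^sup>2)"
    by (intro AE_I2) (simp add: abs_of_nonneg)
qed

lemma L2_mult_integrable:
  fixes f g :: "'a::euclidean_space \<Rightarrow> real"
  assumes "f \<in> L2" "g \<in> L2"
  shows "integrable lebesgue (\<lambda>x. f x * g x)"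
  using L2_inner_integrable[OF assms] by simp

lemma L2_diff:
  assumes "f \<in> L2" "g \<in> L2"
  shows "(\<lambda>x. f x - g x) \<in> L2"
proof -
  have "integrable lebesgue (\<lambda>x. (norm (f x))\<^sup>2 + (norm (g x))\<^sup>2 - 2 * (f x \<bullet> g x))"
    using assms L2_inner_integrable[OF assms] by (auto simp: L2_def)
  moreover have "(norm (f x))\<^sup>2 + (norm (g x))\<^sup>2 - 2 * (f x \<bullet> g x) = (norm (f x - g x))\<^sup>2" for x
    by (simp add: power2_norm_eq_inner inner_diff inner_commute)
  ultimately show ?thesis using assms by (auto simp: L2_def)
qed

lemma L2_scaleR: "f \<in> L2 \<Longrightarrow> (\<lambda>x. c *\<^sub>R f x) \<in> L2"
  by (auto simp: L2_def power_mult_distrib)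

lemma L2_component:
  assumes "F \<in> L2" "b \<in> Basis"
  shows "(\<lambda>x. F x \<bullet> b) \<in> L2"
proof -
  have "integrable lebesgue (\<lambda>x. (norm (F x \<bullet> b))\<^sup>2)"
  proof (rule Bochner_Integration.integrable_bound)
    show "integrable lebesgue (\<lambda>x. (norm (F x))\<^sup>2)" using assms by (simp add: L2_def)
    show "(\<lambda>x. (norm (F x \<bullet> b))\<^sup>2) \<in> borel_measurable lebesgue" using assms by (auto simp: L2_def)
    show "AE x in lebesgue. norm ((norm (F x \<bullet> b))\<^sup>2) \<le> norm ((norm (F x))\<^sup>2)"
      using Basis_le_norm[OF assms(2)] by (intro AE_I2) (simp flip: abs_le_square_iff)
  qed
  then show ?thesis using assms by (auto simp: L2_def)
qed

lemma L2_norm_nonneg: "L2_norm f \<ge> 0"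
  by (simp add: L2_norm_def)

text \<open>A coarse form of the Cauchy-Schwarz inequality: Young's inequality with the norm
  \<open>r\<close> of \<open>f\<close> as weight bounds the integrand by
  \<open>r * (norm (g x))\<^sup>2 + (1 / r) * (norm (f x))\<^sup>2\<close>, and the second term
  integrates to \<open>r\<close>. Linearity in the norm of \<open>f\<close> for fixed
  \<open>g\<close> is what the limits below require.\<close>

lemma L2_pairing_bound:
  fixes f g :: "'a::euclidean_space \<Rightarrow> 'b::euclidean_space"
  assumes f: "f \<in> L2" and g: "g \<in> L2"
  shows "\<bar>\<integral>x. f x \<bullet> g x \<partial>lebesgue\<bar> \<le> L2_norm f * ((\<integral>x. (norm (g x))\<^sup>2 \<partial>lebesgue) + 1)"
proof -
  define F where "F = (\<integral>x. (norm (f x))\<^sup>2 \<partial>lebesgue)"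
  define G where "G = (\<integral>x. (norm (g x))\<^sup>2 \<partial>lebesgue)"
  have if2: "integrable lebesgue (\<lambda>x. (norm (f x))\<^sup>2)" and ig2: "integrable lebesgue (\<lambda>x. (norm (g x))\<^sup>2)"
    using f g by (auto simp: L2_def)
  have F0: "F \<ge> 0" and G0: "G \<ge> 0" by (auto simp: F_def G_def)
  define r where "r = L2_norm f"
  have r: "r = sqrt F" by (simp add: r_def L2_norm_def F_def)
  show ?thesis
  proof (cases "r = 0")
    case True
    then have "F = 0" using r F0 by simp
    then have "AE x in lebesgue. (norm (f x))\<^sup>2 = 0"
      unfolding F_def using integral_nonneg_eq_0_iff_AE[OF if2] by simp
    then have "AE x in lebesgue. f x \<bullet> g x = 0" by eventually_elim simp
    then have "(\<integral>x. f x \<bullet> g x \<partial>lebesgue) = 0" by (rule integral_eq_zero_AE)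
    then show ?thesis using L2_norm_nonneg[of f] G0 by (simp add: G_def)
  next
    case False
    then have rpos: "r > 0" using r F0 by simp
    have "\<bar>\<integral>x. f x \<bullet> g x \<partial>lebesgue\<bar> \<le> (\<integral>x. \<bar>f x \<bullet> g x\<bar> \<partial>lebesgue)"
      by (rule integral_abs_bound)
    also have "\<dots> \<le> (\<integral>x. r * (norm (g x))\<^sup>2 + (1 / r) * (norm (f x))\<^sup>2 \<partial>lebesgue)"
    proof (rule integral_mono)
      show "integrable lebesgue (\<lambda>x. \<bar>f x \<bullet> g x\<bar>)" using L2_inner_integrable[OF f g] by simp
      show "integrable lebesgue (\<lambda>x. r * (norm (g x))\<^sup>2 + (1 / r) * (norm (f x))\<^sup>2)"
        using if2 ig2 by (intro Bochner_Integration.integrable_add integrable_mult_right)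
      fix x :: 'a
      have "\<bar>f x \<bullet> g x\<bar> \<le> norm (f x) * norm (g x)" by (rule Cauchy_Schwarz_ineq2)
      also have "\<dots> = (norm (f x) / sqrt r) * (sqrt r * norm (g x))" using rpos by simp
      also have "\<dots> \<le> (norm (f x) / sqrt r)\<^sup>2 + (sqrt r * norm (g x))\<^sup>2"
      proof -
        have "(norm (f x) / sqrt r) * (sqrt r * norm (g x)) \<ge> 0" using rpos by simp
        then show ?thesis using sum_squares_bound[of "norm (f x) / sqrt r" "sqrt r * norm (g x)"]
          by (simp only: mult.assoc)
      qed
      also have "\<dots> = r * (norm (g x))\<^sup>2 + (1 / r) * (norm (f x))\<^sup>2"
        using rpos by (simp add: power_divide power_mult_distrib)
      finally show "\<bar>f x \<bullet> g x\<bar> \<le> r * (norm (g x))\<^sup>2 + (1 / r) * (norm (f x))\<^sup>2" .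
    qed
    also have "\<dots> = r * G + (1 / r) * F"
      unfolding F_def G_def using if2 ig2 by simp
    also have "(1 / r) * F = r" using r rpos F0 by (simp add: real_div_sqrt)
    finally show ?thesis by (simp add: r_def G_def algebra_simps)
  qed
qed

lemma L2_pairing_tendsto_0:
  assumes "((\<lambda>s. L2_norm (w s)) \<longlongrightarrow> 0) F" and "eventually (\<lambda>s. w s \<in> L2) F" and "g \<in> L2"
  shows "((\<lambda>s. \<integral>x. w s x \<bullet> g x \<partial>lebesgue) \<longlongrightarrow> 0) F"
proof (rule Lim_null_comparison)
  show "((\<lambda>s. L2_norm (w s) * ((\<integral>x. (norm (g x))\<^sup>2 \<partial>lebesgue) + 1)) \<longlongrightarrow> 0) F"
    using tendsto_mult_left_zero[OF assms(1)] by simp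
  show "eventually (\<lambda>s. norm (\<integral>x. w s x \<bullet> g x \<partial>lebesgue) \<le> L2_norm (w s) * ((\<integral>x. (norm (g x))\<^sup>2 \<partial>lebesgue) + 1)) F"
    using assms(2) by eventually_elim (use L2_pairing_bound[OF _ assms(3)] in auto)
qed

lemma continuous_L2_pairing:
  fixes w :: "real \<Rightarrow> 'a::euclidean_space \<Rightarrow> real"
  assumes "continuous_L2 J w" "g \<in> L2"
  shows "continuous_on J (\<lambda>t. pairing (w t) g)"
  unfolding continuous_on_def
proof
  fix t assume t: "t \<in> J"
  have wL2: "w s \<in> L2" if "s \<in> J" for s using assms(1) that by (simp add: continuous_L2_def)
  have ev: "eventually (\<lambda>s. s \<in> J) (at t within J)" by (simp add: eventually_at_filter)
  have "((\<lambda>s. \<integral>x. (w s x - w t x) \<bullet> g x \<partial>lebesgue) \<longlongrightarrow> 0) (at t within J)"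
  proof (rule L2_pairing_tendsto_0)
    show "((\<lambda>s. L2_norm (\<lambda>x. w s x - w t x)) \<longlongrightarrow> 0) (at t within J)"
      using assms(1) t by (simp add: continuous_L2_def)
    show "eventually (\<lambda>s. (\<lambda>x. w s x - w t x) \<in> L2) (at t within J)"
      using ev by eventually_elim (intro L2_diff wL2 t)
  qed (fact assms(2))
  moreover have "eventually (\<lambda>s. (\<integral>x. (w s x - w t x) \<bullet> g x \<partial>lebesgue) =
      pairing (w s) g - pairing (w t) g) (at t within J)"
    using ev
  proof eventually_elim
    case (elim s)
    then show ?case
      using L2_mult_integrable[OF wL2 assms(2)] t by (simp add: left_diff_distrib)
  qed
  ultimately have "((\<lambda>s. pairing (w s) g - pairing (w t) g) \<longlongrightarrow> 0) (at t within J)"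
    by (rule Lim_transform_eventually)
  then show "((\<lambda>s. pairing (w s) g) \<longlongrightarrow> pairing (w t) g) (at t within J)"
    by (rule LIM_zero_cancel)
qed

lemma C1_L2_pairing:
  fixes w :: "real \<Rightarrow> 'a::euclidean_space \<Rightarrow> real"
  assumes "C1_L2 J w w'" "g \<in> L2" and t: "t \<in> J"
  shows "((\<lambda>s. pairing (w s) g) has_real_derivative (pairing (w' t) g)) (at t within J)"
  unfolding has_field_derivative_iff
proof -
  have wL2: "w s \<in> L2" "w' s \<in> L2" if "s \<in> J" for s
    using assms(1) that by (simp_all add: C1_L2_def continuous_L2_def)
  have quot: "(\<lambda>x. (w s x - w t x) / (s - t) - w' t x) \<in> L2" if "s \<in> J" for s
    using L2_diff[OF L2_scaleR[OF L2_diff[OF wL2(1)[OF that] wL2(1)[OF t]], of "inverse (s - t)"] wL2(2)[OF t]]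
    by (simp add: divide_inverse mult.commute)
  have ev: "eventually (\<lambda>s. s \<in> J \<and> s \<noteq> t) (at t within J)" by (simp add: eventually_at_filter)
  have "((\<lambda>s. \<integral>x. ((w s x - w t x) / (s - t) - w' t x) \<bullet> g x \<partial>lebesgue) \<longlongrightarrow> 0) (at t within J)"
  proof (rule L2_pairing_tendsto_0)
    show "((\<lambda>s. L2_norm (\<lambda>x. (w s x - w t x) / (s - t) - w' t x)) \<longlongrightarrow> 0) (at t within J)"
      using assms(1) t by (simp add: C1_L2_def)
    show "eventually (\<lambda>s. (\<lambda>x. (w s x - w t x) / (s - t) - w' t x) \<in> L2) (at t within J)"
      using ev by eventually_elim (intro quot; simp)
  qed (fact assms(2))
  moreover have "eventually (\<lambda>s. (\<integral>x. ((w s x - w t x) / (s - t) - w' t x) \<bullet> g x \<partial>lebesgue) =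
      (pairing (w s) g - pairing (w t) g) / (s - t) - pairing (w' t) g) (at t within J)"
    using ev
  proof eventually_elim
    case (elim s)
    then have s: "s \<in> J" by simp
    note i = L2_mult_integrable[OF wL2(1)[OF s] assms(2)] L2_mult_integrable[OF wL2(1)[OF t] assms(2)]
      L2_mult_integrable[OF wL2(2)[OF t] assms(2)]
    have "((w s x - w t x) / (s - t) - w' t x) \<bullet> g x = (w s x * g x - w t x * g x) / (s - t) - w' t x * g x" for x
      by (simp add: algebra_simps diff_divide_distrib)
    then show ?case using i by simp
  qed
  ultimately have "((\<lambda>s. (pairing (w s) g - pairing (w t) g) / (s - t) - pairing (w' t) g) \<longlongrightarrow> 0) (at t within J)"
    by (rule Lim_transform_eventually)
  then show "((\<lambda>s. (pairing (w s) g - pairing (w t) g) / (s - t)) \<longlongrightarrow> pairing (w' t) g) (at t within J)"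
    by (rule LIM_zero_cancel)
qed

lemma continuous_compact_supp_integrable:
  fixes f :: "'a::euclidean_space \<Rightarrow> real"
  assumes "continuous_on UNIV f" "compact (supp f)"
  shows "integrable lebesgue f"
proof -
  have "integrable lborel (\<lambda>x. indicator (supp f) x *\<^sub>R f x)"
    using assms continuous_on_subset by (intro borel_integrable_compact) auto
  moreover have "(\<lambda>x. indicator (supp f) x *\<^sub>R f x) = f"
    using closure_subset[of "{x. f x \<noteq> 0}"] by (intro ext) (auto simp: indicator_def supp_def)
  ultimately have "integrable lborel f" by simp
  then show ?thesis using assms(1) by (subst integrable_completion) (auto intro: borel_measurable_continuous_onI)
qed

lemma Cc_infty_continuous: "f \<in> Cc_infty \<Longrightarrow> continuous_on UNIV f"
  using smooth_has_derivative(3) by (auto simp: Cc_infty_def)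

lemma Cc_infty_integrable: "f \<in> Cc_infty \<Longrightarrow> integrable lebesgue f"
  using continuous_compact_supp_integrable Cc_infty_continuous by (auto simp: Cc_infty_def)

lemma supp_subset_support: "f x \<noteq> 0 \<Longrightarrow> x \<in> supp f"
  unfolding supp_def using closure_subset[of "{x. f x \<noteq> 0}"] by blast

lemma Cc_infty_L2:
  assumes "f \<in> Cc_infty"
  shows "f \<in> L2"
proof -
  have c: "continuous_on UNIV (\<lambda>x. (norm (f x))\<^sup>2)"
    using Cc_infty_continuous[OF assms] by (intro continuous_intros)
  have "supp (\<lambda>x. (norm (f x))\<^sup>2) = supp f" by (simp add: supp_def)
  then have "compact (supp (\<lambda>x. (norm (f x))\<^sup>2))" using assms by (simp add: Cc_infty_def)
  then have "integrable lebesgue (\<lambda>x. (norm (f x))\<^sup>2)"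
    by (rule continuous_compact_supp_integrable[OF c])
  then show ?thesis using Cc_infty_integrable[OF assms] by (auto simp: L2_def)
qed

lemma Cc_infty_bounded:
  assumes "f \<in> Cc_infty"
  shows "\<exists>M\<ge>0. \<forall>x. \<bar>f x\<bar> \<le> M"
proof -
  have "compact (f ` supp f)"
    using assms Cc_infty_continuous[OF assms] by (auto intro!: compact_continuous_image intro: continuous_on_subset simp: Cc_infty_def)
  then have "bounded (f ` supp f)" by (rule compact_imp_bounded)
  then obtain M where M: "\<forall>y\<in>f ` supp f. \<bar>y\<bar> \<le> M"
    by (auto simp: bounded_iff)
  have "\<bar>f x\<bar> \<le> max M 0" for x
    using M supp_subset_support[of f x] by (cases "f x = 0") (auto simp: max_def)
  then show ?thesis by (intro exI[of _ "max M 0"]) auto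
qed

lemma grad_component: "b \<in> Basis \<Longrightarrow> grad f x \<bullet> b = frechet_derivative f (at x) b"
  by (simp add: grad_def)

definition laplacian :: "('a::euclidean_space \<Rightarrow> real) \<Rightarrow> 'a \<Rightarrow> real" where
  "laplacian f x = (\<Sum>b\<in>Basis. frechet_derivative (\<lambda>y. frechet_derivative f (at y) b) (at x) b)"

text \<open>Every partial derivative of \<open>P\<close> is again a test function, so the definition
  of the weak gradient can be applied to it in the same direction and the results summed.\<close>

lemma weak_gradient_laplacian:
  assumes wg: "has_weak_gradient f F" and f: "f \<in> L2" and F: "F \<in> L2" and P: "P \<in> Cc_infty"
  shows "integrable lebesgue (\<lambda>x. F x \<bullet> grad P x)"
    and "(\<integral>x. F x \<bullet> grad P x \<partial>lebesgue) = - (\<integral>x. f x * laplacian P x \<partial>lebesgue)"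
proof -
  have P1: "(\<lambda>x. frechet_derivative P (at x) b) \<in> Cc_infty" if "b \<in> Basis" for b
    by (rule Cc_infty_partial[OF P that])
  have P2: "(\<lambda>x. frechet_derivative (\<lambda>y. frechet_derivative P (at y) b) (at x) b) \<in> Cc_infty" if "b \<in> Basis" for b
    by (rule Cc_infty_partial[OF P1[OF that] that])
  have eq: "F x \<bullet> grad P x = (\<Sum>b\<in>Basis. (F x \<bullet> b) * frechet_derivative P (at x) b)" for x
    by (subst euclidean_inner) (simp add: grad_component)
  have i1: "integrable lebesgue (\<lambda>x. (F x \<bullet> b) * frechet_derivative P (at x) b)" if "b \<in> Basis" for b
    by (rule L2_mult_integrable[OF L2_component[OF F that] Cc_infty_L2[OF P1[OF that]]])
  then show "integrable lebesgue (\<lambda>x. F x \<bullet> grad P x)"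
    unfolding eq by (intro Bochner_Integration.integrable_sum)
  have i2: "integrable lebesgue (\<lambda>x. f x * frechet_derivative (\<lambda>y. frechet_derivative P (at y) b) (at x) b)" if "b \<in> Basis" for b
    by (rule L2_mult_integrable[OF f Cc_infty_L2[OF P2[OF that]]])
  have "(\<integral>x. F x \<bullet> grad P x \<partial>lebesgue) = (\<Sum>b\<in>Basis. \<integral>x. (F x \<bullet> b) * frechet_derivative P (at x) b \<partial>lebesgue)"
    unfolding eq using i1 by (rule Bochner_Integration.integral_sum)
  also have "\<dots> = (\<Sum>b\<in>Basis. - (\<integral>x. f x * frechet_derivative (\<lambda>y. frechet_derivative P (at y) b) (at x) b \<partial>lebesgue))"
  proof (rule sum.cong[OF refl])
    fix b :: 'a assume b: "b \<in> Basis"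
    show "(\<integral>x. (F x \<bullet> b) * frechet_derivative P (at x) b \<partial>lebesgue) =
        - (\<integral>x. f x * frechet_derivative (\<lambda>y. frechet_derivative P (at y) b) (at x) b \<partial>lebesgue)"
      using wg P1[OF b] b unfolding has_weak_gradient_def by (fastforce simp: grad_component)
  qed
  also have "\<dots> = - (\<integral>x. (\<Sum>b\<in>Basis. f x * frechet_derivative (\<lambda>y. frechet_derivative P (at y) b) (at x) b) \<partial>lebesgue)"
    using i2 by (subst Bochner_Integration.integral_sum) (auto simp: sum_negf)
  finally show "(\<integral>x. F x \<bullet> grad P x \<partial>lebesgue) = - (\<integral>x. f x * laplacian P x \<partial>lebesgue)"
    by (simp add: laplacian_def sum_distrib_left)
qed

text \<open>The exponential is not compactly supported and must be cut off before it can be used as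
  a test function. On a ball containing the support of the solution the cutoff changes nothing. The
  eigenvalue equation is claimed on the open ball only, where the two functions agree in a
  neighbourhood.\<close>

lemma plane_wave_cutoff_exists:
  fixes e :: "'a::euclidean_space"
  assumes "R \<ge> 0" and e: "e \<in> Basis"
  shows "\<exists>P\<in>Cc_infty. (\<forall>x. 0 \<le> P x) \<and> (\<forall>x. norm x \<le> R \<longrightarrow> P x = exp (\<nu> * (x \<bullet> e))) \<and>
     (\<forall>x. norm x < R \<longrightarrow> laplacian P x = \<nu>\<^sup>2 * P x)"
proof -
  obtain \<theta> :: "'a \<Rightarrow> real" where \<theta>: "smooth \<theta>" "\<And>x. 0 \<le> \<theta> x" "\<And>x. norm x \<le> R \<Longrightarrow> \<theta> x = 1" "\<And>x. norm x > R + 1 \<Longrightarrow> \<theta> x = 0"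
    using ball_cutoff_exists[OF assms(1)] by blast
  define \<phi> where "\<phi> = (\<lambda>x::'a. exp (\<nu> * (x \<bullet> e)))"
  define P where "P = (\<lambda>x. \<theta> x * \<phi> x)"
  have "smooth \<phi>" unfolding \<phi>_def
    by (intro smooth_compose[OF smooth_exp] smooth_mult smooth_const smooth_bounded_linear bounded_linear_inner_left)
  then have smP: "smooth P" unfolding P_def by (intro smooth_mult \<theta>)
  moreover have "compact (supp P)"
    by (rule compact_supp[of "R + 1"]) (simp add: P_def \<theta>)
  ultimately have PC: "P \<in> Cc_infty" by (simp add: Cc_infty_def)
  have d\<phi>: "(\<phi> has_derivative (\<lambda>b. (\<nu> * (b \<bullet> e)) * \<phi> x)) (at x)" for x
    unfolding \<phi>_def by (auto intro!: derivative_eq_intros simp: mult.commute)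
  have inside: "P y = \<phi> y" if "y \<in> ball 0 R" for y using that by (simp add: P_def \<theta>)
  have d1: "frechet_derivative P (at x) = (\<lambda>b. (\<nu> * (b \<bullet> e)) * \<phi> x)" if "x \<in> ball 0 R" for x
    by (rule frechet_derivative_at[symmetric])
      (rule has_derivative_transform_within_open[OF d\<phi> open_ball that], simp add: inside)
  have d2: "frechet_derivative (\<lambda>y. frechet_derivative P (at y) b) (at x) = (\<lambda>c. (\<nu> * (b \<bullet> e)) * ((\<nu> * (c \<bullet> e)) * \<phi> x))"
    if "x \<in> ball 0 R" for x b
    by (rule frechet_derivative_at[symmetric])
      (rule has_derivative_transform_within_open[OF has_derivative_mult_right[OF d\<phi>] open_ball that], simp add: d1)
  have "laplacian P x = \<nu>\<^sup>2 * P x" if "norm x < R" for x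
  proof -
    have x: "x \<in> ball 0 R" using that by simp
    have "laplacian P x = (\<Sum>b\<in>Basis. (\<nu> * (b \<bullet> e)) * ((\<nu> * (b \<bullet> e)) * \<phi> x))"
      unfolding laplacian_def d2[OF x] ..
    also have "\<dots> = (\<Sum>b\<in>Basis. if b = e then \<nu>\<^sup>2 * \<phi> x else 0)"
      using e by (intro sum.cong) (auto simp: inner_Basis power2_eq_square)
    also have "\<dots> = \<nu>\<^sup>2 * \<phi> x" using e by simp
    finally show ?thesis using inside[OF x] by simp
  qed
  then show ?thesis using PC \<theta>
    by (intro bexI[of _ P]) (auto simp: P_def \<phi>_def)
qed

section \<open>Supports, Bochner integrals and plane waves\<close>

text \<open>By the Lindelof property countably many of the balls cover \<open>U\<close>, and
  countably many null sets can be discarded at once.\<close>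

lemma AE_zero_on_open:
  fixes f :: "'a::euclidean_space \<Rightarrow> real"
  assumes "open U" and loc: "\<And>x. x \<in> U \<Longrightarrow> \<exists>\<delta>>0. AE y in lebesgue. y \<in> ball x \<delta> \<longrightarrow> f y = 0"
  shows "AE x in lebesgue. x \<in> U \<longrightarrow> f x = 0"
proof -
  obtain \<delta> where \<delta>: "\<And>x. x \<in> U \<Longrightarrow> \<delta> x > 0 \<and> (AE y in lebesgue. y \<in> ball x (\<delta> x) \<longrightarrow> f y = 0)"
    using loc by metis
  obtain F where F: "F \<subseteq> (\<lambda>x. ball x (\<delta> x)) ` U" "countable F" "\<Union>F = (\<Union>x\<in>U. ball x (\<delta> x))"
    using Lindelof[of "(\<lambda>x. ball x (\<delta> x)) ` U"] by (metis (no_types, lifting) image_iff open_ball)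
  have "AE y in lebesgue. \<forall>B\<in>F. y \<in> B \<longrightarrow> f y = 0"
    using F(1) \<delta> by (subst AE_ball_countable[OF F(2)]) blast
  then show ?thesis
  proof eventually_elim
    case (elim y)
    show ?case
    proof
      assume "y \<in> U"
      then have "y \<in> \<Union>F" unfolding F(3) using \<delta> by force
      then show "f y = 0" using elim by blast
    qed
  qed
qed

lemma spacetime_supp_AE:
  fixes u :: "real \<Rightarrow> 'a::euclidean_space \<Rightarrow> real"
  assumes "spacetime_supp T u \<subseteq> {(x, t). t \<in> time_interval T \<and> norm x \<le> r + t}" and t: "t \<in> time_interval T"
  shows "AE x in lebesgue. norm x > r + t \<longrightarrow> u t x = 0"
proof -
  have "open {x::'a. norm x > r + t}"
    by (intro open_Collect_less continuous_intros)
  moreover have "\<exists>\<delta>>0. AE y in lebesgue. y \<in> ball x \<delta> \<longrightarrow> u t y = 0" if "x \<in> {x. norm x > r + t}" for x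
  proof -
    have "(x, t) \<notin> spacetime_supp T u" using assms(1) that by force
    then obtain \<delta> where "\<delta> > 0" "\<forall>s\<in>time_interval T. \<bar>s - t\<bar> < \<delta> \<longrightarrow> (AE y in lebesgue. y \<in> ball x \<delta> \<longrightarrow> u s y = 0)"
      using t by (auto simp: spacetime_supp_def)
    then show ?thesis using t by (intro exI[of _ \<delta>]) auto
  qed
  ultimately have "AE x in lebesgue. x \<in> {x. norm x > r + t} \<longrightarrow> u t x = 0"
    by (rule AE_zero_on_open)
  then show ?thesis by simp
qed

text \<open>The interval is open at its upper end, so there is always room to the right of
  \<open>t\<close>. Without this, limits within the interval would carry no information.\<close>

lemma time_interval_within_nontrivial:
  assumes "t \<in> time_interval T"
  shows "at t within time_interval T \<noteq> bot"
proof -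
  obtain t' where t': "t < t'" "ereal t' < T"
    using assms ereal_dense2[of "ereal t" T] by (auto simp: time_interval_def)
  have "at t within {t..t'} \<le> at t within time_interval T"
    using t' assms by (intro at_le) (auto simp: time_interval_def intro: le_less_trans[of "ereal _" "ereal t'" T])
  moreover have "at t within {t..t'} \<noteq> bot"
    using t' by (simp add: at_within_Icc_at_right)
  ultimately show ?thesis by (metis bot.extremum_uniqueI)
qed

text \<open>At distance \<open>h\<close> outside the cone, the difference quotients vanish for all
  times within \<open>h\<close> of \<open>t\<close>. The square integral of \<open>u' t\<close> over
  that region is then at most the squared error of the quotient, which tends to 0. The margin
  \<open>h\<close> is needed because the cone widens for later times.\<close>

lemma C1_L2_deriv_AE_zero:
  fixes u :: "real \<Rightarrow> 'a::euclidean_space \<Rightarrow> real"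
  assumes C1: "C1_L2 (time_interval T) u u'" and t: "t \<in> time_interval T"
    and zero: "\<And>s. s \<in> time_interval T \<Longrightarrow> AE x in lebesgue. norm x > r + s \<longrightarrow> u s x = 0"
  shows "AE x in lebesgue. norm x > r + t \<longrightarrow> u' t x = 0"
proof -
  let ?J = "time_interval T"
  have uL2: "u s \<in> L2" "u' s \<in> L2" if "s \<in> ?J" for s
    using C1 that by (simp_all add: C1_L2_def continuous_L2_def)
  have far: "AE x in lebesgue. norm x > r + t + h \<longrightarrow> u' t x = 0" if h: "h > 0" for h
  proof -
    let ?V = "{x::'a. norm x > r + t + h}"
    let ?f = "\<lambda>x. indicator ?V x * (u' t x)\<^sup>2"
    have "open ?V" by (intro open_Collect_less continuous_intros)
    then have V: "?V \<in> sets lebesgue" by (intro sets_completionI_sets) simp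
    have i': "integrable lebesgue (\<lambda>x. (u' t x)\<^sup>2)" using uL2(2)[OF t] by (simp add: L2_def)
    have if': "integrable lebesgue ?f"
      using integrable_mult_indicator[OF V i'] by simp
    have bound: "(\<integral>x. ?f x \<partial>lebesgue) \<le> (L2_norm (\<lambda>x. (u s x - u t x) / (s - t) - u' t x))\<^sup>2"
      if s: "s \<in> ?J" "\<bar>s - t\<bar> < h" for s
    proof -
      let ?q = "\<lambda>x. (u s x - u t x) / (s - t) - u' t x"
      have qL2: "?q \<in> L2"
        using L2_diff[OF L2_scaleR[OF L2_diff[OF uL2(1)[OF s(1)] uL2(1)[OF t]], of "inverse (s - t)"] uL2(2)[OF t]]
        by (simp add: divide_inverse mult.commute)
      have "(\<integral>x. ?f x \<partial>lebesgue) \<le> (\<integral>x. (norm (?q x))\<^sup>2 \<partial>lebesgue)"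
      proof (rule integral_mono_AE[OF if'])
        show "integrable lebesgue (\<lambda>x. (norm (?q x))\<^sup>2)" using qL2 by (simp add: L2_def)
        show "AE x in lebesgue. ?f x \<le> (norm (?q x))\<^sup>2"
          using zero[OF s(1)] zero[OF t]
        proof eventually_elim
          case (elim x)
          show ?case
          proof (cases "x \<in> ?V")
            case True
            then have "u s x = 0" "u t x = 0" using elim s(2) h by auto
            then show ?thesis by (simp add: indicator_def)
          qed simp
        qed
      qed
      also have "\<dots> = (L2_norm ?q)\<^sup>2" by (simp add: L2_norm_def)
      finally show ?thesis .
    qed
    have "((\<lambda>s. (L2_norm (\<lambda>x. (u s x - u t x) / (s - t) - u' t x))\<^sup>2) \<longlongrightarrow> 0\<^sup>2) (at t within ?J)"
      using C1 t by (intro tendsto_power) (simp add: C1_L2_def)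
    moreover have "eventually (\<lambda>s. (\<integral>x. ?f x \<partial>lebesgue) \<le> (L2_norm (\<lambda>x. (u s x - u t x) / (s - t) - u' t x))\<^sup>2) (at t within ?J)"
      unfolding eventually_at using h bound by (intro exI[of _ h]) (auto simp: dist_real_def)
    ultimately have "(\<integral>x. ?f x \<partial>lebesgue) \<le> 0\<^sup>2"
      using time_interval_within_nontrivial[OF t] by (intro tendsto_lowerbound)
    moreover have "(\<integral>x. ?f x \<partial>lebesgue) \<ge> 0" by (rule Bochner_Integration.integral_nonneg) simp
    ultimately have "(\<integral>x. ?f x \<partial>lebesgue) = 0" by simp
    then have "AE x in lebesgue. ?f x = 0"
      using integral_nonneg_eq_0_iff_AE[OF if'] by simp
    then show ?thesis by eventually_elim (auto simp: indicator_def split: if_splits)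
  qed
  \<comment> \<open>Countably many margins exhaust the exterior of the cone.\<close>
  have "AE x in lebesgue. \<forall>n::nat. norm x > r + t + inverse (real (Suc n)) \<longrightarrow> u' t x = 0"
    by (subst AE_all_countable) (intro allI far, simp)
  then show ?thesis
  proof eventually_elim
    case (elim x)
    show ?case
    proof
      assume "norm x > r + t"
      then obtain n where "inverse (real (Suc n)) < norm x - (r + t)"
        using reals_Archimedean[of "norm x - (r + t)"] by auto
      then have "norm x > r + t + inverse (real (Suc n))" by linarith
      then show "u' t x = 0" using elim by blast
    qed
  qed
qed

section \<open>Integrability in time of the tested source\<close>

lemma time_interval_cases:
  "time_interval T = {} \<or> time_interval T = {0..} \<or> (\<exists>r. time_interval T = {0..<r})"
  by (cases T) (auto simp: time_interval_def)

lemma time_interval_lebesgue: "time_interval T \<in> sets lebesgue"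
  using time_interval_cases[of T] by (elim disjE exE) (auto intro: lborelD)

lemma Bochner_L1_L1_AE_integrable:
  "Bochner_L1_L1 J F \<Longrightarrow> AE t in lebesgue. t \<in> J \<longrightarrow> integrable lebesgue (F t)"
  unfolding Bochner_L1_L1_def by (elim exE conjE) (erule AE_mp, auto)

lemma Cc_infty_mult_integrable:
  assumes f: "integrable lebesgue f" and P: "P \<in> Cc_infty"
  shows "integrable lebesgue (\<lambda>x. f x * P x)"
proof -
  obtain M where M: "M \<ge> 0" "\<And>x. \<bar>P x\<bar> \<le> M" using Cc_infty_bounded[OF P] by blast
  show ?thesis
  proof (rule Bochner_Integration.integrable_bound[of _ "\<lambda>x. M * f x"])
    show "integrable lebesgue (\<lambda>x. M * f x)" using f by simp
    show "(\<lambda>x. f x * P x) \<in> borel_measurable lebesgue" using f Cc_infty_integrable[OF P] by auto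
    show "AE x in lebesgue. norm (f x * P x) \<le> norm (M * f x)"
      using M by (intro AE_I2) (simp add: abs_mult mult.commute mult_right_mono)
  qed
qed

text \<open>Strong measurability supplies the measurability in time: the pairings of the simple
  approximants are measurable, and they converge almost everywhere because \<open>P\<close> is
  bounded. The same bound dominates the pairing by a multiple of the integrable norm.\<close>

lemma Bochner_L1_L1_pairing:
  fixes F :: "real \<Rightarrow> 'a::euclidean_space \<Rightarrow> real"
  assumes B: "Bochner_L1_L1 J F" and J: "J \<in> sets lebesgue" and P: "P \<in> Cc_infty"
  shows "set_integrable lebesgue J (\<lambda>t. pairing (F t) P)"
proof -
  obtain M where M: "M \<ge> 0" "\<And>x. \<bar>P x\<bar> \<le> M" using Cc_infty_bounded[OF P] by blast
  have iP: "integrable lebesgue (\<lambda>x. f x * P x)" if "integrable lebesgue f" for f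
    by (rule Cc_infty_mult_integrable[OF that P])
  obtain s where s: "\<And>n. L1_simple (s n)"
    and conv: "AE t in lebesgue. t \<in> J \<longrightarrow> integrable lebesgue (F t) \<and> (\<lambda>n. \<integral>x. \<bar>s n t x - F t x\<bar> \<partial>lebesgue) \<longlonglongrightarrow> 0"
    and int: "set_integrable lebesgue J (\<lambda>t. \<integral>x. \<bar>F t x\<bar> \<partial>lebesgue)"
    using B unfolding Bochner_L1_L1_def by blast
  define g where "g = (\<lambda>n t. indicator J t * pairing (s n t) P)"
  have s_int: "integrable lebesgue (s n t)" for n t
  proof -
    obtain m :: nat and A h where *: "\<forall>k<m. A k \<in> sets lebesgue \<and> integrable lebesgue (h k)"
      "\<And>t x. s n t x = (\<Sum>k<m. indicator (A k) t * h k x)"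
      using s[of n] unfolding L1_simple_def by metis
    have "s n t = (\<lambda>x. \<Sum>k<m. indicator (A k) t * h k x)" using *(2) by auto
    then show ?thesis using *(1) by (auto intro!: Bochner_Integration.integrable_sum)
  qed
  have g_meas: "g n \<in> borel_measurable lebesgue" for n
  proof -
    obtain m :: nat and A h where *: "\<forall>k<m. A k \<in> sets lebesgue \<and> integrable lebesgue (h k)"
      "\<And>t x. s n t x = (\<Sum>k<m. indicator (A k) t * h k x)"
      using s[of n] unfolding L1_simple_def by metis
    have "pairing (s n t) P = (\<Sum>k<m. indicator (A k) t * pairing (h k) P)" for t
    proof -
      have "pairing (s n t) P = (\<integral>x. (\<Sum>k<m. indicator (A k) t * (h k x * P x)) \<partial>lebesgue)"
        unfolding *(2) by (simp add: sum_distrib_right mult.assoc)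
      also have "\<dots> = (\<Sum>k<m. \<integral>x. indicator (A k) t * (h k x * P x) \<partial>lebesgue)"
        using iP *(1) by (intro Bochner_Integration.integral_sum) auto
      finally show ?thesis by simp
    qed
    then have "g n = (\<lambda>t. indicator J t * (\<Sum>k<m. indicator (A k) t * pairing (h k) P))"
      by (simp add: g_def)
    then show ?thesis using *(1) J
      by (simp only:) (intro borel_measurable_times borel_measurable_sum borel_measurable_indicator borel_measurable_const, auto)
  qed
  let ?f = "\<lambda>t. indicator J t * pairing (F t) P"
  have lim: "AE t in lebesgue. (\<lambda>n. g n t) \<longlonglongrightarrow> ?f t"
    using conv
  proof eventually_elim
    case (elim t)
    show ?case
    proof (cases "t \<in> J")
      case True
      then have iF: "integrable lebesgue (F t)" and c: "(\<lambda>n. \<integral>x. \<bar>s n t x - F t x\<bar> \<partial>lebesgue) \<longlonglongrightarrow> 0"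
        using elim by auto
      have "(\<lambda>n. g n t - ?f t) \<longlonglongrightarrow> 0"
      proof (rule Lim_null_comparison)
        show "(\<lambda>n. M * (\<integral>x. \<bar>s n t x - F t x\<bar> \<partial>lebesgue)) \<longlonglongrightarrow> 0"
          using tendsto_mult_right_zero[OF c] by simp
        have "norm (g n t - ?f t) \<le> M * (\<integral>x. \<bar>s n t x - F t x\<bar> \<partial>lebesgue)" for n
        proof -
          have id: "integrable lebesgue (\<lambda>x. s n t x - F t x)" using s_int iF by simp
          have "g n t - ?f t = (\<integral>x. (s n t x - F t x) * P x \<partial>lebesgue)"
            using True iP[OF s_int[of n t]] iP[OF iF] by (simp add: g_def left_diff_distrib)
          also have "\<bar>\<dots>\<bar> \<le> (\<integral>x. \<bar>(s n t x - F t x) * P x\<bar> \<partial>lebesgue)" by (rule integral_abs_bound)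
          also have "\<dots> \<le> (\<integral>x. M * \<bar>s n t x - F t x\<bar> \<partial>lebesgue)"
          proof (rule integral_mono)
            show "integrable lebesgue (\<lambda>x. \<bar>(s n t x - F t x) * P x\<bar>)" using iP[OF id] by simp
            show "integrable lebesgue (\<lambda>x. M * \<bar>s n t x - F t x\<bar>)" using id by simp
            show "\<bar>(s n t x - F t x) * P x\<bar> \<le> M * \<bar>s n t x - F t x\<bar>" for x
              using M(2)[of x] by (simp add: abs_mult mult.commute mult_right_mono)
          qed
          finally show ?thesis by simp
        qed
        then show "eventually (\<lambda>n. norm (g n t - ?f t) \<le> M * (\<integral>x. \<bar>s n t x - F t x\<bar> \<partial>lebesgue)) sequentially"
          by (simp add: always_eventually)
      qed
      then show ?thesis by (rule LIM_zero_cancel)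
    qed (simp add: g_def)
  qed
  have f_meas: "?f \<in> borel_measurable lebesgue"
  proof (rule borel_measurable_AE)
    show "(\<lambda>t. lim (\<lambda>n. g n t)) \<in> borel_measurable lebesgue"
      by (rule borel_measurable_lim_metric) (rule g_meas)
    show "AE t in lebesgue. lim (\<lambda>n. g n t) = ?f t"
      using lim by eventually_elim (rule limI)
  qed
  have "integrable lebesgue ?f"
  proof (rule Bochner_Integration.integrable_bound[OF _ f_meas])
    show "integrable lebesgue (\<lambda>t. M * (indicator J t * (\<integral>x. \<bar>F t x\<bar> \<partial>lebesgue)))"
      using int by (simp add: set_integrable_def)
    show "AE t in lebesgue. norm (?f t) \<le> norm (M * (indicator J t * (\<integral>x. \<bar>F t x\<bar> \<partial>lebesgue)))"
      using conv
    proof eventually_elim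
      case (elim t)
      show ?case
      proof (cases "t \<in> J")
        case True
        then have iF: "integrable lebesgue (F t)" using elim by auto
        have "\<bar>pairing (F t) P\<bar> \<le> (\<integral>x. \<bar>F t x * P x\<bar> \<partial>lebesgue)" by (rule integral_abs_bound)
        also have "\<dots> \<le> (\<integral>x. M * \<bar>F t x\<bar> \<partial>lebesgue)"
        proof (rule integral_mono)
          show "integrable lebesgue (\<lambda>x. \<bar>F t x * P x\<bar>)" using iP[OF iF] by simp
          show "integrable lebesgue (\<lambda>x. M * \<bar>F t x\<bar>)" using iF by simp
          show "\<bar>F t x * P x\<bar> \<le> M * \<bar>F t x\<bar>" for x
            using M(2)[of x] by (simp add: abs_mult mult.commute mult_right_mono)
        qed
        finally show ?thesis using True M(1) by (simp add: abs_mult)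
      qed simp
    qed
  qed
  then show ?thesis by (simp add: set_integrable_def)
qed

section \<open>Mass of a plane wave on a ball\<close>

text \<open>One half of the exponential decay absorbs the polynomial; the other half is a convergent
  geometric series.\<close>

lemma summable_exp_power:
  assumes "c > 0"
  shows "summable (\<lambda>j. exp (- c * real j) * real (Suc j) ^ n)"
proof (rule summable_comparison_test_ev)
  have "filterlim (\<lambda>x::real. exp (- (c / 2) * x) * (x + 1) ^ n) (nhds 0) at_top"
    using assms by real_asymp
  then have "filterlim (\<lambda>j. exp (- (c / 2) * real j) * (real j + 1) ^ n) (nhds 0) sequentially"
    by (rule filterlim_compose[OF _ filterlim_real_sequentially])
  then have "eventually (\<lambda>j. exp (- (c / 2) * real j) * (real j + 1) ^ n < 1) sequentially"
    by (rule order_tendstoD) simp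
  then show "eventually (\<lambda>j. norm (exp (- c * real j) * real (Suc j) ^ n) \<le> exp (- (c / 2)) ^ j) sequentially"
  proof eventually_elim
    case (elim j)
    have "exp (- c * real j) * real (Suc j) ^ n = exp (- (c / 2) * real j) * (exp (- (c / 2) * real j) * (real j + 1) ^ n)"
      by (simp add: mult.assoc[symmetric] exp_add[symmetric] add.commute)
    also have "\<dots> \<le> exp (- (c / 2) * real j) * 1" using elim by (intro mult_left_mono) auto
    also have "\<dots> = exp (- (c / 2)) ^ j" by (simp add: exp_of_nat_mult[symmetric] mult.commute)
    finally show ?case by simp
  qed
  show "summable (\<lambda>j. exp (- (c / 2)) ^ j)" using assms by (intro summable_geometric) simp
qed

text \<open>The slab at depth \<open>j\<close> below the top of the ball has width of order \<open>sqrt (\<rho> j)\<close> in the directions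
  orthogonal to \<open>e\<close>; summing over the slabs gives the power \<open>\<rho>\<close> to the \<open>(N - 1) / 2\<close>.\<close>

lemma plane_wave_ball_bound:
  fixes e :: "'a::euclidean_space"
  assumes e: "e \<in> Basis" and c: "c > 0"
  shows "\<exists>C>0. \<forall>\<rho>\<ge>1. (LINT x:cball 0 \<rho>|lebesgue. exp (c * (x \<bullet> e))) \<le> C * exp (c * \<rho>) * \<rho> powr ((real DIM('a) - 1) / 2)"
proof -
  define n where "n = DIM('a) - 1"
  define S where "S = (\<Sum>j. exp (- c * real j) * real (Suc j) ^ n)"
  note summ = summable_exp_power[OF c, of n]
  have S: "S > 0" unfolding S_def by (rule suminf_pos[OF summ]) simp
  have DIM: "(real DIM('a) - 1) / 2 = real n / 2" using DIM_positive[where 'a='a] by (simp add: n_def of_nat_diff)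
  have "(LINT x:cball 0 \<rho>|lebesgue. exp (c * (x \<bullet> e))) \<le> (2 * sqrt 2) ^ n * S * exp (c * \<rho>) * \<rho> powr (real n / 2)"
    if \<rho>: "\<rho> \<ge> 1" for \<rho>
  proof -
    \<comment> \<open>The depth below the top of the ball ranges up to the diameter
      \<open>2 * \<rho>\<close>, so this many slabs of thickness one suffice.\<close>
    define J where "J = Suc (nat \<lceil>2 * \<rho>\<rceil>)"
    \<comment> \<open>Half the width of the slab: at depth between j and j+1, the square of any
      other coordinate is at most
      \<open>(\<rho> - x \<bullet> e) * (\<rho> + x \<bullet> e)\<close>, hence at most
      \<open>(real j + 1) * (2 * \<rho>)\<close>.\<close>
    define d where "d = (\<lambda>j. sqrt (2 * \<rho> * real (Suc j)))"
    have d: "d j \<ge> 0" for j using \<rho> by (simp add: d_def)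
    define lo where "lo = (\<lambda>j. \<Sum>b\<in>Basis. (if b = e then \<rho> - real j - 1 else - d j) *\<^sub>R b)"
    define hi where "hi = (\<lambda>j. \<Sum>b\<in>Basis. (if b = e then \<rho> - real j else d j) *\<^sub>R b)"
    define box where "box = (\<lambda>j. cbox (lo j) (hi j))"
    have lo: "lo j \<bullet> b = (if b = e then \<rho> - real j - 1 else - d j)" and
      hi: "hi j \<bullet> b = (if b = e then \<rho> - real j else d j)" if "b \<in> Basis" for j b
      using that by (simp_all add: lo_def hi_def)
    have vol: "measure lebesgue (box j) = (2 * d j) ^ n" for j
    proof -
      have "lo j \<bullet> b \<le> hi j \<bullet> b" if "b \<in> Basis" for b using d[of j] by (simp add: lo[OF that] hi[OF that])
      then have "cbox (lo j) (hi j) \<noteq> {}" by (simp add: box_ne_empty)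
      then have "measure lborel (box j) = (\<Prod>b\<in>Basis. hi j \<bullet> b - lo j \<bullet> b)"
        unfolding box_def by (rule content_cbox')
      also have "\<dots> = (\<Prod>b\<in>Basis. if b = e then 1 else 2 * d j)"
        by (intro prod.cong) (auto simp: lo hi)
      also have "\<dots> = (\<Prod>b\<in>Basis - {e}. 2 * d j)"
        using e by (subst prod.remove[of _ e]) (auto intro!: prod.cong)
      also have "\<dots> = (2 * d j) ^ n" using e by (simp add: n_def)
      finally show ?thesis by (simp add: box_def)
    qed
    have cover: "\<exists>j<J. x \<in> box j" if x: "x \<in> cball 0 \<rho>" for x
    proof -
      have nx: "norm x \<le> \<rho>" using x by simp
      have xe: "\<bar>x \<bullet> e\<bar> \<le> \<rho>" using Basis_le_norm[OF e, of x] nx by linarith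
      define j where "j = nat \<lfloor>\<rho> - x \<bullet> e\<rfloor>"
      have j0: "\<rho> - x \<bullet> e \<ge> 0" "\<rho> - x \<bullet> e \<le> 2 * \<rho>" using xe by auto
      then have j: "real j \<le> \<rho> - x \<bullet> e" "\<rho> - x \<bullet> e < real j + 1"
        unfolding j_def by (auto simp: of_nat_nat)
      have "j < J" using j(1) j0(2) unfolding J_def by linarith
      moreover have "x \<in> box j"
        unfolding box_def mem_box
      proof
        fix b :: 'a assume b: "b \<in> Basis"
        show "lo j \<bullet> b \<le> x \<bullet> b \<and> x \<bullet> b \<le> hi j \<bullet> b"
        proof (cases "b = e")
          case True
          then show ?thesis unfolding lo[OF b] hi[OF b] using j by simp
        next
          case False
          have "(x \<bullet> e)\<^sup>2 + (x \<bullet> b)\<^sup>2 = (\<Sum>i\<in>{e, b}. (x \<bullet> i)\<^sup>2)" using False by auto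
          also have "\<dots> \<le> (\<Sum>i\<in>Basis. (x \<bullet> i)\<^sup>2)" using e b by (intro sum_mono2) auto
          also have "\<dots> = (norm x)\<^sup>2"
            unfolding power2_norm_eq_inner by (subst euclidean_inner[of x x]) (simp add: power2_eq_square)
          also have "\<dots> \<le> \<rho>\<^sup>2" using nx by (intro power_mono) auto
          finally have 1: "(x \<bullet> b)\<^sup>2 \<le> \<rho>\<^sup>2 - (x \<bullet> e)\<^sup>2" by simp
          also have "\<dots> = (\<rho> - x \<bullet> e) * (\<rho> + x \<bullet> e)" by (simp add: power2_eq_square algebra_simps)
          also have "\<dots> \<le> (real j + 1) * (2 * \<rho>)" using j xe j0 by (intro mult_mono) auto
          also have "\<dots> = 2 * \<rho> * real (Suc j)" by simp
          finally have "\<bar>x \<bullet> b\<bar>\<^sup>2 \<le> 2 * \<rho> * real (Suc j)" by simp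
          then have "\<bar>x \<bullet> b\<bar> \<le> d j" unfolding d_def by (rule real_le_rsqrt)
          then show ?thesis unfolding lo[OF b] hi[OF b] using False by auto
        qed
      qed
      ultimately show ?thesis by blast
    qed
    have boxm: "box j \<in> lmeasurable" for j by (simp add: box_def)
    have ibox: "integrable lebesgue (\<lambda>x. exp (c * (\<rho> - real j)) * indicator (box j) x)" for j
      using boxm by (intro integrable_mult_right) (simp add: lmeasurable_iff_integrable)
    have "(LINT x:cball 0 \<rho>|lebesgue. exp (c * (x \<bullet> e))) \<le> (\<integral>x. (\<Sum>j<J. exp (c * (\<rho> - real j)) * indicator (box j) x) \<partial>lebesgue)"
      unfolding set_lebesgue_integral_def
    proof (rule integral_mono)
      have "set_integrable lborel (cball 0 \<rho>) (\<lambda>x::'a. exp (c * (x \<bullet> e)))"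
        unfolding set_integrable_def by (intro borel_integrable_compact continuous_intros) auto
      then show "integrable lebesgue (\<lambda>x::'a. indicator (cball 0 \<rho>) x *\<^sub>R exp (c * (x \<bullet> e)))"
        unfolding set_integrable_def by (subst integrable_completion) (auto dest: borel_measurable_integrable)
      show "integrable lebesgue (\<lambda>x. \<Sum>j<J. exp (c * (\<rho> - real j)) * indicator (box j) x)"
        by (intro Bochner_Integration.integrable_sum ibox)
      fix x :: 'a
      show "indicator (cball 0 \<rho>) x *\<^sub>R exp (c * (x \<bullet> e)) \<le> (\<Sum>j<J. exp (c * (\<rho> - real j)) * indicator (box j) x)"
      proof (cases "x \<in> cball 0 \<rho>")
        case True
        then obtain j where j: "j < J" "x \<in> box j" using cover by blast
        have "x \<bullet> e \<le> \<rho> - real j" using j(2) e unfolding box_def mem_box by (auto simp: hi)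
        then have "exp (c * (x \<bullet> e)) \<le> exp (c * (\<rho> - real j)) * indicator (box j) x"
          using j(2) c by simp
        also have "\<dots> \<le> (\<Sum>j<J. exp (c * (\<rho> - real j)) * indicator (box j) x)"
          using j(1) by (intro member_le_sum) auto
        finally show ?thesis using True by simp
      qed (simp add: sum_nonneg)
    qed
    also have "\<dots> = (\<Sum>j<J. exp (c * (\<rho> - real j)) * measure lebesgue (box j))"
      using ibox by (subst Bochner_Integration.integral_sum) auto
    also have "\<dots> \<le> (\<Sum>j<J. (2 * sqrt 2) ^ n * exp (c * \<rho>) * \<rho> powr (real n / 2) * (exp (- c * real j) * real (Suc j) ^ n))"
    proof (rule sum_mono)
      fix j assume "j \<in> {..<J}"
      have "2 * d j = 2 * sqrt 2 * sqrt \<rho> * sqrt (real (Suc j))" by (simp add: d_def real_sqrt_mult)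
      \<comment> \<open>The root of \<open>Suc j\<close> is replaced by \<open>Suc j\<close> itself;
        this keeps the powers integral, and the exponential decay in j still makes the sum
        converge.\<close>
      also have "\<dots> \<le> 2 * sqrt 2 * sqrt \<rho> * real (Suc j)"
        using \<rho> by (intro mult_left_mono real_le_lsqrt) (auto simp: power2_eq_square)
      finally have "(2 * d j) ^ n \<le> (2 * sqrt 2 * sqrt \<rho> * real (Suc j)) ^ n"
        using d by (intro power_mono) auto
      also have "\<dots> = (2 * sqrt 2) ^ n * sqrt \<rho> ^ n * real (Suc j) ^ n" by (simp add: power_mult_distrib)
      also have "sqrt \<rho> ^ n = \<rho> powr (real n / 2)"
        using \<rho> by (simp add: powr_half_sqrt[symmetric] powr_powr powr_realpow[symmetric])
      finally have "exp (c * (\<rho> - real j)) * (2 * d j) ^ n \<le>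
          exp (c * (\<rho> - real j)) * ((2 * sqrt 2) ^ n * \<rho> powr (real n / 2) * real (Suc j) ^ n)"
        by (intro mult_left_mono) auto
      moreover have "exp (c * (\<rho> - real j)) = exp (c * \<rho>) * exp (- c * real j)"
        by (simp add: exp_add[symmetric] right_diff_distrib)
      ultimately show "exp (c * (\<rho> - real j)) * measure lebesgue (box j) \<le>
          (2 * sqrt 2) ^ n * exp (c * \<rho>) * \<rho> powr (real n / 2) * (exp (- c * real j) * real (Suc j) ^ n)"
        unfolding vol by (simp add: mult_ac)
    qed
    also have "\<dots> = (2 * sqrt 2) ^ n * exp (c * \<rho>) * \<rho> powr (real n / 2) * (\<Sum>j<J. exp (- c * real j) * real (Suc j) ^ n)"
      by (simp add: sum_distrib_left)
    also have "\<dots> \<le> (2 * sqrt 2) ^ n * exp (c * \<rho>) * \<rho> powr (real n / 2) * S"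
      unfolding S_def by (intro mult_left_mono sum_le_suminf[OF summ]) auto
    finally show ?thesis by (simp add: mult_ac)
  qed
  then show ?thesis unfolding DIM using S by (intro exI[of _ "(2 * sqrt 2) ^ n * S"]) auto
qed

section \<open>The weak wave equation\<close>

text \<open>The lower bound \<open>a\<close> serves the compactness of the support and may be
  negative, so \<zeta> need not vanish at time 0 and the initial data stay visible.\<close>

lemma separated_spacetime_test:
  fixes P :: "'a::euclidean_space \<Rightarrow> real" and \<zeta> :: "real \<Rightarrow> real"
  assumes P: "P \<in> Cc_infty" and \<zeta>: "smooth \<zeta>" and zero: "\<And>s. s < a \<or> s \<ge> b \<Longrightarrow> \<zeta> s = 0" and b: "ereal b < T"
  shows "(\<lambda>z. P (fst z) * \<zeta> (snd z)) \<in> spacetime_test T"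
proof -
  let ?\<Psi> = "\<lambda>z. P (fst z) * \<zeta> (snd z)"
  have "smooth ?\<Psi>" using P \<zeta> by (intro smooth_mult smooth_fst smooth_snd) (auto simp: Cc_infty_def)
  moreover have sub: "supp ?\<Psi> \<subseteq> supp P \<times> {a..b}"
    unfolding supp_def[of ?\<Psi>]
  proof (rule closure_minimal)
    show "{z. ?\<Psi> z \<noteq> 0} \<subseteq> supp P \<times> {a..b}"
      using zero supp_subset_support[of P] by (force simp: not_less[symmetric])
    show "closed (supp P \<times> {a..b})" by (intro closed_Times) (auto simp: supp_def)
  qed
  moreover have "compact (supp ?\<Psi>)"
  proof -
    have "compact (supp P \<times> {a..b})" using P by (intro compact_Times) (auto simp: Cc_infty_def)
    then have "compact ((supp P \<times> {a..b}) \<inter> supp ?\<Psi>)" by (rule compact_Int_closed) (simp add: supp_def)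
    then show ?thesis using sub by (simp add: Int_absorb1)
  qed
  moreover have "supp P \<times> {a..b} \<subseteq> {(x, t). ereal t < T}"
    using b by (auto intro: le_less_trans[of "ereal _" "ereal b"])
  ultimately show ?thesis unfolding spacetime_test_def Cc_infty_def by blast
qed

lemma laplacian_measurable:
  assumes "P \<in> Cc_infty"
  shows "(\<lambda>x. laplacian P x) \<in> borel_measurable lebesgue"
  unfolding laplacian_def
proof (rule borel_measurable_sum)
  fix b :: 'a assume b: "b \<in> Basis"
  show "(\<lambda>x. frechet_derivative (\<lambda>y. frechet_derivative P (at y) b) (at x) b) \<in> borel_measurable lebesgue"
    using Cc_infty_integrable[OF Cc_infty_partial[OF Cc_infty_partial[OF assms b] b]] by auto
qed

text \<open>A product test function reduces the wave equation to the weak form of \<beta>'' =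
  \<nu>^2 \<beta> + f for the scalar function \<open>pairing (w s) P\<close>. The gradient term
  becomes a Laplacian on \<open>P\<close>, which is multiplication by \<open>\<nu>\<^sup>2\<close>
  wherever the solution lives.\<close>

lemma weak_wave_eq_separated:
  fixes w wt F :: "real \<Rightarrow> 'a::euclidean_space \<Rightarrow> real" and \<zeta> :: "real \<Rightarrow> real"
  assumes weak: "weak_wave_eq T wt Dw F w\<^sub>1" and H1: "continuous_H1 (time_interval T) w Dw"
    and C1: "C1_L2 (time_interval T) w wt" and P: "P \<in> Cc_infty"
    and T1: "0 \<le> T1" "ereal T1 < T"
    and lap: "\<And>s. 0 \<le> s \<Longrightarrow> s < T1 \<Longrightarrow> AE x in lebesgue. w s x * laplacian P x = \<nu>\<^sup>2 * (w s x * P x)"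
    and \<zeta>: "smooth \<zeta>" "\<And>s. (\<zeta> has_real_derivative \<zeta>' s) (at s)" "\<And>s. s < -2 \<or> s \<ge> T1 \<Longrightarrow> \<zeta> s = 0"
  shows "pairing w\<^sub>1 P * \<zeta> 0 + (LINT s:{0..T1}|lebesgue. \<zeta> s * pairing (F s) P) =
    (LINT s:{0..T1}|lebesgue. - \<zeta>' s * pairing (wt s) P - \<nu>\<^sup>2 * \<zeta> s * pairing (w s) P)"
proof -
  let ?J = "time_interval T" and ?\<Psi> = "\<lambda>z. P (fst z) * \<zeta> (snd z)"
  have sub: "{0..T1} \<subseteq> ?J" using T1 by (auto simp: time_interval_def intro: le_less_trans[of "ereal _" "ereal T1"])
  have \<zeta>'0: "\<zeta>' s = 0" if "s > T1" for s
  proof -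
    have "(\<zeta> has_real_derivative 0) (at s)"
      by (rule has_field_derivative_transform_within_open[of "\<lambda>_. 0" _ _ "{T1<..}"]) (use that \<zeta>(3) in auto)
    then show ?thesis using \<zeta>(2) DERIV_unique by blast
  qed
  have wL2: "w s \<in> L2" "wt s \<in> L2" "Dw s \<in> L2" "has_weak_gradient (w s) (Dw s)" if "s \<in> ?J" for s
    using H1 C1 that by (simp_all add: continuous_H1_def C1_L2_def continuous_L2_def)
  have restrict: "(LINT s:?J|lebesgue. g s) = (LINT s:{0..T1}|lebesgue. h s)"
    if "\<And>s. s \<in> {0..T1} \<Longrightarrow> g s = h s" "\<And>s. s \<in> ?J \<Longrightarrow> s > T1 \<Longrightarrow> g s = 0" for g h :: "real \<Rightarrow> real"
    unfolding set_lebesgue_integral_def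
  proof (rule Bochner_Integration.integral_cong[OF refl])
    fix s
    show "indicator ?J s *\<^sub>R g s = indicator {0..T1} s *\<^sub>R h s"
    proof (cases "s \<in> {0..T1}")
      case True
      then show ?thesis using that(1)[OF True] sub by (auto simp: indicator_def)
    next
      case False
      then have "s \<in> ?J \<Longrightarrow> g s = 0" using that(2)[of s] by (auto simp: time_interval_def)
      then show ?thesis using False by (auto simp: indicator_def)
    qed
  qed
  have "?\<Psi> \<in> spacetime_test T"
    by (rule separated_spacetime_test[OF P \<zeta>(1) _ T1(2), of "-2"]) (rule \<zeta>(3))
  with weak have "(\<integral>x. w\<^sub>1 x * ?\<Psi> (x, 0) \<partial>lebesgue) + (LINT t:?J|lebesgue. \<integral>x. F t x * ?\<Psi> (x, t) \<partial>lebesgue) =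
     (LINT t:?J|lebesgue. \<integral>x. - wt t x * deriv (\<lambda>s. ?\<Psi> (x, s)) t + Dw t x \<bullet> grad (\<lambda>y. ?\<Psi> (y, t)) x \<partial>lebesgue)"
    unfolding weak_wave_eq_def by (rule bspec)
  moreover have "(\<integral>x. w\<^sub>1 x * ?\<Psi> (x, 0) \<partial>lebesgue) = pairing w\<^sub>1 P * \<zeta> 0"
    by (simp flip: mult.assoc)
  moreover have "(LINT t:?J|lebesgue. \<integral>x. F t x * ?\<Psi> (x, t) \<partial>lebesgue) =
      (LINT s:{0..T1}|lebesgue. \<zeta> s * pairing (F s) P)"
  proof -
    have "(\<integral>x. F t x * ?\<Psi> (x, t) \<partial>lebesgue) = \<zeta> t * pairing (F t) P" for t
    proof -
      have "(\<lambda>x. F t x * ?\<Psi> (x, t)) = (\<lambda>x. \<zeta> t * (F t x * P x))" by (simp add: mult_ac)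
      then show ?thesis by simp
    qed
    then show ?thesis by (intro restrict) (simp_all add: \<zeta>(3))
  qed
  moreover have "(LINT t:?J|lebesgue. \<integral>x. - wt t x * deriv (\<lambda>s. ?\<Psi> (x, s)) t + Dw t x \<bullet> grad (\<lambda>y. ?\<Psi> (y, t)) x \<partial>lebesgue) =
      (LINT s:{0..T1}|lebesgue. - \<zeta>' s * pairing (wt s) P - \<nu>\<^sup>2 * \<zeta> s * pairing (w s) P)"
  proof -
    have d: "deriv (\<lambda>s. ?\<Psi> (x, s)) s = P x * \<zeta>' s" for x s
      using DERIV_imp_deriv[OF DERIV_cmult[OF \<zeta>(2)]] by simp
    have g: "grad (\<lambda>y. ?\<Psi> (y, s)) x = \<zeta> s *\<^sub>R grad P x" for x s
    proof -
      have "smooth P" using P by (simp add: Cc_infty_def)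
      from smooth_has_derivative(1)[OF this]
      have "((\<lambda>y. P y * \<zeta> s) has_derivative (\<lambda>b. frechet_derivative P (at x) b * \<zeta> s)) (at x)"
        by (rule has_derivative_mult_left)
      then have "frechet_derivative (\<lambda>y. P y * \<zeta> s) (at x) = (\<lambda>b. frechet_derivative P (at x) b * \<zeta> s)"
        by (rule frechet_derivative_at[symmetric])
      then show ?thesis by (simp add: grad_def scaleR_sum_right mult.commute)
    qed
    have val: "(\<integral>x. - wt s x * deriv (\<lambda>s. ?\<Psi> (x, s)) s + Dw s x \<bullet> grad (\<lambda>y. ?\<Psi> (y, s)) x \<partial>lebesgue) =
        - \<zeta>' s * pairing (wt s) P - \<zeta> s * (\<integral>x. w s x * laplacian P x \<partial>lebesgue)" if s: "s \<in> ?J" for s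
    proof -
      note wl = weak_gradient_laplacian[OF wL2(4)[OF s] wL2(1)[OF s] wL2(3)[OF s] P]
      have "(\<integral>x. - wt s x * deriv (\<lambda>s. ?\<Psi> (x, s)) s + Dw s x \<bullet> grad (\<lambda>y. ?\<Psi> (y, s)) x \<partial>lebesgue) =
          (\<integral>x. - \<zeta>' s * (wt s x * P x) + \<zeta> s * (Dw s x \<bullet> grad P x) \<partial>lebesgue)"
        unfolding d g by (simp add: mult_ac)
      also have "\<dots> = - \<zeta>' s * pairing (wt s) P + \<zeta> s * (\<integral>x. Dw s x \<bullet> grad P x \<partial>lebesgue)"
        using wl(1) L2_mult_integrable[OF wL2(2)[OF s] Cc_infty_L2[OF P]]
        by (subst Bochner_Integration.integral_add) auto
      finally show ?thesis unfolding wl(2) by simp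
    qed
    show ?thesis
    proof (rule restrict)
      fix s assume s: "s \<in> {0..T1}"
      show "(\<integral>x. - wt s x * deriv (\<lambda>s. ?\<Psi> (x, s)) s + Dw s x \<bullet> grad (\<lambda>y. ?\<Psi> (y, s)) x \<partial>lebesgue) =
         - \<zeta>' s * pairing (wt s) P - \<nu>\<^sup>2 * \<zeta> s * pairing (w s) P"
      proof (cases "s = T1")
        case True
        then show ?thesis using val[of s] s sub \<zeta>(3)[of s] by auto
      next
        case False
        have sJ: "s \<in> ?J" using s sub by auto
        have m: "w s \<in> borel_measurable lebesgue" "P \<in> borel_measurable lebesgue"
          using wL2(1)[OF sJ] Cc_infty_integrable[OF P] by (auto simp: L2_def)
        have "(\<integral>x. w s x * laplacian P x \<partial>lebesgue) = (\<integral>x. \<nu>\<^sup>2 * (w s x * P x) \<partial>lebesgue)"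
          using m laplacian_measurable[OF P] lap[of s] s False by (intro integral_cong_AE) auto
        then show ?thesis using val[OF sJ] by simp
      qed
    next
      fix s assume "s \<in> ?J" "s > T1"
      then show "(\<integral>x. - wt s x * deriv (\<lambda>s. ?\<Psi> (x, s)) s + Dw s x \<bullet> grad (\<lambda>y. ?\<Psi> (y, s)) x \<partial>lebesgue) = 0"
        using val[of s] \<zeta>'0[of s] \<zeta>(3)[of s] by simp
    qed
  qed
  ultimately show ?thesis by simp
qed

lemma set_integrable_continuous_mult:
  fixes f g :: "real \<Rightarrow> real"
  assumes "continuous_on {a..b} g" "set_integrable lebesgue {a..b} f"
  shows "set_integrable lebesgue {a..b} (\<lambda>s. g s * f s)"
proof (rule absolutely_integrable_bounded_measurable_product_real)
  show "g \<in> borel_measurable (lebesgue_on {a..b})"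
    by (rule continuous_imp_measurable_on_sets_lebesgue[OF assms(1)]) simp
  show "bounded (g ` {a..b})"
    by (intro compact_imp_bounded compact_continuous_image assms compact_Icc)
qed (use assms in auto)

text \<open>Testing \<open>\<beta>'' = \<nu>\<^sup>2 \<beta> + f\<close>, given in the weak sense with \<open>a = \<beta>'\<close>, against smooth approximations of
  \<open>cosh (\<nu> (t - s))\<close> cut off at \<open>s = t\<close> removes \<open>\<beta>\<close>, on whose sign nothing is known.\<close>

lemma weak_duhamel:
  fixes a \<beta> f :: "real \<Rightarrow> real"
  assumes t: "0 \<le> t" "t < T1" and a: "continuous_on {0..T1} a"
    and \<beta>: "\<And>s. s \<in> {0..T1} \<Longrightarrow> (\<beta> has_real_derivative a s) (at s within {0..T1})"
    and f: "set_integrable lebesgue {0..T1} f"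
    and weak: "\<And>\<zeta> \<zeta>'. smooth \<zeta> \<Longrightarrow> (\<And>s. (\<zeta> has_real_derivative \<zeta>' s) (at s)) \<Longrightarrow>
        (\<And>s. s < -2 \<or> s \<ge> T1 \<Longrightarrow> \<zeta> s = 0) \<Longrightarrow>
        A * \<zeta> 0 + (LINT s:{0..T1}|lebesgue. \<zeta> s * f s) =
        (LINT s:{0..T1}|lebesgue. - \<zeta>' s * a s - \<nu>\<^sup>2 * \<zeta> s * \<beta> s)"
  shows "a t = A * cosh (\<nu> * t) + \<nu> * sinh (\<nu> * t) * \<beta> 0 + (LINT s:{0..t}|lebesgue. cosh (\<nu> * (t - s)) * f s)"
proof -
  obtain S S' :: "real \<Rightarrow> real" where S: "smooth S" "\<And>x. (S has_real_derivative S' x) (at x)" "continuous_on UNIV S'"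
    "\<And>x. 0 \<le> S' x" "\<And>x. 0 \<le> S x" "\<And>x. S x \<le> 1" "\<And>x. x \<le> 0 \<Longrightarrow> S x = 0" "\<And>x. x \<le> 0 \<Longrightarrow> S' x = 0"
    "\<And>x. x \<ge> 1 \<Longrightarrow> S x = 1" "\<And>x. x \<ge> 1 \<Longrightarrow> S' x = 0"
    using smooth_step_exists by blast
  have cS: "continuous_on UNIV S" by (rule smooth_has_derivative(3)[OF S(1)])
  \<comment> \<open>The dual solution: c'' = \<nu>^2 c with c(t) = 1 and c'(t) = 0.\<close>
  define c c' where "c = (\<lambda>s. cosh (\<nu> * (t - s)))" and "c' = (\<lambda>s. - (\<nu> * sinh (\<nu> * (t - s))))"
  have dc: "(c has_real_derivative c' s) (at s within X)" for s X
    unfolding c_def c'_def by (auto intro!: derivative_eq_intros)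
  have dc': "(c' has_real_derivative \<nu>\<^sup>2 * c s) (at s within X)" for s X
    unfolding c_def c'_def by (auto intro!: derivative_eq_intros simp: power2_eq_square)
  have smc: "smooth c"
  proof -
    have "smooth (\<lambda>s::real. \<nu> * t + (- \<nu>) * s)"
      by (intro smooth_add smooth_mult smooth_const smooth_bounded_linear bounded_linear_ident)
    then have "smooth (\<lambda>s. cosh (\<nu> * t + (- \<nu>) * s))" by (rule smooth_compose[OF smooth_cosh])
    then show ?thesis by (simp add: c_def algebra_simps)
  qed
  have cc: "continuous_on X c" "continuous_on X c'" for X
    using dc dc' by (auto intro!: DERIV_continuous_on)
  have c\<beta>: "continuous_on {0..T1} \<beta>" by (rule DERIV_continuous_on[OF \<beta>])
  \<comment> \<open>Widths of the cutoff layer to the right of \<open>t\<close>. They shrink to 0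
    and never exceed \<open>T1 - t\<close>, so the test function vanishes from \<open>T1\<close>
    on.\<close>
  define h where "h = (\<lambda>n::nat. (T1 - t) / real (Suc n))"
  have h: "h n > 0" "h n \<le> T1 - t" for n
    using t divide_left_mono[of 1 "real (Suc n)" "T1 - t"] by (simp_all add: h_def)
  have h0: "h \<longlonglongrightarrow> 0" unfolding h_def by (rule LIMSEQ_Suc[OF lim_const_over_n])
  define arg where "arg = (\<lambda>n s. (t + h n) / h n + (- (1 / h n)) * s)"
  have arg: "arg n s = (t + h n - s) / h n" for n s
    using h(1)[of n] by (simp add: arg_def diff_divide_distrib add_divide_distrib)
  have arg1: "arg n s \<ge> 1" if "s \<le> t" for n s using h(1)[of n] that unfolding arg by simp
  have arg0: "arg n s \<le> 0" if "s \<ge> t + h n" for n s using h(1)[of n] that unfolding arg by (simp add: divide_nonpos_pos)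
  have darg: "(arg n has_real_derivative (- (1 / h n))) (at s within X)" for n s X
    unfolding arg_def using less_imp_neq[OF h(1)[of n]] by (auto intro!: derivative_eq_intros)
  define \<eta> where "\<eta> = (\<lambda>n s. S (arg n s))"
  define \<delta> where "\<delta> = (\<lambda>n s. S' (arg n s) * (1 / h n))"
  have d\<eta>: "(\<eta> n has_real_derivative (- \<delta> n s)) (at s)" for n s
    using DERIV_chain2[OF S(2) darg[of n s UNIV]] unfolding \<eta>_def \<delta>_def by simp
  have carg: "continuous_on X (arg n)" for n X using darg by (auto intro!: DERIV_continuous_on)
  have c\<eta>: "continuous_on X (\<eta> n)" for n X
    unfolding \<eta>_def by (rule continuous_on_compose2[OF cS carg]) simp
  have c\<delta>: "continuous_on X (\<delta> n)" for n X
    unfolding \<delta>_def by (intro continuous_intros continuous_on_compose2[OF S(3) carg]) simp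
  have sm\<eta>: "smooth (\<eta> n)" for n unfolding \<eta>_def arg_def
    by (intro smooth_compose[OF S(1)] smooth_add smooth_mult smooth_const smooth_bounded_linear bounded_linear_ident)
  \<comment> \<open>All terms with the undifferentiated \<beta> sit here; \<open>K\<close> is the
    derivative of the product of \<open>c'\<close> and \<beta>, which is why they disappear up to
    boundary values.\<close>
  define K where "K = (\<lambda>s. c' s * a s + \<nu>\<^sup>2 * (c s * \<beta> s))"
  define G where "G = (\<lambda>s. c s * f s + K s)"
  have cK: "continuous_on {0..T1} K" unfolding K_def by (intro continuous_intros cc a c\<beta>)
  have iK: "set_integrable lebesgue {0..T1} K" by (rule absolutely_integrable_continuous_real[OF cK])
  have icf: "set_integrable lebesgue {0..T1} (\<lambda>s. c s * f s)" by (rule set_integrable_continuous_mult[OF cc(1) f])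
  have iG: "set_integrable lebesgue {0..T1} G" unfolding G_def by (rule set_integral_add(1)[OF icf iK])
  have identity: "A * cosh (\<nu> * t) + (LINT s:{0..T1}|lebesgue. \<eta> n s * G s) = (LINT s:{0..T1}|lebesgue. \<delta> n s * (c s * a s))" for n
  proof -
    \<comment> \<open>A cutoff that is 1 from time -1 on and 0 before -2: it makes the test function
      compactly supported and is invisible for nonnegative times.\<close>
    define \<sigma> where "\<sigma> = (\<lambda>s. S (s + 2))"
    have d\<sigma>: "(\<sigma> has_real_derivative S' (s + 2)) (at s)" for s
    proof -
      have "((\<lambda>s. s + 2) has_real_derivative 1) (at s)" by (auto intro!: derivative_eq_intros)
      from DERIV_chain2[OF S(2) this] show ?thesis by (simp add: \<sigma>_def)
    qed
    have sm\<sigma>: "smooth \<sigma>"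
      unfolding \<sigma>_def
      by (intro smooth_compose[OF S(1)] smooth_add smooth_const smooth_bounded_linear bounded_linear_ident)
    define \<zeta> where "\<zeta> = (\<lambda>s. \<sigma> s * (\<eta> n s * c s))"
    define \<zeta>' where "\<zeta>' = (\<lambda>s. S' (s + 2) * (\<eta> n s * c s) + (- \<delta> n s * c s + c' s * \<eta> n s) * \<sigma> s)"
    have inside: "\<zeta> s = \<eta> n s * c s" "\<zeta>' s = - \<delta> n s * c s + c' s * \<eta> n s" if "s \<ge> 0" for s
      using that S(9)[of "s + 2"] S(10)[of "s + 2"] by (simp_all add: \<zeta>_def \<zeta>'_def \<sigma>_def)
    have "A * \<zeta> 0 + (LINT s:{0..T1}|lebesgue. \<zeta> s * f s) = (LINT s:{0..T1}|lebesgue. - \<zeta>' s * a s - \<nu>\<^sup>2 * \<zeta> s * \<beta> s)"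
    proof (rule weak)
      show "smooth \<zeta>" unfolding \<zeta>_def by (intro smooth_mult sm\<sigma> sm\<eta> smc)
      show "(\<zeta> has_real_derivative \<zeta>' s) (at s)" for s
        unfolding \<zeta>_def \<zeta>'_def by (intro DERIV_mult d\<sigma> d\<eta> dc)
      show "\<zeta> s = 0" if "s < -2 \<or> s \<ge> T1" for s
        using that S(7)[of "s + 2"] S(7)[OF arg0, of n s] h(2)[of n] by (auto simp: \<zeta>_def \<sigma>_def \<eta>_def)
    qed
    moreover have "\<zeta> 0 = cosh (\<nu> * t)" using inside(1)[of 0] S(9)[OF arg1, of 0 n] t by (simp add: \<eta>_def c_def)
    moreover have "(LINT s:{0..T1}|lebesgue. \<zeta> s * f s) = (LINT s:{0..T1}|lebesgue. \<eta> n s * (c s * f s))"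
      by (intro set_lebesgue_integral_cong) (auto simp: inside)
    moreover have "(LINT s:{0..T1}|lebesgue. - \<zeta>' s * a s - \<nu>\<^sup>2 * \<zeta> s * \<beta> s) =
        (LINT s:{0..T1}|lebesgue. \<delta> n s * (c s * a s) - \<eta> n s * K s)"
      by (intro set_lebesgue_integral_cong) (auto simp: inside K_def algebra_simps)
    moreover have "\<dots> = (LINT s:{0..T1}|lebesgue. \<delta> n s * (c s * a s)) - (LINT s:{0..T1}|lebesgue. \<eta> n s * K s)"
      by (intro set_integral_diff set_integrable_continuous_mult c\<delta> c\<eta> cc absolutely_integrable_continuous_real[OF a] iK)
    moreover have "(LINT s:{0..T1}|lebesgue. \<eta> n s * G s) =
        (LINT s:{0..T1}|lebesgue. \<eta> n s * (c s * f s)) + (LINT s:{0..T1}|lebesgue. \<eta> n s * K s)"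
      unfolding G_def distrib_left by (intro set_integral_add set_integrable_continuous_mult c\<eta> cc f iK)
    ultimately show ?thesis by simp
  qed
  have lim1: "(\<lambda>n. LINT s:{0..T1}|lebesgue. \<eta> n s * G s) \<longlonglongrightarrow> (LINT s:{0..t}|lebesgue. G s)"
    unfolding set_lebesgue_integral_def
  proof (rule integral_dominated_convergence[where w="\<lambda>s. norm (indicator {0..T1} s *\<^sub>R G s)"])
    have Gt: "set_integrable lebesgue {0..t} G" by (rule set_integrable_subset[OF iG]) (use t in auto)
    then show "(\<lambda>s. indicator {0..t} s *\<^sub>R G s) \<in> borel_measurable lebesgue"
      by (auto simp: set_integrable_def)
    show "(\<lambda>s. indicator {0..T1} s *\<^sub>R (\<eta> n s * G s)) \<in> borel_measurable lebesgue" for n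
      using set_integrable_continuous_mult[OF c\<eta> iG] by (auto simp: set_integrable_def)
    show "integrable lebesgue (\<lambda>s. norm (indicator {0..T1} s *\<^sub>R G s))"
      using iG by (simp add: set_integrable_def integrable_norm)
    show "AE s in lebesgue. norm (indicator {0..T1} s *\<^sub>R (\<eta> n s * G s)) \<le> norm (indicator {0..T1} s *\<^sub>R G s)" for n
      using S(5,6) by (intro AE_I2) (auto simp: indicator_def \<eta>_def abs_mult mult_left_le_one_le)
    show "AE s in lebesgue. (\<lambda>n. indicator {0..T1} s *\<^sub>R (\<eta> n s * G s)) \<longlonglongrightarrow> indicator {0..t} s *\<^sub>R G s"
    proof (rule AE_I2)
      fix s
      consider "s < 0 \<or> s > T1" | "0 \<le> s" "s \<le> t" | "t < s" "s \<le> T1" by linarith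
      then show "(\<lambda>n. indicator {0..T1} s *\<^sub>R (\<eta> n s * G s)) \<longlonglongrightarrow> indicator {0..t} s *\<^sub>R G s"
      proof cases
        case 1
        then show ?thesis using t by (auto simp: indicator_def)
      next
        case 2
        then have "\<eta> n s = 1" for n unfolding \<eta>_def by (intro S(9) arg1)
        then show ?thesis using 2 t by (simp add: indicator_def)
      next
        case 3
        have "eventually (\<lambda>n. h n < s - t) sequentially" using order_tendstoD(2)[OF h0, of "s - t"] 3 by simp
        then have "eventually (\<lambda>n. indicator {0..T1} s *\<^sub>R (\<eta> n s * G s) = 0) sequentially"
        proof eventually_elim
          case (elim n)
          then have "\<eta> n s = 0" unfolding \<eta>_def by (intro S(7) arg0) simp
          then show ?case by simp
        qed
        then show ?thesis using 3 by (simp add: indicator_def tendsto_eventually)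
      qed
    qed
  qed
  define \<psi> where "\<psi> = (\<lambda>s. c s * a s)"
  have c\<psi>: "continuous_on {0..T1} \<psi>" unfolding \<psi>_def by (intro continuous_intros cc a)
  have \<psi>t: "\<psi> t = a t" by (simp add: \<psi>_def c_def)
  have i\<delta>: "set_integrable lebesgue {0..T1} (\<delta> n)" for n by (rule absolutely_integrable_continuous_real[OF c\<delta>])
  have mass: "(LINT s:{0..T1}|lebesgue. \<delta> n s) = 1" for n
  proof -
    have "((\<lambda>s. \<delta> n s) has_integral (- \<eta> n T1 - (- \<eta> n 0))) {0..T1}"
    proof (rule fundamental_theorem_of_calculus)
      show "((\<lambda>s. - \<eta> n s) has_vector_derivative \<delta> n s) (at s within {0..T1})" for s
        using DERIV_minus[OF d\<eta>[of n s]] by (auto simp: has_real_derivative_iff_has_vector_derivative intro: has_vector_derivative_at_within)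
    qed (use t in simp)
    moreover have "\<eta> n T1 = 0" unfolding \<eta>_def by (intro S(7) arg0) (use h(2)[of n] in simp)
    moreover have "\<eta> n 0 = 1" unfolding \<eta>_def by (intro S(9) arg1 t)
    ultimately show ?thesis
      using set_lebesgue_integral_eq_integral(2)[OF i\<delta>[of n]] by (simp add: integral_unique)
  qed
  \<comment> \<open>\<open>\<delta> n\<close> is nonnegative with integral 1 and concentrates on the
    layer between \<open>t\<close> and \<open>t + h n\<close>, so the integrals converge to the
    value at \<open>t\<close>.\<close>
  have lim2: "(\<lambda>n. LINT s:{0..T1}|lebesgue. \<delta> n s * \<psi> s) \<longlonglongrightarrow> a t"
  proof (rule LIMSEQ_I)
    fix e :: real assume e: "e > 0"
    have "t \<in> {0..T1}" using t by simp
    then obtain d where d: "d > 0" "\<And>s. s \<in> {0..T1} \<Longrightarrow> dist s t < d \<Longrightarrow> dist (\<psi> s) (\<psi> t) < e / 2"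
      using c\<psi> e unfolding continuous_on_iff by (meson half_gt_zero)
    have "eventually (\<lambda>n. h n < d) sequentially" using order_tendstoD(2)[OF h0 d(1)] .
    then obtain N where N: "\<And>n. n \<ge> N \<Longrightarrow> h n < d" by (auto simp: eventually_sequentially)
    have "norm ((LINT s:{0..T1}|lebesgue. \<delta> n s * \<psi> s) - a t) < e" if "n \<ge> N" for n
    proof -
      have i1: "set_integrable lebesgue {0..T1} (\<lambda>s. \<delta> n s * \<psi> s)"
        by (intro set_integrable_continuous_mult c\<delta> absolutely_integrable_continuous_real c\<psi>)
      have small: "\<bar>\<delta> n s * (\<psi> s - a t)\<bar> \<le> \<delta> n s * (e / 2)" if s: "s \<in> {0..T1}" for s
      proof (cases "t < s \<and> s < t + h n")
        case True
        then have "\<bar>\<psi> s - a t\<bar> \<le> e / 2" using d(2)[OF s] N[OF \<open>n \<ge> N\<close>] \<psi>t by (auto simp: dist_real_def)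
        moreover have \<delta>0: "\<delta> n s \<ge> 0" using S(4) h(1)[of n] by (simp add: \<delta>_def)
        ultimately have "\<delta> n s * \<bar>\<psi> s - a t\<bar> \<le> \<delta> n s * (e / 2)" by (rule mult_left_mono)
        then show ?thesis using \<delta>0 by (simp add: abs_mult)
      next
        case False
        then have "\<delta> n s = 0" unfolding \<delta>_def using S(8)[OF arg0, of n s] S(10)[OF arg1, of s n] by force
        then show ?thesis by simp
      qed
      have "(LINT s:{0..T1}|lebesgue. \<delta> n s * \<psi> s) - a t = (LINT s:{0..T1}|lebesgue. \<delta> n s * \<psi> s) - (LINT s:{0..T1}|lebesgue. \<delta> n s * a t)"
        using mass[of n] by simp
      also have "\<dots> = (LINT s:{0..T1}|lebesgue. \<delta> n s * (\<psi> s - a t))"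
        using i1 i\<delta>[of n] by (subst set_integral_diff(2)[symmetric]) (auto simp: algebra_simps)
      finally have "norm ((LINT s:{0..T1}|lebesgue. \<delta> n s * \<psi> s) - a t) = \<bar>LINT s:{0..T1}|lebesgue. \<delta> n s * (\<psi> s - a t)\<bar>" by simp
      also have "\<dots> \<le> (LINT s:{0..T1}|lebesgue. \<bar>\<delta> n s * (\<psi> s - a t)\<bar>)"
        unfolding set_lebesgue_integral_def using integral_abs_bound[of lebesgue "\<lambda>s. indicator {0..T1} s *\<^sub>R (\<delta> n s * (\<psi> s - a t))"]
        by (simp add: abs_mult)
      also have "\<dots> \<le> (LINT s:{0..T1}|lebesgue. \<delta> n s * (e / 2))"
      proof (rule set_integral_mono)
        have "continuous_on {0..T1} (\<lambda>s. \<bar>\<delta> n s * (\<psi> s - a t)\<bar>)" by (intro continuous_intros c\<delta> c\<psi>)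
        then show "set_integrable lebesgue {0..T1} (\<lambda>s. \<bar>\<delta> n s * (\<psi> s - a t)\<bar>)" by (rule absolutely_integrable_continuous_real)
        show "set_integrable lebesgue {0..T1} (\<lambda>s. \<delta> n s * (e / 2))" using i\<delta>[of n] by simp
      qed (rule small)
      also have "\<dots> = e / 2" using mass[of n] by simp
      finally show ?thesis using e by simp
    qed
    then show "\<exists>no. \<forall>n\<ge>no. norm ((LINT s:{0..T1}|lebesgue. \<delta> n s * \<psi> s) - a t) < e" by blast
  qed
  have "(\<lambda>n. A * cosh (\<nu> * t) + (LINT s:{0..T1}|lebesgue. \<eta> n s * G s)) \<longlonglongrightarrow> A * cosh (\<nu> * t) + (LINT s:{0..t}|lebesgue. G s)"
    by (intro tendsto_intros lim1)
  then have "a t = A * cosh (\<nu> * t) + (LINT s:{0..t}|lebesgue. G s)"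
    using LIMSEQ_unique[OF lim2] unfolding identity \<psi>_def by blast
  moreover have "(LINT s:{0..t}|lebesgue. G s) = (LINT s:{0..t}|lebesgue. c s * f s) + (LINT s:{0..t}|lebesgue. K s)"
  proof -
    have sub: "{0..t} \<subseteq> {0..T1}" using t by auto
    show ?thesis unfolding G_def
      by (rule set_integral_add(2)) (rule set_integrable_subset[OF icf _ sub] set_integrable_subset[OF iK _ sub], simp)+
  qed
  \<comment> \<open>The upper boundary term is absent since c'(t) = 0, so only the initial value of
    \<beta> survives.\<close>
  moreover have "(LINT s:{0..t}|lebesgue. K s) = \<nu> * sinh (\<nu> * t) * \<beta> 0"
  proof -
    have "(K has_integral (c' t * \<beta> t - c' 0 * \<beta> 0)) {0..t}"
    proof (rule fundamental_theorem_of_calculus[OF t(1)])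
      fix s assume s: "s \<in> {0..t}"
      have "(\<beta> has_real_derivative a s) (at s within {0..t})"
        by (rule DERIV_subset[OF \<beta>]) (use s t in auto)
      from DERIV_mult[OF dc' this]
      have "((\<lambda>s. c' s * \<beta> s) has_real_derivative K s) (at s within {0..t})"
        by (simp add: K_def mult_ac add.commute)
      then show "((\<lambda>s. c' s * \<beta> s) has_vector_derivative K s) (at s within {0..t})"
        by (simp add: has_real_derivative_iff_has_vector_derivative)
    qed
    moreover have "set_integrable lebesgue {0..t} K" by (rule set_integrable_subset[OF iK]) (use t in auto)
    ultimately show ?thesis
      using set_lebesgue_integral_eq_integral(2)[of "{0..t}" K] by (simp add: integral_unique c'_def)
  qed
  ultimately show ?thesis by (simp add: c_def)
qed

text \<open>Since \<open>cosh x \<ge> exp x / 2\<close>, the factor \<open>exp (- \<nu> * t)\<close>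
  turns the kernel into one depending on \<open>s\<close> alone. The initial position has no sign;
  \<open>\<bar>sinh x\<bar> \<le> cosh x\<close> lets it be subtracted from \<open>A\<close> in the
  worst case, and \<open>c0\<close> bounds from below what is left.\<close>

lemma duhamel_lower_bound:
  fixes f :: "real \<Rightarrow> real"
  assumes a: "a = A * cosh (\<nu> * t) + \<nu> * sinh (\<nu> * t) * \<beta>0 + (LINT s:{0..t}|lebesgue. cosh (\<nu> * (t - s)) * f s)"
    and t: "0 \<le> t" and \<nu>: "\<nu> \<ge> 0" and c0: "0 \<le> c0" "c0 \<le> A - \<nu> * \<bar>\<beta>0\<bar>"
    and f: "set_integrable lebesgue {0..t} f" "\<And>s. f s \<ge> 0"
  shows "exp (- \<nu> * t) * a \<ge> 1 / 2 * (c0 + (LINT s:{0..t}|lebesgue. exp (- \<nu> * s) * f s))"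
proof -
  have cosh_ge: "cosh x \<ge> exp x / 2" for x :: real by (simp add: cosh_def)
  have sc: "\<bar>sinh x\<bar> \<le> cosh x" for x :: real
    unfolding sinh_def cosh_def abs_le_iff using exp_gt_zero[of x] exp_gt_zero[of "- x"] by (simp add: field_simps)
  have "c0 * (exp (\<nu> * t) / 2) \<le> c0 * cosh (\<nu> * t)" using cosh_ge c0 by (intro mult_left_mono) auto
  also have "\<dots> \<le> (A - \<nu> * \<bar>\<beta>0\<bar>) * cosh (\<nu> * t)" using c0 by (intro mult_right_mono) auto
  also have "\<dots> = A * cosh (\<nu> * t) - \<nu> * (\<bar>\<beta>0\<bar> * cosh (\<nu> * t))" by (simp add: algebra_simps)
  also have "\<nu> * (\<bar>\<beta>0\<bar> * cosh (\<nu> * t)) \<ge> \<nu> * \<bar>sinh (\<nu> * t) * \<beta>0\<bar>"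
    using sc[of "\<nu> * t"] \<nu> by (intro mult_left_mono) (auto simp: abs_mult mult.commute mult_left_mono)
  then have "A * cosh (\<nu> * t) - \<nu> * (\<bar>\<beta>0\<bar> * cosh (\<nu> * t)) \<le> A * cosh (\<nu> * t) + \<nu> * sinh (\<nu> * t) * \<beta>0"
  proof -
    have "- (\<nu> * sinh (\<nu> * t) * \<beta>0) \<le> \<bar>\<nu> * (sinh (\<nu> * t) * \<beta>0)\<bar>" by (simp add: mult.assoc)
    also have "\<dots> = \<nu> * \<bar>sinh (\<nu> * t) * \<beta>0\<bar>" using \<nu> by (simp add: abs_mult)
    finally show ?thesis using \<open>\<nu> * (\<bar>\<beta>0\<bar> * cosh (\<nu> * t)) \<ge> \<nu> * \<bar>sinh (\<nu> * t) * \<beta>0\<bar>\<close> by linarith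
  qed
  finally have 1: "c0 * (exp (\<nu> * t) / 2) \<le> A * cosh (\<nu> * t) + \<nu> * sinh (\<nu> * t) * \<beta>0" .
  have "(LINT s:{0..t}|lebesgue. (exp (\<nu> * t) / 2) * (exp (- \<nu> * s) * f s)) \<le> (LINT s:{0..t}|lebesgue. cosh (\<nu> * (t - s)) * f s)"
  proof (rule set_integral_mono)
    show "set_integrable lebesgue {0..t} (\<lambda>s. (exp (\<nu> * t) / 2) * (exp (- \<nu> * s) * f s))"
      by (intro set_integrable_mult_right set_integrable_continuous_mult continuous_intros f)
    show "set_integrable lebesgue {0..t} (\<lambda>s. cosh (\<nu> * (t - s)) * f s)"
      by (intro set_integrable_continuous_mult continuous_intros f)
    fix s
    have "exp (\<nu> * t) / 2 * exp (- \<nu> * s) \<le> cosh (\<nu> * (t - s))"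
      using cosh_ge[of "\<nu> * (t - s)"] by (simp add: exp_add[symmetric] right_diff_distrib)
    then have "exp (\<nu> * t) / 2 * exp (- \<nu> * s) * f s \<le> cosh (\<nu> * (t - s)) * f s"
      by (rule mult_right_mono[OF _ f(2)])
    then show "(exp (\<nu> * t) / 2) * (exp (- \<nu> * s) * f s) \<le> cosh (\<nu> * (t - s)) * f s"
      by (simp only: mult.assoc)
  qed
  then have "(exp (\<nu> * t) / 2) * (c0 + (LINT s:{0..t}|lebesgue. exp (- \<nu> * s) * f s)) \<le> a"
    using 1 a unfolding set_integral_mult_right distrib_left by (simp add: mult.commute)
  then have "exp (- \<nu> * t) * ((exp (\<nu> * t) / 2) * (c0 + (LINT s:{0..t}|lebesgue. exp (- \<nu> * s) * f s))) \<le> exp (- \<nu> * t) * a"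
    by (rule mult_left_mono) simp
  then show ?thesis by (simp add: mult.assoc[symmetric] exp_add[symmetric])
qed

section \<open>Jensen's inequality for the nonlinear source\<close>

text \<open>The right-hand side is the tangent at \<open>M\<close> of the convex function |y|^p,
  obtained here from Young's inequality with conjugate exponent p/(p-1).\<close>

lemma powr_tangent_bound:
  fixes y M p :: real
  assumes "p > 1" "M > 0"
  shows "\<bar>y\<bar> powr p \<ge> p * M powr (p - 1) * y - (p - 1) * M powr p"
proof -
  let ?q = "p / (p - 1)"
  have "\<bar>y\<bar> * M powr (p - 1) \<le> \<bar>y\<bar> powr p / p + (M powr (p - 1)) powr ?q / ?q"
    using assms by (intro Youngs_inequality) (auto simp: field_simps)
  also have "(M powr (p - 1)) powr ?q = M powr p" using assms by (simp add: powr_powr)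
  finally have "p * (\<bar>y\<bar> * M powr (p - 1)) \<le> p * (\<bar>y\<bar> powr p / p + M powr p / ?q)"
    using assms by (intro mult_left_mono) auto
  also have "\<dots> = \<bar>y\<bar> powr p + (p - 1) * M powr p" using assms by (simp add: field_simps)
  finally have "p * M powr (p - 1) * \<bar>y\<bar> \<le> \<bar>y\<bar> powr p + (p - 1) * M powr p" by (simp add: mult_ac)
  moreover have "p * M powr (p - 1) * y \<le> p * M powr (p - 1) * \<bar>y\<bar>" using assms by (intro mult_left_mono) auto
  ultimately show ?thesis by linarith
qed

text \<open>Jensen's inequality, proved by integrating the tangent bound at the mean value. The mass
  of the weight enters with a negative coefficient, so an upper bound \<open>W\<close> is enough.
  Outside the ball both sides vanish because \<open>v\<close> does and
  \<open>G 0 = 0\<close>.\<close>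

lemma nonlinear_pairing_lower_bound:
  fixes v \<phi> :: "'a::euclidean_space \<Rightarrow> real"
  assumes p: "p > 1" and \<kappa>: "\<kappa> > 0" and G: "\<And>\<sigma>. G \<sigma> \<ge> \<kappa> * \<bar>\<sigma>\<bar> powr p" "G 0 = 0"
    and iG: "integrable lebesgue (\<lambda>x. G (v x))" and v: "v \<in> L2"
    and zero: "AE x in lebesgue. norm x > \<rho> \<longrightarrow> v x = 0"
    and P: "P \<in> Cc_infty" "\<And>x. P x \<ge> 0" "\<And>x. norm x \<le> \<rho> \<Longrightarrow> P x = \<phi> x"
    and W: "W > 0" "(LINT x:cball 0 \<rho>|lebesgue. \<phi> x) \<le> W"
    and A: "pairing v P > 0"
  shows "(\<integral>x. G (v x) * P x \<partial>lebesgue) \<ge> \<kappa> * W powr (1 - p) * pairing v P powr p"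
proof -
  define A where "A = pairing v P"
  have A0: "A > 0" using A by (simp add: A_def)
  \<comment> \<open>The mean of \<open>v\<close> with respect to a weight of mass \<open>W\<close>;
    it makes the two tangent terms proportional.\<close>
  define M where "M = A / W"
  have M: "M > 0" using A0 W by (simp add: M_def)
  define w0 where "w0 = (LINT x:cball 0 \<rho>|lebesgue. P x)"
  have w0: "w0 \<le> W"
  proof -
    have "w0 = (LINT x:cball 0 \<rho>|lebesgue. \<phi> x)" unfolding w0_def
      by (intro set_lebesgue_integral_cong) (auto simp: P(3))
    then show ?thesis using W by simp
  qed
  have i1: "integrable lebesgue (\<lambda>x. v x * P x)" by (rule L2_mult_integrable[OF v Cc_infty_L2[OF P(1)]])
  have i2: "integrable lebesgue (\<lambda>x. indicator (cball 0 \<rho>) x * P x)"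
    using integrable_mult_indicator[OF _ Cc_infty_integrable[OF P(1)], of "cball 0 \<rho>"] by simp
  have "\<kappa> * (p * M powr (p - 1) * A - (p - 1) * M powr p * w0) =
      (\<integral>x. \<kappa> * (p * M powr (p - 1) * (v x * P x) - (p - 1) * M powr p * (indicator (cball 0 \<rho>) x * P x)) \<partial>lebesgue)"
    using i1 i2 by (simp add: A_def w0_def set_lebesgue_integral_def)
  also have "\<dots> \<le> (\<integral>x. G (v x) * P x \<partial>lebesgue)"
  proof (rule integral_mono_AE)
    show "integrable lebesgue (\<lambda>x. \<kappa> * (p * M powr (p - 1) * (v x * P x) - (p - 1) * M powr p * (indicator (cball 0 \<rho>) x * P x)))"
      using i1 i2 by simp
    show "integrable lebesgue (\<lambda>x. G (v x) * P x)" by (rule Cc_infty_mult_integrable[OF iG P(1)])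
    show "AE x in lebesgue. \<kappa> * (p * M powr (p - 1) * (v x * P x) - (p - 1) * M powr p * (indicator (cball 0 \<rho>) x * P x)) \<le> G (v x) * P x"
      using zero
    proof eventually_elim
      case (elim x)
      show ?case
      proof (cases "norm x \<le> \<rho>")
        case True
        have "\<kappa> * (p * M powr (p - 1) * v x - (p - 1) * M powr p) \<le> \<kappa> * \<bar>v x\<bar> powr p"
          using powr_tangent_bound[OF p M, of "v x"] \<kappa> by (intro mult_left_mono) auto
        also have "\<dots> \<le> G (v x)" by (rule G(1))
        finally have "\<kappa> * (p * M powr (p - 1) * v x - (p - 1) * M powr p) * P x \<le> G (v x) * P x"
          by (rule mult_right_mono[OF _ P(2)])
        then show ?thesis using True by (simp add: algebra_simps)
      next
        case False
        then show ?thesis using elim G(2) by simp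
      qed
    qed
  qed
  finally have 1: "\<kappa> * (p * M powr (p - 1) * A - (p - 1) * M powr p * w0) \<le> (\<integral>x. G (v x) * P x \<partial>lebesgue)" .
  have "(p - 1) * M powr p * w0 \<le> (p - 1) * M powr p * W" using p w0 by (intro mult_left_mono) auto
  then have "\<kappa> * (p * M powr (p - 1) * A - (p - 1) * M powr p * W) \<le> \<kappa> * (p * M powr (p - 1) * A - (p - 1) * M powr p * w0)"
    using \<kappa> by (intro mult_left_mono) auto
  moreover have "p * M powr (p - 1) * A - (p - 1) * M powr p * W = W powr (1 - p) * A powr p"
  proof -
    have 2: "M powr (p - 1) * A = W powr (1 - p) * A powr p"
    proof -
      have "M powr (p - 1) = A powr (p - 1) * W powr (1 - p)"
        using A0 W unfolding M_def by (simp add: powr_divide) (simp add: powr_diff field_simps)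
      moreover have "A powr p = A * A powr (p - 1)" using A0 by (simp add: powr_mult_base)
      ultimately show ?thesis by simp
    qed
    have 3: "M powr p * W = M powr (p - 1) * A"
    proof -
      have "M powr p = M * M powr (p - 1)" using M by (simp add: powr_mult_base)
      moreover have "M * W = A" using W by (simp add: M_def)
      ultimately show ?thesis by (metis mult.assoc mult.commute)
    qed
    have "p * M powr (p - 1) * A - (p - 1) * M powr p * W = p * (M powr (p - 1) * A) - (p - 1) * (M powr p * W)"
      by (simp add: mult_ac)
    then show ?thesis unfolding 3 2 by (simp add: algebra_simps)
  qed
  ultimately show ?thesis using 1 unfolding A_def by (simp add: mult.assoc)
qed

section \<open>Lifespan of weak solutions\<close>

text \<open>The time cutoff behind Duhamel's formula extends past \<open>t\<close>, hence
  \<open>T1\<close> is strictly later. Up to \<open>T1\<close> the solution stays inside the open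
  ball on which \<open>P\<close> is an eigenfunction.\<close>

lemma wave_component_lower_bound:
  fixes w wt F :: "real \<Rightarrow> 'a::euclidean_space \<Rightarrow> real"
  assumes weak: "weak_wave_eq T wt Dw F w\<^sub>1" and H1: "continuous_H1 (time_interval T) w Dw"
    and C1: "C1_L2 (time_interval T) w wt" and P: "P \<in> Cc_infty" "\<And>x. P x \<ge> 0"
    and lap: "\<And>x. norm x < r + T1 + 1 \<Longrightarrow> laplacian P x = \<nu>\<^sup>2 * P x"
    and t: "0 \<le> t" "t < T1" "ereal T1 < T" and \<nu>: "\<nu> \<ge> 0"
    and zero: "\<And>s. s \<in> time_interval T \<Longrightarrow> AE x in lebesgue. norm x > r + s \<longrightarrow> w s x = 0"
    and F: "Bochner_L1_L1 (time_interval T) F" "\<And>s x. F s x \<ge> 0"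
    and c0: "0 \<le> c0" "c0 \<le> pairing w\<^sub>1 P - \<nu> * \<bar>pairing (w 0) P\<bar>"
  shows "exp (- \<nu> * t) * pairing (wt t) P \<ge>
    1 / 2 * (c0 + (LINT s:{0..t}|lebesgue. exp (- \<nu> * s) * pairing (F s) P))"
proof -
  let ?J = "time_interval T"
  let ?f = "\<lambda>s. pairing (F s) P"
  have sub: "{0..T1} \<subseteq> ?J" using t by (auto simp: time_interval_def intro: le_less_trans[of "ereal _" "ereal T1"])
  have PL2: "P \<in> L2" by (rule Cc_infty_L2[OF P(1)])
  have f: "set_integrable lebesgue {0..T1} ?f"
    by (rule set_integrable_subset[OF Bochner_L1_L1_pairing[OF F(1) time_interval_lebesgue P(1)] _ sub]) simp
  have "pairing (wt t) P = pairing w\<^sub>1 P * cosh (\<nu> * t) +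
      \<nu> * sinh (\<nu> * t) * pairing (w 0) P + (LINT s:{0..t}|lebesgue. cosh (\<nu> * (t - s)) * ?f s)"
  proof (rule weak_duhamel[OF t(1,2) _ _ f, where \<beta>="\<lambda>s. pairing (w s) P"])
    show "continuous_on {0..T1} (\<lambda>s. pairing (wt s) P)"
      using C1 by (intro continuous_on_subset[OF continuous_L2_pairing[OF _ PL2] sub]) (simp add: C1_L2_def)
    show "((\<lambda>s. pairing (w s) P) has_real_derivative (pairing (wt s) P)) (at s within {0..T1})"
      if "s \<in> {0..T1}" for s
      by (rule DERIV_subset[OF C1_L2_pairing[OF C1 PL2] sub]) (use sub that in auto)
  next
    fix \<zeta> \<zeta>' :: "real \<Rightarrow> real"
    assume \<zeta>: "smooth \<zeta>" "\<And>s. (\<zeta> has_real_derivative \<zeta>' s) (at s)" "\<And>s. s < -2 \<or> s \<ge> T1 \<Longrightarrow> \<zeta> s = 0"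
    show "pairing w\<^sub>1 P * \<zeta> 0 + (LINT s:{0..T1}|lebesgue. \<zeta> s * ?f s) =
        (LINT s:{0..T1}|lebesgue. - \<zeta>' s * pairing (wt s) P - \<nu>\<^sup>2 * \<zeta> s * pairing (w s) P)"
    proof (rule weak_wave_eq_separated[OF weak H1 C1 P(1) _ t(3) _ \<zeta>])
      fix s assume s: "0 \<le> s" "s < T1"
      then have "s \<in> ?J" using sub by auto
      from zero[OF this] show "AE x in lebesgue. w s x * laplacian P x = \<nu>\<^sup>2 * (w s x * P x)"
      proof eventually_elim
        case (elim x)
        show ?case
        proof (cases "norm x > r + s")
          case False
          then have "laplacian P x = \<nu>\<^sup>2 * P x" using s by (intro lap) simp
          then show ?thesis by simp
        qed (use elim in simp)
      qed
    qed (use t in simp)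
  qed
  then show ?thesis
  proof (rule duhamel_lower_bound[OF _ t(1) \<nu> c0])
    show "set_integrable lebesgue {0..t} ?f" by (rule set_integrable_subset[OF f]) (use t in auto)
    show "?f s \<ge> 0" for s by (rule Bochner_Integration.integral_nonneg) (simp add: F(2) P(2))
  qed
qed

section \<open>From integral to differential inequalities\<close>

text \<open>The source \<open>f\<close> is only integrable, so its integral cannot simply be
  differentiated. Replacing it by its continuous lower bound gives a differentiable function below
  \<open>A\<close>. The shift by 1 in time converts the weight \<open>1 + s\<close> into
  \<open>t\<close>.\<close>

lemma integral_minorant:
  fixes A B f :: "real \<Rightarrow> real"
  assumes T1: "0 < T1" and B: "continuous_on {0..T1} B" "\<And>t. t \<in> {0..T1} \<Longrightarrow> B t > 0"
    and A: "\<And>t. t \<in> {0..T1} \<Longrightarrow> A t \<ge> 1 / 2 * (c + (LINT s:{0..t}|lebesgue. f s))"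
    and f: "set_integrable lebesgue {0..T1} f" and c: "c > 0" and \<kappa>: "\<kappa> > 0"
    and lower: "AE s in lebesgue. s \<in> {0..T1} \<longrightarrow> f s \<ge> \<kappa> * (1 + s) powr e * B s powr p"
  shows "\<exists>X. continuous_on {1..1 + T1} X \<and> X 1 = c / 2 \<and> (\<forall>t\<in>{1..1 + T1}. 0 < X t \<and> X t \<le> A (t - 1)) \<and>
    (\<forall>t\<in>{1<..<1 + T1}. (X has_real_derivative \<kappa> / 2 * t powr e * B (t - 1) powr p) (at t))"
proof -
  define g where "g = (\<lambda>s. \<kappa> * (1 + s) powr e * B s powr p)"
  have cg: "continuous_on {0..T1} g" unfolding g_def
    by (intro continuous_intros B(1)) (use B(2) in force)+
  have ig: "set_integrable lebesgue {0..T1} g" by (rule absolutely_integrable_continuous_real[OF cg])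
  have g0: "g s \<ge> 0" for s using \<kappa> by (simp add: g_def)
  define H where "H = (\<lambda>t. integral {0..t} g)"
  have dH: "(H has_real_derivative g t) (at t within {0..T1})" if "t \<in> {0..T1}" for t
    unfolding H_def by (rule integral_has_real_derivative[OF cg that])
  have H: "0 \<le> H t \<and> H t \<le> (LINT s:{0..t}|lebesgue. f s)" if t: "t \<in> {0..T1}" for t
  proof -
    have sub: "{0..t} \<subseteq> {0..T1}" using t by auto
    have igt: "set_integrable lebesgue {0..t} g" and ift: "set_integrable lebesgue {0..t} f"
      using set_integrable_subset[OF ig _ sub] set_integrable_subset[OF f _ sub] by auto
    have H': "H t = (LINT s:{0..t}|lebesgue. g s)" unfolding H_def
      by (rule set_lebesgue_integral_eq_integral(2)[OF igt, symmetric])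
    have "H t \<ge> 0" unfolding H' set_lebesgue_integral_def
      by (rule Bochner_Integration.integral_nonneg) (simp add: g0)
    moreover have "(LINT s:{0..t}|lebesgue. g s) \<le> (LINT s:{0..t}|lebesgue. f s)"
    proof (rule set_integral_mono_AE[OF igt ift])
      show "AE s\<in>{0..t} in lebesgue. g s \<le> f s"
        using lower by eventually_elim (use sub in \<open>auto simp: g_def\<close>)
    qed
    ultimately show ?thesis by (simp add: H')
  qed
  define X where "X = (\<lambda>t. 1 / 2 * (c + H (t - 1)))"
  have cH: "continuous_on {0..T1} H" by (rule DERIV_continuous_on[OF dH])
  have "continuous_on {1..1 + T1} X" unfolding X_def
    by (intro continuous_intros continuous_on_compose2[OF cH]) auto
  moreover have "X 1 = c / 2" by (simp add: X_def H_def)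
  moreover have "0 < X t \<and> X t \<le> A (t - 1)" if "t \<in> {1..1 + T1}" for t
    using H[of "t - 1"] A[of "t - 1"] that c by (auto simp: X_def)
  moreover have "(X has_real_derivative \<kappa> / 2 * t powr e * B (t - 1) powr p) (at t)" if t: "t \<in> {1<..<1 + T1}" for t
  proof -
    have "at (t - 1) within {0..T1} = at (t - 1)" using t by (intro at_within_interior) auto
    then have dH1: "(H has_real_derivative g (t - 1)) (at (t - 1))" using dH[of "t - 1"] t by auto
    have "((\<lambda>t. t - 1) has_real_derivative 1) (at t)" by (auto intro!: derivative_eq_intros)
    from DERIV_chain2[OF dH1 this] have "((\<lambda>t. H (t - 1)) has_real_derivative g (t - 1)) (at t)" by simp
    then have "(X has_real_derivative 1 / 2 * (0 + g (t - 1))) (at t)"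
      unfolding X_def by (intro DERIV_cmult DERIV_add DERIV_const)
    then show ?thesis by (simp add: g_def)
  qed
  ultimately show ?thesis by blast
qed

text \<open>Nonnegative sources first give positivity of \<open>A\<close> and \<open>B\<close>,
  which releases the conditional bounds \<open>fB\<close> and \<open>hA\<close>. The derivatives of
  the minorants are then expressed through \<open>B\<close> and \<open>A\<close>; as
  \<open>Y\<close> lies below \<open>B\<close> and \<open>X\<close> below \<open>A\<close>,
  monotonicity of the powers closes the system.\<close>

lemma ode_supersolution_from_integral_inequalities:
  fixes A B f h :: "real \<Rightarrow> real"
  assumes T1: "0 < T1" and pq: "p > 1" "q > 1" and AB: "continuous_on {0..T1} A" "continuous_on {0..T1} B"
    and A: "\<And>t. t \<in> {0..T1} \<Longrightarrow> A t \<ge> 1 / 2 * (c + (LINT s:{0..t}|lebesgue. f s))"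
    and B: "\<And>t. t \<in> {0..T1} \<Longrightarrow> B t \<ge> 1 / 2 * (c + (LINT s:{0..t}|lebesgue. h s))"
    and f: "set_integrable lebesgue {0..T1} f" "\<And>s. f s \<ge> 0"
    and h: "set_integrable lebesgue {0..T1} h" "\<And>s. h s \<ge> 0" and c: "c > 0" and \<kappa>: "\<kappa> > 0"
    and fB: "AE s in lebesgue. s \<in> {0..T1} \<longrightarrow> B s > 0 \<longrightarrow> f s \<ge> \<kappa> * (1 + s) powr (- (m * (p - 1))) * B s powr p"
    and hA: "AE s in lebesgue. s \<in> {0..T1} \<longrightarrow> A s > 0 \<longrightarrow> h s \<ge> \<kappa> * (1 + s) powr (- (m * (q - 1))) * A s powr q"
  shows "\<exists>X Y. ode_supersolution p q (\<kappa> / 2) m (1 + T1) X Y \<and> X 1 = c / 2 \<and> Y 1 = c / 2"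
proof -
  have nonneg: "(LINT s:{0..t}|lebesgue. k s) \<ge> 0" if "\<And>s. k s \<ge> 0" for k :: "real \<Rightarrow> real" and t
    unfolding set_lebesgue_integral_def by (rule Bochner_Integration.integral_nonneg) (simp add: that)
  have A0: "A t > 0" and B0: "B t > 0" if "t \<in> {0..T1}" for t
    using A[OF that] B[OF that] nonneg[of f t, OF f(2)] nonneg[of h t, OF h(2)] c by auto
  have fB': "AE s in lebesgue. s \<in> {0..T1} \<longrightarrow> f s \<ge> \<kappa> * (1 + s) powr (- (m * (p - 1))) * B s powr p"
    using fB by eventually_elim (use B0 in auto)
  have hA': "AE s in lebesgue. s \<in> {0..T1} \<longrightarrow> h s \<ge> \<kappa> * (1 + s) powr (- (m * (q - 1))) * A s powr q"
    using hA by eventually_elim (use A0 in auto)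
  obtain X where X: "continuous_on {1..1 + T1} X" "X 1 = c / 2" "\<And>t. t \<in> {1..1 + T1} \<Longrightarrow> 0 < X t \<and> X t \<le> A (t - 1)"
    "\<And>t. t \<in> {1<..<1 + T1} \<Longrightarrow> (X has_real_derivative \<kappa> / 2 * t powr (- (m * (p - 1))) * B (t - 1) powr p) (at t)"
    using integral_minorant[OF T1 AB(2) B0 A f(1) c \<kappa> fB'] by blast
  obtain Y where Y: "continuous_on {1..1 + T1} Y" "Y 1 = c / 2" "\<And>t. t \<in> {1..1 + T1} \<Longrightarrow> 0 < Y t \<and> Y t \<le> B (t - 1)"
    "\<And>t. t \<in> {1<..<1 + T1} \<Longrightarrow> (Y has_real_derivative \<kappa> / 2 * t powr (- (m * (q - 1))) * A (t - 1) powr q) (at t)"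
    using integral_minorant[OF T1 AB(1) A0 B h(1) c \<kappa> hA'] by blast
  have "ode_supersolution p q (\<kappa> / 2) m (1 + T1) X Y"
    unfolding ode_supersolution_def
  proof (intro conjI ballI)
    fix t assume t: "t \<in> {1<..<1 + T1}"
    have "\<kappa> / 2 * t powr (- (m * (p - 1))) * Y t powr p \<le> \<kappa> / 2 * t powr (- (m * (p - 1))) * B (t - 1) powr p"
      using Y(3)[of t] t \<kappa> pq by (intro mult_left_mono powr_mono2) auto
    then show "\<exists>D. (X has_real_derivative D) (at t) \<and> \<kappa> / 2 * t powr (- (m * (p - 1))) * Y t powr p \<le> D"
      using X(4)[OF t] by blast
    have "\<kappa> / 2 * t powr (- (m * (q - 1))) * X t powr q \<le> \<kappa> / 2 * t powr (- (m * (q - 1))) * A (t - 1) powr q"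
      using X(3)[of t] t \<kappa> pq by (intro mult_left_mono powr_mono2) auto
    then show "\<exists>D. (Y has_real_derivative D) (at t) \<and> \<kappa> / 2 * t powr (- (m * (q - 1))) * X t powr q \<le> D"
      using Y(4)[OF t] by blast
  qed (use X Y in auto)
  then show ?thesis using X(2) Y(2) by blast
qed

lemma Cc_infty_support_bounded:
  fixes f :: "'a::euclidean_space \<Rightarrow> real"
  assumes "f \<in> Cc_infty"
  shows "\<exists>M. \<forall>x. f x \<noteq> 0 \<longrightarrow> norm x \<le> M"
proof -
  have "bounded (supp f)" using assms by (auto simp: Cc_infty_def intro: compact_imp_bounded)
  then obtain M where "\<forall>x\<in>supp f. norm x \<le> M" by (auto simp: bounded_iff)
  then show ?thesis using supp_subset_support[of f] by (intro exI[of _ M]) blast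
qed

text \<open>As \<nu> tends to 0 the weight tends to 1 uniformly on the supports of \<open>f\<close>
  and \<open>g\<close>, so the expression tends to the positive integral of \<open>g\<close>,
  whatever the sign or size of \<open>f\<close>.\<close>

lemma exponential_moment_positive:
  fixes f g :: "'a::euclidean_space \<Rightarrow> real"
  assumes f: "f \<in> Cc_infty" and g: "g \<in> Cc_infty" and pos: "(\<integral>x. g x \<partial>lebesgue) > 0" and e: "e \<in> Basis"
  shows "eventually (\<lambda>\<nu>. (\<integral>x. g x * exp (\<nu> * (x \<bullet> e)) \<partial>lebesgue) - \<nu> * \<bar>\<integral>x. f x * exp (\<nu> * (x \<bullet> e)) \<partial>lebesgue\<bar> > 0) (at_right 0)"
proof -
  obtain M1 M2 where M12: "\<And>x. f x \<noteq> 0 \<Longrightarrow> norm x \<le> M1" "\<And>x. g x \<noteq> 0 \<Longrightarrow> norm x \<le> M2"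
    using Cc_infty_support_bounded[OF f] Cc_infty_support_bounded[OF g] by blast
  define M where "M = max M1 M2"
  have M: "\<bar>x \<bullet> e\<bar> \<le> M" if "f x \<noteq> 0 \<or> g x \<noteq> 0" for x
    using M12[of x] that Basis_le_norm[OF e, of x] by (auto simp: M_def)
  define I where "I = (\<integral>x. g x \<partial>lebesgue)"
  define L1g where "L1g = (\<integral>x. \<bar>g x\<bar> \<partial>lebesgue)"
  define L1f where "L1f = (\<integral>x. \<bar>f x\<bar> \<partial>lebesgue)"
  have ig: "integrable lebesgue g" and "integrable lebesgue f" using Cc_infty_integrable f g by auto
  have exp_int: "integrable lebesgue (\<lambda>x. k x * exp (\<nu> * (x \<bullet> e)))" if "k \<in> Cc_infty" for k :: "'a \<Rightarrow> real" and \<nu>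
  proof (rule continuous_compact_supp_integrable)
    show "continuous_on UNIV (\<lambda>x. k x * exp (\<nu> * (x \<bullet> e)))"
      by (intro continuous_intros Cc_infty_continuous that)
    have "supp (\<lambda>x. k x * exp (\<nu> * (x \<bullet> e))) = supp k" by (simp add: supp_def)
    then show "compact (supp (\<lambda>x. k x * exp (\<nu> * (x \<bullet> e))))" using that by (simp add: Cc_infty_def)
  qed
  \<comment> \<open>An explicit lower bound that is continuous in \<nu> and equals \<open>I\<close>
    at \<nu> = 0.\<close>
  have "((\<lambda>\<nu>. I - (exp (\<nu> * M) - 1) * L1g - \<nu> * (exp (\<nu> * M) * L1f)) \<longlongrightarrow> I - (exp (0 * M) - 1) * L1g - 0 * (exp (0 * M) * L1f)) (at_right 0)"
    by (intro tendsto_intros)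
  then have "eventually (\<lambda>\<nu>. I - (exp (\<nu> * M) - 1) * L1g - \<nu> * (exp (\<nu> * M) * L1f) > 0) (at_right 0)"
    using pos by (intro order_tendstoD) (auto simp: I_def)
  moreover have "eventually (\<lambda>\<nu>::real. \<nu> > 0) (at_right 0)" by (simp add: eventually_at_right_less)
  ultimately show ?thesis
  proof eventually_elim
    case (elim \<nu>)
    then have \<nu>: "\<nu> > 0" by simp
    have "I - (\<integral>x. g x * exp (\<nu> * (x \<bullet> e)) \<partial>lebesgue) = (\<integral>x. g x - g x * exp (\<nu> * (x \<bullet> e)) \<partial>lebesgue)"
      unfolding I_def using ig exp_int[OF g] by simp
    also have "\<dots> \<le> (\<integral>x. (exp (\<nu> * M) - 1) * \<bar>g x\<bar> \<partial>lebesgue)"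
    proof (rule integral_mono)
      show "integrable lebesgue (\<lambda>x. g x - g x * exp (\<nu> * (x \<bullet> e)))" using ig exp_int[OF g] by simp
      show "integrable lebesgue (\<lambda>x. (exp (\<nu> * M) - 1) * \<bar>g x\<bar>)" using ig by simp
      show "g x - g x * exp (\<nu> * (x \<bullet> e)) \<le> (exp (\<nu> * M) - 1) * \<bar>g x\<bar>" for x
      proof (cases "g x = 0")
        case False
        then have "\<bar>x \<bullet> e\<bar> \<le> M" using M by blast
        then have y: "\<bar>\<nu> * (x \<bullet> e)\<bar> \<le> \<nu> * M" using \<nu> by (simp add: abs_mult)
        let ?E = "exp (\<nu> * (x \<bullet> e))"
        have "?E \<le> exp (\<nu> * M)" using y by simp
        \<comment> \<open>Both exponentials lie above their tangents at 0, which settles the case of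
          a negative exponent.\<close>
        moreover have "1 - ?E \<le> exp (\<nu> * M) - 1"
        proof -
          have "?E \<ge> 1 + \<nu> * (x \<bullet> e)" "exp (\<nu> * M) \<ge> 1 + \<nu> * M" by (rule exp_ge_add_one_self)+
          then show ?thesis using y by linarith
        qed
        ultimately have "\<bar>1 - ?E\<bar> \<le> exp (\<nu> * M) - 1" by linarith
        then have "\<bar>1 - ?E\<bar> * \<bar>g x\<bar> \<le> (exp (\<nu> * M) - 1) * \<bar>g x\<bar>" by (rule mult_right_mono) simp
        then have "\<bar>g x * (1 - ?E)\<bar> \<le> (exp (\<nu> * M) - 1) * \<bar>g x\<bar>" by (simp only: abs_mult mult.commute)
        then show ?thesis by (simp add: right_diff_distrib)
      qed simp
    qed
    finally have 1: "(\<integral>x. g x * exp (\<nu> * (x \<bullet> e)) \<partial>lebesgue) \<ge> I - (exp (\<nu> * M) - 1) * L1g"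
      by (simp add: L1g_def)
    have "\<bar>\<integral>x. f x * exp (\<nu> * (x \<bullet> e)) \<partial>lebesgue\<bar> \<le> (\<integral>x. \<bar>f x * exp (\<nu> * (x \<bullet> e))\<bar> \<partial>lebesgue)"
      by (rule integral_abs_bound)
    also have "\<dots> \<le> (\<integral>x. exp (\<nu> * M) * \<bar>f x\<bar> \<partial>lebesgue)"
    proof (rule integral_mono)
      show "integrable lebesgue (\<lambda>x. \<bar>f x * exp (\<nu> * (x \<bullet> e))\<bar>)" using exp_int[OF f] by simp
      show "integrable lebesgue (\<lambda>x. exp (\<nu> * M) * \<bar>f x\<bar>)" using Cc_infty_integrable[OF f] by simp
      show "\<bar>f x * exp (\<nu> * (x \<bullet> e))\<bar> \<le> exp (\<nu> * M) * \<bar>f x\<bar>" for x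
      proof (cases "f x = 0")
        case False
        then have "x \<bullet> e \<le> M" using M[of x] by auto
        then have "exp (\<nu> * (x \<bullet> e)) * \<bar>f x\<bar> \<le> exp (\<nu> * M) * \<bar>f x\<bar>"
          using \<nu> by (intro mult_right_mono) auto
        then show ?thesis by (simp add: abs_mult mult.commute)
      qed simp
    qed
    finally have "\<nu> * \<bar>\<integral>x. f x * exp (\<nu> * (x \<bullet> e)) \<partial>lebesgue\<bar> \<le> \<nu> * (exp (\<nu> * M) * L1f)"
      using \<nu> by (simp add: L1f_def)
    with 1 elim show ?case by linarith
  qed
qed

text \<open>The exponents of \<open>exp (\<nu> * s)\<close> add up to -1 + (1 - p) + p = 0. The
  exponential growth of the plane wave thus drops out and only the polynomial weight
  remains.\<close>

lemma weighted_power_simplify: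
  fixes D s m p B \<nu> :: real
  assumes "D > 0" "s \<ge> 0" "B > 0"
  shows "exp (- \<nu> * s) * ((D * exp (\<nu> * s) * (1 + s) powr m) powr (1 - p) * (exp (\<nu> * s) * B) powr p)
     = D powr (1 - p) * (1 + s) powr (- (m * (p - 1))) * B powr p"
proof -
  have "exp (- \<nu> * s) * (exp (\<nu> * s) powr (1 - p) * exp (\<nu> * s) powr p) = 1"
    by (simp add: powr_add[symmetric] exp_add[symmetric])
  moreover have "((1 + s) powr m) powr (1 - p) = (1 + s) powr (- (m * (p - 1)))"
    by (simp add: powr_powr algebra_simps)
  moreover have "exp (- \<nu> * s) * ((D * exp (\<nu> * s) * (1 + s) powr m) powr (1 - p) * (exp (\<nu> * s) * B) powr p)
     = D powr (1 - p) * ((1 + s) powr m) powr (1 - p) * B powr p * (exp (- \<nu> * s) * (exp (\<nu> * s) powr (1 - p) * exp (\<nu> * s) powr p))"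
    using assms by (simp add: powr_mult mult_ac)
  ultimately show ?thesis by simp
qed

text \<open>The constants are fixed before \<epsilon>, the times and the solution. The truncated
  wave \<open>P\<close> does depend on the time horizon, but it equals the plane wave throughout the
  cone, so its pairings with the data and its mass on the relevant balls do not.\<close>

lemma weak_solution_ode_supersolution:
  fixes p q a b r\<^sub>0 :: real
    and G\<^sub>1 G\<^sub>2 :: "real \<Rightarrow> real"
    and f\<^sub>1 g\<^sub>1 f\<^sub>2 g\<^sub>2 :: "'a::euclidean_space \<Rightarrow> real"
  defines "m \<equiv> (real DIM('a) - 1) / 2"
  assumes p: "p > 1" and q: "q > 1" and a: "a > 0" and b: "b > 0"
    and G0: "G\<^sub>1 0 = 0" "G\<^sub>2 0 = 0"
    and G1: "\<And>\<sigma>. G\<^sub>1 \<sigma> \<ge> a * \<bar>\<sigma>\<bar> powr p"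
    and G2: "\<And>\<sigma>. G\<^sub>2 \<sigma> \<ge> b * \<bar>\<sigma>\<bar> powr q"
    and data: "f\<^sub>1 \<in> Cc_infty" "g\<^sub>1 \<in> Cc_infty" "f\<^sub>2 \<in> Cc_infty" "g\<^sub>2 \<in> Cc_infty"
    and pos: "(\<integral>x. g\<^sub>1 x \<partial>lebesgue) > 0" "(\<integral>x. g\<^sub>2 x \<partial>lebesgue) > 0"
  shows "\<exists>\<kappa>>0. \<exists>c>0. \<forall>\<epsilon> T1 T u v. 0 < \<epsilon> \<and> 0 < T1 \<and> ereal T1 < T \<and>
      weak_solution G\<^sub>1 G\<^sub>2 \<epsilon> f\<^sub>1 g\<^sub>1 f\<^sub>2 g\<^sub>2 T u v \<and>
      spacetime_supp T u \<union> spacetime_supp T v \<subseteq> {(x, t). t \<in> time_interval T \<and> norm x \<le> r\<^sub>0 + t} \<longrightarrow>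
      (\<exists>X Y. ode_supersolution p q \<kappa> m (1 + T1) X Y \<and> X 1 = c * \<epsilon> \<and> Y 1 = c * \<epsilon>)"
proof -
  obtain e :: 'a where e: "e \<in> Basis" using nonempty_Basis by blast
  let ?\<phi> = "\<lambda>\<nu> x. exp (\<nu> * (x \<bullet> e))"
  have "eventually (\<lambda>\<nu>::real. \<nu> > 0) (at_right 0)" by (simp add: eventually_at_right_less)
  with exponential_moment_positive[OF data(1,2) pos(1) e] exponential_moment_positive[OF data(3,4) pos(2) e]
  have "eventually (\<lambda>\<nu>. \<nu> > 0 \<and> (\<integral>x. g\<^sub>1 x * ?\<phi> \<nu> x \<partial>lebesgue) - \<nu> * \<bar>\<integral>x. f\<^sub>1 x * ?\<phi> \<nu> x \<partial>lebesgue\<bar> > 0 \<and>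
      (\<integral>x. g\<^sub>2 x * ?\<phi> \<nu> x \<partial>lebesgue) - \<nu> * \<bar>\<integral>x. f\<^sub>2 x * ?\<phi> \<nu> x \<partial>lebesgue\<bar> > 0) (at_right 0)"
    by eventually_elim simp
  then obtain \<nu> where \<nu>: "\<nu> > 0"
    and k1: "(\<integral>x. g\<^sub>1 x * ?\<phi> \<nu> x \<partial>lebesgue) - \<nu> * \<bar>\<integral>x. f\<^sub>1 x * ?\<phi> \<nu> x \<partial>lebesgue\<bar> > 0"
    and k2: "(\<integral>x. g\<^sub>2 x * ?\<phi> \<nu> x \<partial>lebesgue) - \<nu> * \<bar>\<integral>x. f\<^sub>2 x * ?\<phi> \<nu> x \<partial>lebesgue\<bar> > 0"
    using eventually_happens'[OF trivial_limit_at_right_real] by blast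
  define c0 where "c0 = min ((\<integral>x. g\<^sub>1 x * ?\<phi> \<nu> x \<partial>lebesgue) - \<nu> * \<bar>\<integral>x. f\<^sub>1 x * ?\<phi> \<nu> x \<partial>lebesgue\<bar>)
    ((\<integral>x. g\<^sub>2 x * ?\<phi> \<nu> x \<partial>lebesgue) - \<nu> * \<bar>\<integral>x. f\<^sub>2 x * ?\<phi> \<nu> x \<partial>lebesgue\<bar>)"
  have c0: "c0 > 0" using k1 k2 by (simp add: c0_def)
  obtain M1 M2 M3 M4 where M: "\<And>x. f\<^sub>1 x \<noteq> 0 \<Longrightarrow> norm x \<le> M1" "\<And>x. g\<^sub>1 x \<noteq> 0 \<Longrightarrow> norm x \<le> M2"
    "\<And>x. f\<^sub>2 x \<noteq> 0 \<Longrightarrow> norm x \<le> M3" "\<And>x. g\<^sub>2 x \<noteq> 0 \<Longrightarrow> norm x \<le> M4"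
    using data[THEN Cc_infty_support_bounded] by metis
  \<comment> \<open>Enlarging the radius of the cone weakens the support condition and is harmless.
    The new radius also covers the data, and \<open>R \<ge> 1\<close> gives
    \<open>R + s \<le> R * (1 + s)\<close>.\<close>
  define R where "R = 1 + max \<bar>r\<^sub>0\<bar> (max (max M1 M2) (max M3 M4))"
  have R: "R \<ge> 1" "r\<^sub>0 \<le> R" "M1 \<le> R" "M2 \<le> R" "M3 \<le> R" "M4 \<le> R" by (auto simp: R_def)
  have m0: "m \<ge> 0" using DIM_positive[where 'a='a] by (simp add: m_def)
  obtain C where C: "C > 0" "\<And>\<rho>. \<rho> \<ge> 1 \<Longrightarrow> (LINT x:cball 0 \<rho>|lebesgue. ?\<phi> \<nu> x) \<le> C * exp (\<nu> * \<rho>) * \<rho> powr m"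
    using plane_wave_ball_bound[OF e \<nu>] unfolding m_def by blast
  define D where "D = C * exp (\<nu> * R) * R powr m"
  have D: "D > 0" using C R by (simp add: D_def)
  have ball: "(LINT x:cball 0 (R + s)|lebesgue. ?\<phi> \<nu> x) \<le> D * exp (\<nu> * s) * (1 + s) powr m" if s: "s \<ge> 0" for s
  proof -
    have "R + s \<le> R * (1 + s)" using R s mult_right_mono[of 1 R s] by (simp add: algebra_simps)
    then have "(R + s) powr m \<le> (R * (1 + s)) powr m" using R s m0 by (intro powr_mono2) auto
    also have "\<dots> = R powr m * (1 + s) powr m" using R s by (simp add: powr_mult)
    finally have "C * exp (\<nu> * (R + s)) * (R + s) powr m \<le> C * exp (\<nu> * (R + s)) * (R powr m * (1 + s) powr m)"
      using C by (intro mult_left_mono) auto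
    also have "\<dots> = D * exp (\<nu> * s) * (1 + s) powr m" by (simp add: D_def distrib_left exp_add mult_ac)
    finally show ?thesis using C(2)[of "R + s"] R s by simp
  qed
  define \<kappa> where "\<kappa> = min (a * D powr (1 - p)) (b * D powr (1 - q))"
  have \<kappa>: "\<kappa> > 0" using a b D by (simp add: \<kappa>_def)
  have "\<exists>X Y. ode_supersolution p q (\<kappa> / 2) m (1 + T1) X Y \<and> X 1 = \<epsilon> * c0 / 2 \<and> Y 1 = \<epsilon> * c0 / 2"
    if \<epsilon>: "0 < \<epsilon>" and T1: "0 < T1" "ereal T1 < T" and sol: "weak_solution G\<^sub>1 G\<^sub>2 \<epsilon> f\<^sub>1 g\<^sub>1 f\<^sub>2 g\<^sub>2 T u v"
      and spt: "spacetime_supp T u \<union> spacetime_supp T v \<subseteq> {(x, t). t \<in> time_interval T \<and> norm x \<le> r\<^sub>0 + t}"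
    for \<epsilon> T1 and T :: ereal and u v :: "real \<Rightarrow> 'a \<Rightarrow> real"
  proof -
    let ?J = "time_interval T"
    \<comment> \<open>Room beyond \<open>T1\<close>, so that Duhamel's formula also holds at
      \<open>t = T1\<close>.\<close>
    obtain T2 where T2: "T1 < T2" "ereal T2 < T" using ereal_dense2[OF T1(2)] by auto
    have subJ: "{0..T1} \<subseteq> ?J" using T1 by (auto simp: time_interval_def intro: le_less_trans[of "ereal _" "ereal T1"])
    obtain ut Du vt Dv where s: "continuous_H1 ?J u Du" "C1_L2 ?J u ut" "continuous_H1 ?J v Dv" "C1_L2 ?J v vt"
      "Bochner_L1_L1 ?J (\<lambda>t x. G\<^sub>2 (ut t x))" "Bochner_L1_L1 ?J (\<lambda>t x. G\<^sub>1 (vt t x))"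
      "AE x in lebesgue. u 0 x = \<epsilon> * f\<^sub>1 x" "AE x in lebesgue. v 0 x = \<epsilon> * f\<^sub>2 x"
      "weak_wave_eq T ut Du (\<lambda>t x. G\<^sub>1 (vt t x)) (\<lambda>x. \<epsilon> * g\<^sub>1 x)"
      "weak_wave_eq T vt Dv (\<lambda>t x. G\<^sub>2 (ut t x)) (\<lambda>x. \<epsilon> * g\<^sub>2 x)"
      using sol unfolding weak_solution_def by blast
    define \<rho> where "\<rho> = R + T2 + 1"
    have \<rho>: "\<rho> \<ge> R" "\<rho> \<ge> 0" using R T1 T2 by (auto simp: \<rho>_def)
    obtain P where P: "P \<in> Cc_infty" "\<And>x. 0 \<le> P x" "\<And>x. norm x \<le> \<rho> \<Longrightarrow> P x = ?\<phi> \<nu> x"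
      "\<And>x. norm x < \<rho> \<Longrightarrow> laplacian P x = \<nu>\<^sup>2 * P x"
      using plane_wave_cutoff_exists[OF \<rho>(2) e, of \<nu>] by blast
    have PL2: "P \<in> L2" by (rule Cc_infty_L2[OF P(1)])
    have support: "AE x in lebesgue. norm x > R + t \<longrightarrow> w t x = 0"
      if "spacetime_supp T w \<subseteq> {(x, t). t \<in> ?J \<and> norm x \<le> r\<^sub>0 + t}" "t \<in> ?J" for w :: "real \<Rightarrow> 'a \<Rightarrow> real" and t
      using spacetime_supp_AE[OF that] by eventually_elim (use R in auto)
    have zu: "AE x in lebesgue. norm x > R + t \<longrightarrow> u t x = 0"
      and zv: "AE x in lebesgue. norm x > R + t \<longrightarrow> v t x = 0" if "t \<in> ?J" for t
      using support[of u t] support[of v t] spt that by auto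
    have pairing: "(\<integral>x. (\<epsilon> * g x) * P x \<partial>lebesgue) = \<epsilon> * (\<integral>x. g x * ?\<phi> \<nu> x \<partial>lebesgue)"
      if "\<And>x. g x \<noteq> 0 \<Longrightarrow> norm x \<le> R" for g
    proof -
      have "(\<epsilon> * g x) * P x = \<epsilon> * (g x * ?\<phi> \<nu> x)" for x
        using that[of x] P(3)[of x] \<rho> by (cases "g x = 0") auto
      then have "(\<lambda>x. (\<epsilon> * g x) * P x) = (\<lambda>x. \<epsilon> * (g x * ?\<phi> \<nu> x))" by blast
      then show ?thesis by simp
    qed
    have initial: "pairing w P = \<epsilon> * (\<integral>x. f x * ?\<phi> \<nu> x \<partial>lebesgue)"
      if w: "AE x in lebesgue. w x = \<epsilon> * f x" "w \<in> L2" "f \<in> Cc_infty" "\<And>x. f x \<noteq> 0 \<Longrightarrow> norm x \<le> R" for w f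
    proof -
      have m: "w \<in> borel_measurable lebesgue" "f \<in> borel_measurable lebesgue" "P \<in> borel_measurable lebesgue"
        using w(2) Cc_infty_L2[OF w(3)] PL2 by (simp_all add: L2_def)
      have "pairing w P = (\<integral>x. (\<epsilon> * f x) * P x \<partial>lebesgue)"
      proof (rule integral_cong_AE)
        show "AE x in lebesgue. w x * P x = \<epsilon> * f x * P x" using w(1) by eventually_elim simp
      qed (use m in auto)
      also have "\<dots> = \<epsilon> * (\<integral>x. f x * ?\<phi> \<nu> x \<partial>lebesgue)" by (rule pairing[OF w(4)])
      finally show ?thesis .
    qed
    have J0: "0 \<in> ?J" using subJ T1 by auto
    have L2s: "u t \<in> L2" "v t \<in> L2" "ut t \<in> L2" "vt t \<in> L2" if "t \<in> ?J" for t
      using s(2,4) that by (simp_all add: C1_L2_def continuous_L2_def)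
    let ?A = "\<lambda>t. exp (- \<nu> * t) * pairing (ut t) P"
    let ?B = "\<lambda>t. exp (- \<nu> * t) * pairing (vt t) P"
    let ?f = "\<lambda>t. exp (- \<nu> * t) * (\<integral>x. G\<^sub>1 (vt t x) * P x \<partial>lebesgue)"
    let ?h = "\<lambda>t. exp (- \<nu> * t) * (\<integral>x. G\<^sub>2 (ut t x) * P x \<partial>lebesgue)"
    have G1n: "G\<^sub>1 \<sigma> \<ge> 0" for \<sigma> using G1[of \<sigma>] a by (smt (verit) mult_nonneg_nonneg powr_ge_zero)
    have G2n: "G\<^sub>2 \<sigma> \<ge> 0" for \<sigma> using G2[of \<sigma>] b by (smt (verit) mult_nonneg_nonneg powr_ge_zero)
    \<comment> \<open>One statement for both components. It holds for almost every time because the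
      source is known to be integrable in space only then, and it is conditional because positivity
      of the pairing comes later from the integral inequalities.\<close>
    have jensen: "AE t in lebesgue. t \<in> {0..T1} \<longrightarrow> exp (- \<nu> * t) * pairing (wt t) P > 0 \<longrightarrow>
        exp (- \<nu> * t) * (\<integral>x. G (wt t x) * P x \<partial>lebesgue) \<ge>
        \<kappa> * (1 + t) powr (- (m * (z - 1))) * (exp (- \<nu> * t) * pairing (wt t) P) powr z"
      if w: "C1_L2 ?J w wt" "\<And>t. t \<in> ?J \<Longrightarrow> AE x in lebesgue. norm x > R + t \<longrightarrow> w t x = 0"
        and Bo: "Bochner_L1_L1 ?J (\<lambda>t x. G (wt t x))" and z: "z > 1" and d: "d > 0" "\<kappa> \<le> d * D powr (1 - z)"
        and G: "\<And>\<sigma>. G \<sigma> \<ge> d * \<bar>\<sigma>\<bar> powr z" "G 0 = 0"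
      for w wt :: "real \<Rightarrow> 'a \<Rightarrow> real" and G and z d :: real
      using Bochner_L1_L1_AE_integrable[OF Bo]
    proof eventually_elim
      case (elim t)
      show ?case
      proof (intro impI)
        assume t: "t \<in> {0..T1}" and posB: "exp (- \<nu> * t) * pairing (wt t) P > 0"
        define B where "B = exp (- \<nu> * t) * pairing (wt t) P"
        have BB: "B > 0" using posB by (simp add: B_def)
        have IB: "pairing (wt t) P = exp (\<nu> * t) * B"
          by (simp add: B_def mult.assoc[symmetric] exp_add[symmetric])
        have tJ: "t \<in> ?J" and t0: "t \<ge> 0" using t subJ by auto
        have W: "D * exp (\<nu> * t) * (1 + t) powr m > 0" using D t0 by simp
        have "(\<integral>x. G (wt t x) * P x \<partial>lebesgue) \<ge>
            d * (D * exp (\<nu> * t) * (1 + t) powr m) powr (1 - z) * pairing (wt t) P powr z"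
        proof (rule nonlinear_pairing_lower_bound[OF z d(1) G _ _ _ P(1,2) _ W ball[OF t0]])
          show "integrable lebesgue (\<lambda>x. G (wt t x))" using elim tJ by simp
          show "wt t \<in> L2" using w(1) tJ by (simp add: C1_L2_def continuous_L2_def)
          show "AE x in lebesgue. norm x > R + t \<longrightarrow> wt t x = 0" by (rule C1_L2_deriv_AE_zero[OF w(1) tJ w(2)])
          show "P x = ?\<phi> \<nu> x" if "norm x \<le> R + t" for x
            using that t T2 by (intro P(3)) (simp add: \<rho>_def)
          show "pairing (wt t) P > 0" using BB by (simp add: IB)
        qed
        then have "exp (- \<nu> * t) * (d * (D * exp (\<nu> * t) * (1 + t) powr m) powr (1 - z) * (exp (\<nu> * t) * B) powr z)
            \<le> exp (- \<nu> * t) * (\<integral>x. G (wt t x) * P x \<partial>lebesgue)"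
          unfolding IB by (rule mult_left_mono) simp
        also have "exp (- \<nu> * t) * (d * (D * exp (\<nu> * t) * (1 + t) powr m) powr (1 - z) * (exp (\<nu> * t) * B) powr z)
            = d * (exp (- \<nu> * t) * ((D * exp (\<nu> * t) * (1 + t) powr m) powr (1 - z) * (exp (\<nu> * t) * B) powr z))"
          by (simp only: mult_ac)
        also have "\<dots> = (d * D powr (1 - z)) * ((1 + t) powr (- (m * (z - 1))) * B powr z)"
          unfolding weighted_power_simplify[OF D t0 BB] by (simp only: mult.assoc)
        finally have "(d * D powr (1 - z)) * ((1 + t) powr (- (m * (z - 1))) * B powr z) \<le> exp (- \<nu> * t) * (\<integral>x. G (wt t x) * P x \<partial>lebesgue)" .
        moreover have "\<kappa> * ((1 + t) powr (- (m * (z - 1))) * B powr z) \<le> (d * D powr (1 - z)) * ((1 + t) powr (- (m * (z - 1))) * B powr z)"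
          using d(2) by (rule mult_right_mono) simp
        ultimately show "\<kappa> * (1 + t) powr (- (m * (z - 1))) * (exp (- \<nu> * t) * pairing (wt t) P) powr z
            \<le> exp (- \<nu> * t) * (\<integral>x. G (wt t x) * P x \<partial>lebesgue)"
          unfolding B_def[symmetric] by (simp add: mult.assoc)
      qed
    qed
    have cont: "continuous_on {0..T1} (\<lambda>t. exp (- \<nu> * t) * pairing (wt t) P)"
      if "C1_L2 ?J w wt" for w wt :: "real \<Rightarrow> 'a \<Rightarrow> real"
      using that by (intro continuous_intros continuous_on_subset[OF continuous_L2_pairing[OF _ PL2] subJ]) (simp add: C1_L2_def)
    have integ: "set_integrable lebesgue {0..T1} (\<lambda>t. exp (- \<nu> * t) * pairing (F t) P)"
      if "Bochner_L1_L1 ?J F" for F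
    proof (intro set_integrable_continuous_mult continuous_intros)
      show "set_integrable lebesgue {0..T1} (\<lambda>t. pairing (F t) P)"
        by (rule set_integrable_subset[OF Bochner_L1_L1_pairing[OF that time_interval_lebesgue P(1)] _ subJ]) simp
    qed
    have lower: "exp (- \<nu> * t) * pairing (wt t) P \<ge>
        1 / 2 * (\<epsilon> * c0 + (LINT s:{0..t}|lebesgue. exp (- \<nu> * s) * pairing (F s) P))"
      if w: "weak_wave_eq T wt Dw F (\<lambda>x. \<epsilon> * g x)" "continuous_H1 ?J w Dw" "C1_L2 ?J w wt"
          "\<And>t. t \<in> ?J \<Longrightarrow> AE x in lebesgue. norm x > R + t \<longrightarrow> w t x = 0"
          "Bochner_L1_L1 ?J F" "\<And>s x. F s x \<ge> 0" "AE x in lebesgue. w 0 x = \<epsilon> * f x" "f \<in> Cc_infty"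
          "\<And>x. f x \<noteq> 0 \<Longrightarrow> norm x \<le> R" "\<And>x. g x \<noteq> 0 \<Longrightarrow> norm x \<le> R"
          "c0 \<le> (\<integral>x. g x * ?\<phi> \<nu> x \<partial>lebesgue) - \<nu> * \<bar>\<integral>x. f x * ?\<phi> \<nu> x \<partial>lebesgue\<bar>"
        and t: "t \<in> {0..T1}"
      for w wt F :: "real \<Rightarrow> 'a \<Rightarrow> real" and Dw f g t
    proof (rule wave_component_lower_bound[OF w(1-3) P(1,2) _ _ _ T2(2) _ w(4-6)])
      show "laplacian P x = \<nu>\<^sup>2 * P x" if "norm x < R + T2 + 1" for x
        using that by (intro P(4)) (simp add: \<rho>_def)
      have w0: "w 0 \<in> L2" using w(3) J0 by (simp add: C1_L2_def continuous_L2_def)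
      have "\<epsilon> * c0 \<le> \<epsilon> * ((\<integral>x. g x * ?\<phi> \<nu> x \<partial>lebesgue) - \<nu> * \<bar>\<integral>x. f x * ?\<phi> \<nu> x \<partial>lebesgue\<bar>)"
        using w(11) \<epsilon> by simp
      also have "\<dots> = (\<integral>x. (\<epsilon> * g x) * P x \<partial>lebesgue) - \<nu> * \<bar>pairing (w 0) P\<bar>"
      proof -
        have scale: "\<epsilon> * (I - \<nu> * \<bar>K\<bar>) = \<epsilon> * I - \<nu> * \<bar>\<epsilon> * K\<bar>" for I K :: real
          using \<epsilon> by (simp add: abs_mult algebra_simps)
        have "(\<integral>x. (\<epsilon> * g x) * P x \<partial>lebesgue) = \<epsilon> * (\<integral>x. g x * ?\<phi> \<nu> x \<partial>lebesgue)"
          by (rule pairing) (rule w(10))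
        moreover have "pairing (w 0) P = \<epsilon> * (\<integral>x. f x * ?\<phi> \<nu> x \<partial>lebesgue)"
          by (rule initial[OF w(7) w0 w(8)]) (rule w(9))
        ultimately show ?thesis by (simp only: scale)
      qed
      finally show "\<epsilon> * c0 \<le> \<dots>" .
    qed (use t T2 \<nu> \<epsilon> c0 in simp_all)
    have nn: "exp (- \<nu> * t) * pairing F P \<ge> 0" if "\<And>x. F x \<ge> 0" for t F
      by (intro mult_nonneg_nonneg Bochner_Integration.integral_nonneg that P(2)) simp
    show ?thesis
    proof (rule ode_supersolution_from_integral_inequalities[where A="?A" and B="?B" and f="?f" and h="?h", OF T1(1) p q])
      show "?A t \<ge> 1 / 2 * (\<epsilon> * c0 + (LINT s:{0..t}|lebesgue. ?f s))" if "t \<in> {0..T1}" for t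
        by (rule lower[OF s(9,1,2) zu s(6) G1n s(7) data(1) _ _ _ that]) (use M R in \<open>force simp: c0_def\<close>)+
      show "?B t \<ge> 1 / 2 * (\<epsilon> * c0 + (LINT s:{0..t}|lebesgue. ?h s))" if "t \<in> {0..T1}" for t
        by (rule lower[OF s(10,3,4) zv s(5) G2n s(8) data(3) _ _ _ that]) (use M R in \<open>force simp: c0_def\<close>)+
      show "AE t in lebesgue. t \<in> {0..T1} \<longrightarrow> ?B t > 0 \<longrightarrow> ?f t \<ge> \<kappa> * (1 + t) powr (- (m * (p - 1))) * ?B t powr p"
        by (rule jensen[OF s(4) zv s(6) p a _ G1 G0(1)]) (simp_all add: \<kappa>_def)
      show "AE t in lebesgue. t \<in> {0..T1} \<longrightarrow> ?A t > 0 \<longrightarrow> ?h t \<ge> \<kappa> * (1 + t) powr (- (m * (q - 1))) * ?A t powr q"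
        by (rule jensen[OF s(2) zu s(5) q b _ G2 G0(2)]) (simp_all add: \<kappa>_def)
      show "?f t \<ge> 0" "?h t \<ge> 0" for t by (intro nn G1n G2n)+
    qed (use \<epsilon> c0 \<kappa> cont[OF s(2)] cont[OF s(4)] integ[OF s(5)] integ[OF s(6)] in auto)
  qed
  then show ?thesis using \<kappa> c0
    by (intro exI[of _ "\<kappa> / 2"] conjI exI[of _ "c0 / 2"]) (auto simp: mult.commute)
qed

text \<open>Since the denominator \<open>p * q - 1\<close> is symmetric, the larger exponent decides
  which function attains the maximum. Cases in which it is \<open>F_GG N q p\<close> follow by
  exchanging the roles of \<open>X\<close> and \<open>Y\<close>.\<close>

lemma ode_lifespan:
  fixes p q \<kappa> c :: real and N :: nat
  assumes p: "p > 1" and q: "q > 1" and \<kappa>: "\<kappa> > 0" and c: "c > 0" and N: "N \<ge> 1"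
  defines "m \<equiv> (real N - 1) / 2"
  assumes \<Gamma>0: "\<Gamma>_GG N p q \<ge> 0"
  shows "\<exists>\<epsilon>\<^sub>0>0. \<exists>C>0. \<forall>\<epsilon> S X Y. 0 < \<epsilon> \<and> \<epsilon> \<le> \<epsilon>\<^sub>0 \<and> S \<ge> 1 \<and> ode_supersolution p q \<kappa> m S X Y \<and>
      X 1 = c * \<epsilon> \<and> Y 1 = c * \<epsilon> \<longrightarrow>
      (\<Gamma>_GG N p q > 0 \<longrightarrow> S \<le> C * \<epsilon> powr (- inverse (\<Gamma>_GG N p q))) \<and>
      (\<Gamma>_GG N p q = 0 \<and> p \<noteq> q \<longrightarrow> S \<le> exp (C * \<epsilon> powr (- (p * q - 1)))) \<and>
      (\<Gamma>_GG N p q = 0 \<and> p = q \<longrightarrow> S \<le> exp (C * \<epsilon> powr (- (p - 1))))"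
proof -
  have m: "m \<ge> 0" using N by (simp add: m_def)
  have pq: "p * q > 1" by (rule less_1_mult[OF p q])
  have F: "F_GG N p q = (p + 1) / (p * q - 1) - m" "F_GG N q p = (q + 1) / (q * p - 1) - m"
    by (simp_all add: F_GG_def m_def)
  have witness: ?thesis if "\<epsilon>\<^sub>0 > 0" "C > 0"
      "\<And>\<epsilon> S X Y. 0 < \<epsilon> \<Longrightarrow> \<epsilon> \<le> \<epsilon>\<^sub>0 \<Longrightarrow> S \<ge> 1 \<Longrightarrow> ode_supersolution p q \<kappa> m S X Y \<Longrightarrow> X 1 = c * \<epsilon> \<Longrightarrow> Y 1 = c * \<epsilon> \<Longrightarrow>
        (\<Gamma>_GG N p q > 0 \<longrightarrow> S \<le> C * \<epsilon> powr (- inverse (\<Gamma>_GG N p q))) \<and>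
        (\<Gamma>_GG N p q = 0 \<and> p \<noteq> q \<longrightarrow> S \<le> exp (C * \<epsilon> powr (- (p * q - 1)))) \<and>
        (\<Gamma>_GG N p q = 0 \<and> p = q \<longrightarrow> S \<le> exp (C * \<epsilon> powr (- (p - 1))))" for \<epsilon>\<^sub>0 C
    using that by blast
  consider "\<Gamma>_GG N p q > 0" "\<Gamma>_GG N p q = F_GG N p q" | "\<Gamma>_GG N p q > 0" "\<Gamma>_GG N p q = F_GG N q p"
    | "\<Gamma>_GG N p q = 0" "p = q" | "\<Gamma>_GG N p q = 0" "p > q" | "\<Gamma>_GG N p q = 0" "q > p"
  proof -
    have "\<Gamma>_GG N p q > 0 \<or> \<Gamma>_GG N p q = 0" using \<Gamma>0 by auto
    moreover have "\<Gamma>_GG N p q = F_GG N p q \<or> \<Gamma>_GG N p q = F_GG N q p" by (simp add: \<Gamma>_GG_def max_def)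
    moreover have "p = q \<or> p > q \<or> q > p" by auto
    ultimately show thesis using that by blast
  qed
  then show ?thesis
  proof cases
    case 1
    then have "(p + 1) / (p * q - 1) - m > 0" using F by simp
    from subcritical_lifespan[OF p q \<kappa> m this c] obtain \<epsilon>\<^sub>0 C where "\<epsilon>\<^sub>0 > 0" "C > 0"
      "\<And>\<epsilon> S X Y. 0 < \<epsilon> \<Longrightarrow> \<epsilon> \<le> \<epsilon>\<^sub>0 \<Longrightarrow> ode_supersolution p q \<kappa> m S X Y \<Longrightarrow> X 1 \<ge> c * \<epsilon> \<Longrightarrow> Y 1 \<ge> c * \<epsilon> \<Longrightarrow>
        S \<le> C * \<epsilon> powr (- inverse (\<Gamma>_GG N p q))"
      unfolding 1(2) F by blast
    then show ?thesis using 1(1) by (intro witness[of \<epsilon>\<^sub>0 C]) auto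
  next
    case 2
    then have "(q + 1) / (q * p - 1) - m > 0" using F by simp
    from subcritical_lifespan[OF q p \<kappa> m this c] obtain \<epsilon>\<^sub>0 C where "\<epsilon>\<^sub>0 > 0" "C > 0"
      "\<And>\<epsilon> S X Y. 0 < \<epsilon> \<Longrightarrow> \<epsilon> \<le> \<epsilon>\<^sub>0 \<Longrightarrow> ode_supersolution q p \<kappa> m S X Y \<Longrightarrow> X 1 \<ge> c * \<epsilon> \<Longrightarrow> Y 1 \<ge> c * \<epsilon> \<Longrightarrow>
        S \<le> C * \<epsilon> powr (- inverse (\<Gamma>_GG N p q))"
      unfolding 2(2) F by blast
    then show ?thesis using 2(1) ode_supersolution_swap[of p q \<kappa> m]
      by (intro witness[of \<epsilon>\<^sub>0 C]) fastforce+
  next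
    case 3
    have "(p + 1) / (p * p - 1) = 1 / (p - 1)"
    proof -
      have 1: "p * p - 1 = (p + 1) * (p - 1)" by (simp add: algebra_simps)
      have "(p + 1) / ((p + 1) * (p - 1)) = 1 / (p - 1)" using p by simp
      then show ?thesis by (simp only: 1)
    qed
    then have "m = 1 / (p - 1)" using 3 F by (simp add: \<Gamma>_GG_def)
    from critical_symmetric_lifespan[OF p \<kappa> this c] obtain C where "C > 0"
      "\<And>\<epsilon> S X Y. 0 < \<epsilon> \<Longrightarrow> S \<ge> 1 \<Longrightarrow> ode_supersolution p p \<kappa> m S X Y \<Longrightarrow> X 1 \<ge> c * \<epsilon> \<Longrightarrow> Y 1 \<ge> c * \<epsilon> \<Longrightarrow>
        S \<le> exp (C * \<epsilon> powr (- (p - 1)))"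
      by blast
    then show ?thesis using 3 by (intro witness[of 1 C]) auto
  next
    case 4
    then have "(q + 1) / (q * p - 1) \<le> (p + 1) / (p * q - 1)"
      using pq by (simp add: mult.commute divide_right_mono)
    then have "m = (p + 1) / (p * q - 1)" using 4 F by (simp add: \<Gamma>_GG_def)
    moreover have "q \<le> p" using 4 by simp
    ultimately obtain \<epsilon>\<^sub>0 C where "\<epsilon>\<^sub>0 > 0" "C > 0"
      "\<And>\<epsilon> S X Y. 0 < \<epsilon> \<Longrightarrow> \<epsilon> \<le> \<epsilon>\<^sub>0 \<Longrightarrow> ode_supersolution p q \<kappa> m S X Y \<Longrightarrow> X 1 \<ge> c * \<epsilon> \<Longrightarrow> Y 1 \<ge> c * \<epsilon> \<Longrightarrow>
        S \<le> exp (C * \<epsilon> powr (- (p * q - 1)))"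
      using critical_lifespan[OF p q \<kappa> m _ _ c] by blast
    then show ?thesis using 4 by (intro witness[of \<epsilon>\<^sub>0 C]) auto
  next
    case 5
    then have "(p + 1) / (p * q - 1) \<le> (q + 1) / (q * p - 1)"
      using pq by (simp add: mult.commute divide_right_mono)
    then have "m = (q + 1) / (q * p - 1)" using 5 F by (simp add: \<Gamma>_GG_def)
    moreover have "p \<le> q" using 5 by simp
    ultimately obtain \<epsilon>\<^sub>0 C where *: "\<epsilon>\<^sub>0 > 0" "C > 0"
      "\<And>\<epsilon> S X Y. 0 < \<epsilon> \<Longrightarrow> \<epsilon> \<le> \<epsilon>\<^sub>0 \<Longrightarrow> ode_supersolution q p \<kappa> m S X Y \<Longrightarrow> X 1 \<ge> c * \<epsilon> \<Longrightarrow> Y 1 \<ge> c * \<epsilon> \<Longrightarrow>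
        S \<le> exp (C * \<epsilon> powr (- (q * p - 1)))"
      using critical_lifespan[OF q p \<kappa> m _ _ c] by blast
    have "S \<le> exp (C * \<epsilon> powr (- (p * q - 1)))"
      if "0 < \<epsilon>" "\<epsilon> \<le> \<epsilon>\<^sub>0" "ode_supersolution p q \<kappa> m S X Y" "X 1 = c * \<epsilon>" "Y 1 = c * \<epsilon>" for \<epsilon> S X Y
      using *(3)[of \<epsilon> S Y X] ode_supersolution_swap[OF that(3)] that by (simp add: mult.commute)
    then show ?thesis using 5 *(1,2) by (intro witness[of \<epsilon>\<^sub>0 C]) auto
  qed
qed

text \<open>The end time may be infinite, so it is approached through finite times below it.
  Nonnegativity of \<open>B\<close> makes any time between \<open>B\<close> and \<open>T\<close>
  positive.\<close>

lemma lifespan_le: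
  fixes T :: ereal
  assumes "\<And>T1. 0 < T1 \<Longrightarrow> ereal T1 < T \<Longrightarrow> 1 + T1 \<le> B"
    and "B \<ge> 0"
  shows "T \<le> ereal B"
proof (rule ccontr)
  assume "\<not> ?thesis"
  then have "ereal B < T" by simp
  then obtain T1 where "B < T1" "ereal T1 < T" using ereal_dense2 by fastforce
  then show False using assms(1)[of T1] assms(2) by auto
qed

theorem proposition8p1:
  fixes p q a b r\<^sub>0 :: real
    and G\<^sub>1 G\<^sub>2 :: "real \<Rightarrow> real"
    and f\<^sub>1 g\<^sub>1 f\<^sub>2 g\<^sub>2 :: "real ^ 'n \<Rightarrow> real"
  assumes "p > 1" and "q > 1" and "a > 0" and "b > 0"
    and "G\<^sub>1 C1_differentiable_on UNIV" and "G\<^sub>2 C1_differentiable_on UNIV"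
    and "G\<^sub>1 0 = 0" and "G\<^sub>2 0 = 0"
    and "\<And>\<sigma>. G\<^sub>1 \<sigma> \<ge> a * \<bar>\<sigma>\<bar> powr p"
    and "\<And>\<sigma>. G\<^sub>2 \<sigma> \<ge> b * \<bar>\<sigma>\<bar> powr q"
    and "f\<^sub>1 \<in> Cc_infty" and "g\<^sub>1 \<in> Cc_infty" and "f\<^sub>2 \<in> Cc_infty" and "g\<^sub>2 \<in> Cc_infty"
    and "(\<integral>x. g\<^sub>1 x \<partial>lebesgue) > 0" and "(\<integral>x. g\<^sub>2 x \<partial>lebesgue) > 0"
    and "r\<^sub>0 = Sup (norm ` (supp f\<^sub>1 \<union> supp f\<^sub>2 \<union> supp g\<^sub>1 \<union> supp g\<^sub>2))"
    and "\<Gamma>_GG CARD('n) p q \<ge> 0"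
  shows "\<exists>\<epsilon>\<^sub>0>0. \<exists>C>0. \<forall>\<epsilon>. 0 < \<epsilon> \<and> \<epsilon> \<le> \<epsilon>\<^sub>0 \<longrightarrow>
    (\<forall>(T::ereal) (u :: real \<Rightarrow> real ^ 'n \<Rightarrow> real) v.
       weak_solution G\<^sub>1 G\<^sub>2 \<epsilon> f\<^sub>1 g\<^sub>1 f\<^sub>2 g\<^sub>2 T u v \<and>
       spacetime_supp T u \<union> spacetime_supp T v
         \<subseteq> {(x, t). t \<in> time_interval T \<and> norm x \<le> r\<^sub>0 + t} \<longrightarrow>
       (\<Gamma>_GG CARD('n) p q > 0 \<longrightarrow>
          T \<le> ereal (C * \<epsilon> powr (- inverse (\<Gamma>_GG CARD('n) p q)))) \<and>
       (\<Gamma>_GG CARD('n) p q = 0 \<and> p \<noteq> q \<longrightarrow>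
          T \<le> ereal (exp (C * \<epsilon> powr (- (p * q - 1))))) \<and>
       (\<Gamma>_GG CARD('n) p q = 0 \<and> p = q \<longrightarrow>
          T \<le> ereal (exp (C * \<epsilon> powr (- (p - 1))))))"
proof -
  let ?N = "CARD('n)"
  let ?m = "(real ?N - 1) / 2"
  obtain \<kappa> c where \<kappa>: "\<kappa> > 0" and c: "c > 0" and ode: "\<And>\<epsilon> T1 T (u :: real \<Rightarrow> real ^ 'n \<Rightarrow> real) v.
      0 < \<epsilon> \<Longrightarrow> 0 < T1 \<Longrightarrow> ereal T1 < T \<Longrightarrow> weak_solution G\<^sub>1 G\<^sub>2 \<epsilon> f\<^sub>1 g\<^sub>1 f\<^sub>2 g\<^sub>2 T u v \<Longrightarrow>
      spacetime_supp T u \<union> spacetime_supp T v \<subseteq> {(x, t). t \<in> time_interval T \<and> norm x \<le> r\<^sub>0 + t} \<Longrightarrow>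
      \<exists>X Y. ode_supersolution p q \<kappa> ?m (1 + T1) X Y \<and> X 1 = c * \<epsilon> \<and> Y 1 = c * \<epsilon>"
    using weak_solution_ode_supersolution[OF assms(1-4,7-16), of r\<^sub>0] by (auto simp only: DIM_cart DIM_real mult_1_right)
  have N: "?N \<ge> 1" by (simp add: Suc_leI)
  from ode_lifespan[OF assms(1,2) \<kappa> c N assms(18)]
  obtain \<epsilon>\<^sub>0 C where \<epsilon>\<^sub>0: "\<epsilon>\<^sub>0 > 0" and C: "C > 0" and life: "\<And>\<epsilon> S X Y. 0 < \<epsilon> \<and> \<epsilon> \<le> \<epsilon>\<^sub>0 \<and> S \<ge> 1 \<and>
      ode_supersolution p q \<kappa> ?m S X Y \<and> X 1 = c * \<epsilon> \<and> Y 1 = c * \<epsilon> \<Longrightarrow>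
      (\<Gamma>_GG ?N p q > 0 \<longrightarrow> S \<le> C * \<epsilon> powr (- inverse (\<Gamma>_GG ?N p q))) \<and>
      (\<Gamma>_GG ?N p q = 0 \<and> p \<noteq> q \<longrightarrow> S \<le> exp (C * \<epsilon> powr (- (p * q - 1)))) \<and>
      (\<Gamma>_GG ?N p q = 0 \<and> p = q \<longrightarrow> S \<le> exp (C * \<epsilon> powr (- (p - 1))))"
    by blast
  show ?thesis
  proof (rule exI[of _ \<epsilon>\<^sub>0], rule conjI[OF \<epsilon>\<^sub>0], rule exI[of _ C], rule conjI[OF C], intro allI impI, elim conjE)
    fix \<epsilon> :: real and T :: ereal and u v :: "real \<Rightarrow> real ^ 'n \<Rightarrow> real"
    assume \<epsilon>: "0 < \<epsilon>" "\<epsilon> \<le> \<epsilon>\<^sub>0" and sol: "weak_solution G\<^sub>1 G\<^sub>2 \<epsilon> f\<^sub>1 g\<^sub>1 f\<^sub>2 g\<^sub>2 T u v"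
      and spt: "spacetime_supp T u \<union> spacetime_supp T v \<subseteq> {(x, t). t \<in> time_interval T \<and> norm x \<le> r\<^sub>0 + t}"
    have bound: "(\<Gamma>_GG ?N p q > 0 \<longrightarrow> 1 + T1 \<le> C * \<epsilon> powr (- inverse (\<Gamma>_GG ?N p q))) \<and>
      (\<Gamma>_GG ?N p q = 0 \<and> p \<noteq> q \<longrightarrow> 1 + T1 \<le> exp (C * \<epsilon> powr (- (p * q - 1)))) \<and>
      (\<Gamma>_GG ?N p q = 0 \<and> p = q \<longrightarrow> 1 + T1 \<le> exp (C * \<epsilon> powr (- (p - 1))))"
      if T1: "0 < T1" "ereal T1 < T" for T1
    proof -
      obtain X Y where "ode_supersolution p q \<kappa> ?m (1 + T1) X Y \<and> X 1 = c * \<epsilon> \<and> Y 1 = c * \<epsilon>"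
        using ode[OF \<epsilon>(1) T1 sol spt] by blast
      then show ?thesis using \<epsilon> T1 by (intro life) simp
    qed
    show "(\<Gamma>_GG ?N p q > 0 \<longrightarrow> T \<le> ereal (C * \<epsilon> powr (- inverse (\<Gamma>_GG ?N p q)))) \<and>
       (\<Gamma>_GG ?N p q = 0 \<and> p \<noteq> q \<longrightarrow> T \<le> ereal (exp (C * \<epsilon> powr (- (p * q - 1))))) \<and>
       (\<Gamma>_GG ?N p q = 0 \<and> p = q \<longrightarrow> T \<le> ereal (exp (C * \<epsilon> powr (- (p - 1)))))"
    proof (intro conjI impI)
      assume \<Gamma>: "\<Gamma>_GG ?N p q > 0"
      show "T \<le> ereal (C * \<epsilon> powr (- inverse (\<Gamma>_GG ?N p q)))"
      proof (rule lifespan_le)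
        show "1 + T1 \<le> C * \<epsilon> powr (- inverse (\<Gamma>_GG ?N p q))" if "0 < T1" "ereal T1 < T" for T1
          by (rule mp[OF bound[OF that, THEN conjunct1] \<Gamma>])
        show "0 \<le> C * \<epsilon> powr (- inverse (\<Gamma>_GG ?N p q))"
          by (rule mult_nonneg_nonneg[OF less_imp_le[OF C] powr_ge_zero])
      qed
    next
      assume \<Gamma>: "\<Gamma>_GG ?N p q = 0 \<and> p \<noteq> q"
      show "T \<le> ereal (exp (C * \<epsilon> powr (- (p * q - 1))))"
      proof (rule lifespan_le)
        show "1 + T1 \<le> exp (C * \<epsilon> powr (- (p * q - 1)))" if "0 < T1" "ereal T1 < T" for T1
          by (rule mp[OF bound[OF that, THEN conjunct2, THEN conjunct1] \<Gamma>])
      qed simp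
    next
      assume \<Gamma>: "\<Gamma>_GG ?N p q = 0 \<and> p = q"
      show "T \<le> ereal (exp (C * \<epsilon> powr (- (p - 1))))"
      proof (rule lifespan_le)
        show "1 + T1 \<le> exp (C * \<epsilon> powr (- (p - 1)))" if "0 < T1" "ereal T1 < T" for T1
          by (rule mp[OF bound[OF that, THEN conjunct2, THEN conjunct2] \<Gamma>])
      qed simp
    qed
  qed
qed

end
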